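(* Let $m,L\in\mathbb{N}$ and fix $x^{(m)}\in\mathrm{Conf}_m(\mathbb{R})$. Consider the point process on $\mathrm{Conf}(\mathbb{R})=\prod_{n=m+1}^{m+L}\mathrm{Conf}_n(\mathbb{R})$ (viewed as a point process on $\{m+1,\dots,m+L\}\times\mathbb{R}$) whose measure is defined by a weight function (density up to normalization) of the form $$W(X,x^{(m)})\propto\det\big[\upsilon_i(x_j^{(m)}|m)\big]_{i,j=1}^{m}\Big(\prod_{k=m+1}^{m+L}\det\big[\varphi(x_i^{(k-1)},x_j^{(k)})\big]_{i,j=1}^{k}\Big)\det\big[\psi_i(x_j^{(m+L)}|m+L)\big]_{i,j=1}^{m+L},\quad X=(x^{(m+1)},\dots,x^{(m+L)}).$$ This point process is determinantal and, if the Gram matrix $G$ is invertible, then for all $x_1,x_2\in\mathbb{R}$ and $n_1,n_2\in\{m+1,\dots,m+L\}$ its correlation kernel is $$K(n_1,x_1;n_2,x_2)=-\varphi^{(n_1,n_2)}(x_1,x_2)+\sum_{i=1}^m\sum_{j=1}^{m+L}[G^{-t}]_{ij}\,\upsilon_i(x_2|n_2)\,\psi_j(x_1|n_1)+\sum_{i=m+1}^{n_2}\sum_{j=1}^{m+L}[G^{-t}]_{ij}\,(\varphi\star\varphi^{(i,n_2)})(\mathrm{virt},x_2)\,\psi_j(x_1|n_1).$$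
   Context: $\mathrm{Conf}_n(\mathbb{R})$ is the set of ordered $n$-tuples $x_1^{(n)}\ge\dots\ge x_n^{(n)}$ of reals, with the formal convention that there is an $(n+1)$-st "virtual" entry $x_{n+1}^{(n)}=\mathrm{virt}$ (so in the $k$-th determinant, the last row is $\varphi(\mathrm{virt},x_j^{(k)})$). The given functions are $\varphi:\mathbb{R}\times\mathbb{R}\to\mathbb{C}$, $\varphi(\mathrm{virt},\cdot):\mathbb{R}\to\mathbb{C}$, $\psi_j(\cdot|m+L):\mathbb{R}\to\mathbb{C}$ for $1\le j\le m+L$, and $\upsilon_i(\cdot|m):\{x_j^{(m)}\}_{j=1}^m\to\mathbb{C}$ for $1\le i\le m$. The reference measure is counting measure on levels times Lebesgue measure on $\mathbb{R}$. All sums and integrals below are assumed to converge absolutely and the total weight to be finite and nonzero. Convolutions: $(f\star g)(x,y)=\int_{\mathbb{R}}f(x,z)g(z,y)dz$; $(g\star h)(x)=\int_{\mathbb{R}} g(x,y)h(y)dy$; $(h\star g)(y)=\int_{\mathbb{R}} h(x)g(x,y)dx$; and if $f$ is defined on a finite set $S\subset\mathbb{R}$, $(f\star g)(y)=\sum_{x\in S}f(x)g(x,y)$. Convolving zero times leaves a function unchanged; $f\star h$ of two one-variable functions is $\int f h$ (or the sum over $S$). For $r,n\in\{m,\dots,m+L\}$: - $\varphi^{(n,r)}(x,y)=\mathbf 1_{n<r}(\varphi\star\cdots\star\varphi)(x,y)$ with $r-n$ factors; - $(\varphi\star\varphi^{(n,r)})(\mathrm{virt},x)=\mathbf 1_{n\le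 r}\big(\varphi(\mathrm{virt},\cdot)\star\varphi\star\cdots\star\varphi\big)(x)$ with $r-n$ factors $\varphi$ after the first; - $\upsilon_i(x|r)=(\upsilon_i(\cdot|m)\star\varphi\star\cdots\star\varphi)(x)$ with $r-m$ factors $\varphi$; - $\psi_j(x|r)=(\varphi\star\cdots\star\varphi\star\psi_j(\cdot|m+L))(x)$ with $m+L-r$ factors $\varphi$. The Gram matrix is the $(m+L)\times(m+L)$ matrix with $G_{ij}=\upsilon_i(\cdot|m)\star\varphi^{(m,m+L)}\star\psi_j(\cdot|m+L)$ for $1\le i\le m$ and $G_{ij}=(\varphi\star\varphi^{(i,m+L)})(\mathrm{virt},\cdot)\star\psi_j(\cdot|m+L)$ for $m+1\le i\le m+L$. $G^{-t}$ is the inverse transpose of $G$. A point process is determinantal with kernel $K$ if its $n$-point correlation functions with respect to the reference measure are $\det[K(p_i,p_j)]_{i,j=1}^n$ for all $n$. *)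

theory Defs
  imports
    "HOL-Analysis.Analysis"
    "Jordan_Normal_Form.Gauss_Jordan_Elimination"
    "Jordan_Normal_Form.Determinant"
begin

text \<open>All families are indexed from 1; only the underlying matrices of
  Jordan_Normal_Form are indexed from 0.\<close>

definition det1 :: "nat \<Rightarrow> (nat \<Rightarrow> nat \<Rightarrow> complex) \<Rightarrow> complex" where
  "det1 n a = Determinant.det (Matrix.mat n n (\<lambda>(i, j). a (Suc i) (Suc j)))"


section \<open>Convolutions\<close>

definition conv2 :: "(real \<Rightarrow> real \<Rightarrow> complex) \<Rightarrow> (real \<Rightarrow> real \<Rightarrow> complex) \<Rightarrow> real \<Rightarrow> real \<Rightarrow> complex" where
  "conv2 f g x y = (LINT z|lborel. f x z * g z y)"

definition conv_right :: "(real \<Rightarrow> real \<Rightarrow> complex) \<Rightarrow> (real \<Rightarrow> complex) \<Rightarrow> real \<Rightarrow> complex" where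
  "conv_right g h x = (LINT y|lborel. g x y * h y)"

definition conv_left :: "(real \<Rightarrow> complex) \<Rightarrow> (real \<Rightarrow> real \<Rightarrow> complex) \<Rightarrow> real \<Rightarrow> complex" where
  "conv_left h g y = (LINT x|lborel. h x * g x y)"

definition conv_fin :: "real set \<Rightarrow> (real \<Rightarrow> complex) \<Rightarrow> (real \<Rightarrow> real \<Rightarrow> complex) \<Rightarrow> real \<Rightarrow> complex" where
  "conv_fin S f g y = (\<Sum>x\<in>S. f x * g x y)"

definition conv_pair :: "(real \<Rightarrow> complex) \<Rightarrow> (real \<Rightarrow> complex) \<Rightarrow> complex" where
  "conv_pair f h = (LINT x|lborel. f x * h x)"

text \<open>\<open>\<phi>v\<close> stands for the function \<open>\<phi>(virt, _)\<close>, \<open>\<upsilon> i\<close> for \<open>\<upsilon>\<^sub>i(_|m)\<close> (of which only the values on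
  the finite set \<open>S\<close> of entries of the fixed configuration are ever used), and \<open>\<psi> j\<close> for
  \<open>\<psi>\<^sub>j(_|m+L)\<close>. The four definitions below are \<open>\<phi>\<^sup>(\<^sup>n\<^sup>,\<^sup>r\<^sup>)(x,y)\<close>, \<open>(\<phi> * \<phi>\<^sup>(\<^sup>n\<^sup>,\<^sup>r\<^sup>))(virt,x)\<close>,
  \<open>\<upsilon>\<^sub>i(x|r)\<close> and \<open>\<psi>\<^sub>j(x|r)\<close>.\<close>

definition phi_conv :: "(real \<Rightarrow> real \<Rightarrow> complex) \<Rightarrow> nat \<Rightarrow> nat \<Rightarrow> real \<Rightarrow> real \<Rightarrow> complex" where
  "phi_conv \<phi> n r x y = (if n < r then ((\<lambda>f. conv2 f \<phi>) ^^ (r - n - 1)) \<phi> x y else 0)"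

definition phi_virt ::
  "(real \<Rightarrow> real \<Rightarrow> complex) \<Rightarrow> (real \<Rightarrow> complex) \<Rightarrow> nat \<Rightarrow> nat \<Rightarrow> real \<Rightarrow> complex" where
  "phi_virt \<phi> \<phi>v n r x = (if n \<le> r then ((\<lambda>h. conv_left h \<phi>) ^^ (r - n)) \<phi>v x else 0)"

text \<open>Only the first of the \<open>r - m\<close> convolutions is a sum over \<open>S\<close>; the others are integrals.\<close>

definition upsilon_conv ::
  "nat \<Rightarrow> real set \<Rightarrow> (real \<Rightarrow> real \<Rightarrow> complex) \<Rightarrow> (nat \<Rightarrow> real \<Rightarrow> complex) \<Rightarrow> nat \<Rightarrow> nat \<Rightarrow> real \<Rightarrow> complex"
where
  "upsilon_conv m S \<phi> \<upsilon> i r x =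
     (if r = m then \<upsilon> i x
      else ((\<lambda>h. conv_left h \<phi>) ^^ (r - m - 1)) (conv_fin S (\<upsilon> i) \<phi>) x)"

definition psi_conv ::
  "nat \<Rightarrow> nat \<Rightarrow> (real \<Rightarrow> real \<Rightarrow> complex) \<Rightarrow> (nat \<Rightarrow> real \<Rightarrow> complex) \<Rightarrow> nat \<Rightarrow> nat \<Rightarrow> real \<Rightarrow> complex"
where
  "psi_conv m L \<phi> \<psi> j r x = ((conv_right \<phi>) ^^ (m + L - r)) (\<psi> j) x"

definition gram ::
  "nat \<Rightarrow> nat \<Rightarrow> real set \<Rightarrow> (real \<Rightarrow> real \<Rightarrow> complex) \<Rightarrow> (real \<Rightarrow> complex) \<Rightarrow>
   (nat \<Rightarrow> real \<Rightarrow> complex) \<Rightarrow> (nat \<Rightarrow> real \<Rightarrow> complex) \<Rightarrow> complex mat"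
where
  "gram m L S \<phi> \<phi>v \<upsilon> \<psi> = Matrix.mat (m + L) (m + L) (\<lambda>(i0, j0).
     let i = Suc i0; j = Suc j0 in
       if i \<le> m then conv_pair (conv_fin S (\<upsilon> i) (phi_conv \<phi> m (m + L))) (\<psi> j)
       else conv_pair (phi_virt \<phi> \<phi>v i (m + L)) (\<psi> j))"

text \<open>Absolute convergence of all the (multiple) integrals above. The convolutions are formed with
  the absolute values of the given functions, and every one-dimensional integral occurring in
  them is required to exist. By Tonelli this is absolute convergence of the full multiple
  integrals, which is stronger than integrability of the successive integrands with the signed
  inner integrals.\<close>

definition convolutions_converge ::
  "nat \<Rightarrow> nat \<Rightarrow> real set \<Rightarrow> (real \<Rightarrow> real \<Rightarrow> complex) \<Rightarrow> (real \<Rightarrow> complex) \<Rightarrow>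
   (nat \<Rightarrow> real \<Rightarrow> complex) \<Rightarrow> (nat \<Rightarrow> real \<Rightarrow> complex) \<Rightarrow> bool"
where
  "convolutions_converge m L S \<phi> \<phi>v \<upsilon> \<psi> \<longleftrightarrow>
    (let a\<phi> = (\<lambda>x y. of_real (norm (\<phi> x y)));
         a\<phi>v = (\<lambda>x. of_real (norm (\<phi>v x)));
         a\<upsilon> = (\<lambda>i x. of_real (norm (\<upsilon> i x)));
         a\<psi> = (\<lambda>j x. of_real (norm (\<psi> j x)))
     in
       (\<forall>n r x y. m \<le> n \<and> n < r \<and> r < m + L \<longrightarrow>
          integrable lborel (\<lambda>z. phi_conv a\<phi> n r x z * a\<phi> z y)) \<and>
       (\<forall>n r y. m < n \<and> n \<le> r \<and> r < m + L \<longrightarrow>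
          integrable lborel (\<lambda>z. phi_virt a\<phi> a\<phi>v n r z * a\<phi> z y)) \<and>
       (\<forall>i r y. 1 \<le> i \<and> i \<le> m \<and> m < r \<and> r < m + L \<longrightarrow>
          integrable lborel (\<lambda>z. upsilon_conv m S a\<phi> a\<upsilon> i r z * a\<phi> z y)) \<and>
       (\<forall>j r x. 1 \<le> j \<and> j \<le> m + L \<and> m < r \<and> r \<le> m + L \<longrightarrow>
          integrable lborel (\<lambda>z. a\<phi> x z * psi_conv m L a\<phi> a\<psi> j r z)) \<and>
       (\<forall>i j. 1 \<le> i \<and> i \<le> m \<and> 1 \<le> j \<and> j \<le> m + L \<longrightarrow>
          integrable lborel (\<lambda>z. conv_fin S (a\<upsilon> i) (phi_conv a\<phi> m (m + L)) z * a\<psi> j z)) \<and>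
       (\<forall>i j. m < i \<and> i \<le> m + L \<and> 1 \<le> j \<and> j \<le> m + L \<longrightarrow>
          integrable lborel (\<lambda>z. phi_virt a\<phi> a\<phi>v i (m + L) z * a\<psi> j z)))"


section \<open>Configurations and the weight\<close>

definition Conf :: "nat \<Rightarrow> (nat \<Rightarrow> real) set" where
  "Conf n = {x. \<forall>i j. 1 \<le> i \<and> i \<le> j \<and> j \<le> n \<longrightarrow> x j \<le> x i}"

text \<open>A configuration \<open>X\<close> on the levels \<open>m+1, ..., m+L\<close> has the entries \<open>x\<^sub>i\<^sup>(\<^sup>k\<^sup>) = X (k, i)\<close>.\<close>

definition labels :: "nat \<Rightarrow> nat \<Rightarrow> (nat \<times> nat) set" where
  "labels m L = (SIGMA k:{m+1..m+L}. {1..k})"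

definition conf_measure :: "nat \<Rightarrow> nat \<Rightarrow> (nat \<times> nat \<Rightarrow> real) measure" where
  "conf_measure m L = restrict_space (\<Pi>\<^sub>M p\<in>labels m L. lborel)
     {X. \<forall>k\<in>{m+1..m+L}. (\<lambda>i. X (k, i)) \<in> Conf k}"

definition entry :: "nat \<Rightarrow> (nat \<Rightarrow> real) \<Rightarrow> (nat \<times> nat \<Rightarrow> real) \<Rightarrow> nat \<Rightarrow> nat \<Rightarrow> real" where
  "entry m xm X k i = (if k = m then xm i else X (k, i))"

definition weight ::
  "nat \<Rightarrow> nat \<Rightarrow> (nat \<Rightarrow> real) \<Rightarrow> (real \<Rightarrow> real \<Rightarrow> complex) \<Rightarrow> (real \<Rightarrow> complex) \<Rightarrow>
   (nat \<Rightarrow> real \<Rightarrow> complex) \<Rightarrow> (nat \<Rightarrow> real \<Rightarrow> complex) \<Rightarrow> (nat \<times> nat \<Rightarrow> real) \<Rightarrow> complex"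
where
  "weight m L xm \<phi> \<phi>v \<upsilon> \<psi> X =
     det1 m (\<lambda>i j. \<upsilon> i (xm j)) *
     (\<Prod>k=m+1..m+L. det1 k (\<lambda>i j.
        if i = k then \<phi>v (entry m xm X k j)
        else \<phi> (entry m xm X (k - 1) i) (entry m xm X k j))) *
     det1 (m + L) (\<lambda>i j. \<psi> i (entry m xm X (m + L) j))"


section \<open>Determinantal point processes\<close>

text \<open>The process with (unnormalized, possibly complex) weight \<open>W\<close> has density \<open>W / Z\<close> with respect
  to Lebesgue measure on the configurations, where \<open>Z\<close> is the total weight. No positivity is
  built in; if \<open>W / Z\<close> is real and nonnegative, the lemma \<open>mean_eq_expectation\<close>
  below identifies \<open>mean\<close> with the expectation for the resulting probability measure.\<close>

definition total_weight :: "nat \<Rightarrow> nat \<Rightarrow> ((nat \<times> nat \<Rightarrow> real) \<Rightarrow> complex) \<Rightarrow> complex" where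
  "total_weight m L W = (LINT X|conf_measure m L. W X)"

definition mean ::
  "nat \<Rightarrow> nat \<Rightarrow> ((nat \<times> nat \<Rightarrow> real) \<Rightarrow> complex) \<Rightarrow> ((nat \<times> nat \<Rightarrow> real) \<Rightarrow> complex) \<Rightarrow> complex" where
  "mean m L W F = (LINT X|conf_measure m L. W X / total_weight m L W * F X)"

lemma mean_eq_expectation:
  fixes q :: "(nat \<times> nat \<Rightarrow> real) \<Rightarrow> real"
  assumes int: "integrable (conf_measure m L) W" and nz: "total_weight m L W \<noteq> 0"
    and q: "\<And>X. X \<in> space (conf_measure m L) \<Longrightarrow> W X / total_weight m L W = of_real (q X)"
    and q0: "\<And>X. X \<in> space (conf_measure m L) \<Longrightarrow> 0 \<le> q X"
    and F: "F \<in> borel_measurable (conf_measure m L)"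
  shows "emeasure (density (conf_measure m L) q) (space (conf_measure m L)) = 1"
    and "mean m L W F = (LINT X|density (conf_measure m L) q. F X)"
proof -
  let ?M = "conf_measure m L" and ?Z = "total_weight m L W"
  have iq: "integrable ?M (\<lambda>X. complex_of_real (q X))"
    by (rule iffD1[OF Bochner_Integration.integrable_cong[OF refl q] integrable_divide_zero[OF int]])
  then have iqr: "integrable ?M q"
    by (rule iffD1[OF complex_of_real_integrable_eq])
  have "complex_of_real (LINT X|?M. q X) = (LINT X|?M. complex_of_real (q X))"
    by (rule integral_complex_of_real[symmetric])
  also have "\<dots> = (LINT X|?M. W X / ?Z)"
    by (rule Bochner_Integration.integral_cong[OF refl q[symmetric]])
  also have "\<dots> = (LINT X|?M. W X) / ?Z"
    by (rule integral_divide_zero)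
  also have "\<dots> = 1"
    unfolding total_weight_def[symmetric] by (rule divide_self[OF nz])
  finally have one: "(LINT X|?M. q X) = 1"
    by (simp only: of_real_eq_1_iff)
  have "emeasure (density ?M q) (space ?M) = (\<integral>\<^sup>+ X. q X \<partial>?M)"
  proof -
    have "emeasure (density ?M q) (space ?M) = (\<integral>\<^sup>+ X. ennreal (q X) * indicator (space ?M) X \<partial>?M)"
      using iqr by (intro emeasure_density) auto
    also have "\<dots> = (\<integral>\<^sup>+ X. q X \<partial>?M)"
      by (rule nn_integral_cong) simp
    finally show ?thesis .
  qed
  also have "\<dots> = ennreal (LINT X|?M. q X)"
    by (rule nn_integral_eq_integral[OF iqr]) (simp add: q0)
  finally show "emeasure (density ?M q) (space ?M) = 1"
    using one by simp
  have "(LINT X|density ?M q. F X) = (LINT X|?M. q X *\<^sub>R F X)"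
    by (rule integral_density) (use F iqr q0 in auto)
  also have "\<dots> = (LINT X|?M. W X / ?Z * F X)"
  proof (rule Bochner_Integration.integral_cong[OF refl])
    fix X assume X: "X \<in> space ?M"
    show "q X *\<^sub>R F X = W X / ?Z * F X"
      unfolding q[OF X] scaleR_conv_of_real by (rule refl)
  qed
  also have "\<dots> = mean m L W F"
    unfolding mean_def by (rule refl)
  finally show "mean m L W F = (LINT X|density ?M q. F X)" ..
qed

definition reference_measure :: "nat \<Rightarrow> nat \<Rightarrow> (nat \<times> real) measure" where
  "reference_measure m L = count_space {m+1..m+L} \<Otimes>\<^sub>M lborel"

text \<open>The number of \<open>n\<close>-tuples of distinct points of \<open>X\<close> (with distinct labels, so that coinciding
  entries count separately) lying in \<open>B\<close>.\<close>

definition tuple_count ::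
  "nat \<Rightarrow> nat \<Rightarrow> nat \<Rightarrow> (nat \<Rightarrow> nat \<times> real) set \<Rightarrow> (nat \<times> nat \<Rightarrow> real) \<Rightarrow> nat" where
  "tuple_count m L n B X =
     card {s \<in> {..<n} \<rightarrow>\<^sub>E labels m L.
             inj_on s {..<n} \<and> (\<lambda>a\<in>{..<n}. (fst (s a), X (s a))) \<in> B}"

text \<open>The \<open>n\<close>-point correlation function is the density of the \<open>n\<close>-th factorial moment measure. The
  number of points is fixed, so that measure is finite and there is no need to restrict to
  bounded sets.\<close>

definition correlation_function ::
  "nat \<Rightarrow> nat \<Rightarrow> ((nat \<times> nat \<Rightarrow> real) \<Rightarrow> complex) \<Rightarrow> nat \<Rightarrow> ((nat \<Rightarrow> nat \<times> real) \<Rightarrow> complex) \<Rightarrow> bool"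
where
  "correlation_function m L W n \<rho> \<longleftrightarrow>
     integrable (\<Pi>\<^sub>M a\<in>{..<n}. reference_measure m L) \<rho> \<and>
     (\<forall>B \<in> sets (\<Pi>\<^sub>M a\<in>{..<n}. reference_measure m L).
        mean m L W (\<lambda>X. of_nat (tuple_count m L n B X)) =
        (LINT p:B|(\<Pi>\<^sub>M a\<in>{..<n}. reference_measure m L). \<rho> p))"

definition determinantal ::
  "nat \<Rightarrow> nat \<Rightarrow> ((nat \<times> nat \<Rightarrow> real) \<Rightarrow> complex) \<Rightarrow> (nat \<times> real \<Rightarrow> nat \<times> real \<Rightarrow> complex) \<Rightarrow> bool"
where
  "determinantal m L W K \<longleftrightarrow>
     (\<forall>n. correlation_function m L W n
        (\<lambda>p. Determinant.det (Matrix.mat n n (\<lambda>(a, b). K (p a) (p b)))))"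

definition inverse_transpose :: "complex mat \<Rightarrow> nat \<Rightarrow> nat \<Rightarrow> complex" where
  "inverse_transpose G i j = transpose_mat (the (mat_inverse G)) $$ (i - 1, j - 1)"

definition correlation_kernel ::
  "nat \<Rightarrow> nat \<Rightarrow> real set \<Rightarrow> (real \<Rightarrow> real \<Rightarrow> complex) \<Rightarrow> (real \<Rightarrow> complex) \<Rightarrow>
   (nat \<Rightarrow> real \<Rightarrow> complex) \<Rightarrow> (nat \<Rightarrow> real \<Rightarrow> complex) \<Rightarrow> nat \<times> real \<Rightarrow> nat \<times> real \<Rightarrow> complex"
where
  "correlation_kernel m L S \<phi> \<phi>v \<upsilon> \<psi> = (\<lambda>(n1, x1) (n2, x2).
     - phi_conv \<phi> n1 n2 x1 x2
     + (\<Sum>i=1..m. \<Sum>j=1..m+L. inverse_transpose (gram m L S \<phi> \<phi>v \<upsilon> \<psi>) i j *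
          upsilon_conv m S \<phi> \<upsilon> i n2 x2 * psi_conv m L \<phi> \<psi> j n1 x1)
     + (\<Sum>i=m+1..n2. \<Sum>j=1..m+L. inverse_transpose (gram m L S \<phi> \<phi>v \<upsilon> \<psi>) i j *
          phi_virt \<phi> \<phi>v i n2 x2 * psi_conv m L \<phi> \<psi> j n1 x1))"

end

theory Submission
  imports Defs
begin

text \<open>
  Let \<open>P\<close> be a finite set of points, each with a level and a position, and border the matrix
  \<open>\<phi>\<^bsup>(n,n')\<^esup>(x, x')\<close> of the points by the Gram matrix, by \<open>m + L\<close> rows (the functions \<open>\<upsilon>\<^sub>i\<close> and the virtual
  variables, transported to the points) and by \<open>m + L\<close> columns (the functions \<open>\<psi>\<^sub>j\<close>). Up to the sign
  \<open>(-1)\<close> to the number of points, the determinant of this bordered matrix is \<open>bdet P\<close>. It interpolates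
  between all quantities in question.

  \<^item> By a Schur complement, \<open>bdet P = det G * det [K(p, q)]\<close> if \<open>det G\<close> is nonzero
    (\<open>bdet_eq_det_kernel\<close>).
  \<^item> For the full set of labels, with \<open>k\<close> points on level \<open>k\<close>, the matrix is block triangular after a
    permutation of its columns; the diagonal blocks give the determinants in the weight. So the weight is
    \<open>bdet\<close> up to a constant (\<open>weight_eq_bdet\<close>).
  \<^item> Integrating out the position of a point of level \<open>n\<close> multiplies \<open>bdet\<close> of the remaining points by
    \<open>n\<close> minus the number of remaining points of level \<open>n\<close> (\<open>bdet_integrate_out\<close>).

  The last fact is the heart of the proof. In the Leibniz formula, the point \<open>q\<close> that is integrated out
  is visited by a single detour \<open>a \<rightarrow> q \<rightarrow> b\<close> of the permutation. Every row has a level at which it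
  starts and every column has a level at which it ends, and since the entries are iterated
  convolutions, integrating over \<open>q\<close> turns the detour into the direct step \<open>a \<rightarrow> b\<close> if the level of
  \<open>q\<close> lies between the start of \<open>a\<close> and the end of \<open>b\<close>, and into \<open>0\<close> otherwise (\<open>detour\<close>). The number of
  steps \<open>a \<rightarrow> b\<close> that pass a given level is the same for all permutations with a nonzero term
  (\<open>detour_count\<close>), so the Leibniz formula of the smaller determinant reappears with a factor. If
  there are more than \<open>n\<close> points on level \<open>n\<close>, that number would be negative, and \<open>bdet\<close> vanishes
  (\<open>bdet_overfull\<close>).

  The \<open>n\<close>-point correlation function is obtained by integrating all but \<open>n\<close> of the points out of the
  weight. The factors that appear count the ways of completing the \<open>n\<close> points to a full set of
  labels, so they are cancelled by the number of ways to label the \<open>n\<close> points; what remains is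
  \<open>bdet / det G\<close>. For \<open>L > 0\<close>, integrating out all points shows that the total weight is a nonzero multiple
  of \<open>det G\<close>, which is why a kernel exists as soon as the total weight is nonzero; without levels
  there are no points.

  Absolute convergence is handled by the same expansion: with the convolutions of the absolute values
  in \<open>[0, \<infinity>]\<close> instead, the permanent of the bordered matrix has a finite integral
  (\<open>abs_perm_finite\<close>), and it dominates \<open>bdet\<close>.
\<close>

abbreviation lborel_on :: "'i set \<Rightarrow> ('i \<Rightarrow> real) measure" where
  "lborel_on I \<equiv> (\<Pi>\<^sub>M i\<in>I. lborel)"

section \<open>Determinants over finite index sets\<close>

text \<open>Matrices are indexed by arbitrary finite sets because the indices below are a disjoint union of
  numbers and points, and points are adjoined and removed one at a time.\<close>

definition pdet :: "'i set \<Rightarrow> ('i \<Rightarrow> 'i \<Rightarrow> 'a::comm_ring_1) \<Rightarrow> 'a" where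
  "pdet S M = (\<Sum>\<sigma> | \<sigma> permutes S. of_int (sign \<sigma>) * (\<Prod>a\<in>S. M a (\<sigma> a)))"

lemma det_mat_eq_pdet:
  "Determinant.det (Matrix.mat n n (\<lambda>(i, j). f i j)) = pdet {0..<n} f"
proof -
  have "(\<Prod>i = 0..<n. Matrix.mat n n (\<lambda>(i, j). f i j) $$ (i, p i)) = (\<Prod>i = 0..<n. f i (p i))"
    if "p permutes {0..<n}" for p
    by (rule prod.cong) (use permutes_in_image[OF that] in auto)
  then show ?thesis
    unfolding Determinant.det_def pdet_def by (auto intro!: sum.cong)
qed

lemma pdet_cong:
  assumes "\<And>a b. a \<in> S \<Longrightarrow> b \<in> S \<Longrightarrow> M a b = N a b"
  shows "pdet S M = pdet S N"
  unfolding pdet_def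
  by (intro sum.cong arg_cong2[where f = times] prod.cong) (auto simp: assms permutes_in_image)

lemma pdet_empty [simp]: "pdet {} M = 1"
  by (simp add: pdet_def)

lemma pdet_reindex:
  assumes S: "finite S" and g: "inj_on g S"
  shows "pdet (g ` S) M = pdet S (\<lambda>a b. M (g a) (g b))"
proof -
  have bij: "bij_betw g S (g ` S)"
    using g by (rule inj_on_imp_bij_betw)
  have inv: "bij_betw (inv_into S g) (g ` S) S"
    using bij by (rule bij_betw_inv_into)
  show ?thesis
    unfolding pdet_def
  proof (rule sum.reindex_bij_witness[where i = "map_permutation S g"
        and j = "map_permutation (g ` S) (inv_into S g)"], goal_cases)
    case (1 p)
    then show ?case
      by (intro map_permutation_compose_inv[OF inv]) (auto simp: f_inv_into_f)
  next
    case (2 p)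
    then show ?case
      using map_permutation_permutes[OF inv] by auto
  next
    case (3 p)
    then show ?case
      by (intro map_permutation_compose_inv[OF bij]) (auto simp: g)
  next
    case (4 p)
    then show ?case
      using map_permutation_permutes[OF bij] by auto
  next
    case (5 p)
    let ?q = "map_permutation (g ` S) (inv_into S g) p"
    have p: "p permutes g ` S"
      using 5 by simp
    have q: "?q permutes S"
      using p map_permutation_permutes[OF inv] by auto
    have conj: "map_permutation S g ?q = p"
      by (intro map_permutation_compose_inv[OF inv p]) (auto simp: f_inv_into_f)
    have sgn: "sign ?q = sign p"
      using sign_map_permutation[OF g q] S conj by metis
    have "(\<Prod>a\<in>g ` S. M a (p a)) = (\<Prod>a\<in>S. M (g a) (g (?q a)))"
    proof -
      have "p (g a) = g (?q a)" if "a \<in> S" for a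
        using map_permutation_apply[OF g that, of ?q] conj by metis
      then show ?thesis
        by (simp add: prod.reindex[OF g])
    qed
    then show ?case
      using sgn by simp
  qed
qed

lemma det_mat_eq_pdet_image:
  assumes "inj_on g {0..<n}"
  shows "Determinant.det (Matrix.mat n n (\<lambda>(i, j). f (g i) (g j))) = pdet (g ` {0..<n}) f"
  unfolding det_mat_eq_pdet by (rule pdet_reindex[symmetric]) (use assms in auto)

lemma det1_eq_pdet: "det1 n f = pdet {1..n} f"
proof -
  have "Suc ` {0..<n} = {1..n}"
    by (simp add: image_Suc_atLeastLessThan atLeastLessThanSuc_atLeastAtMost)
  then show ?thesis
    unfolding det1_def using det_mat_eq_pdet_image[of Suc n f] by simp
qed

lemma pdet_permute_columns:
  assumes S: "finite S" and q: "q permutes S"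
  shows "pdet S (\<lambda>a b. M a (q b)) = of_int (sign q) * pdet S M"
proof -
  have "pdet S M = (\<Sum>\<sigma> | \<sigma> permutes S. of_int (sign (q \<circ> \<sigma>)) * (\<Prod>a\<in>S. M a ((q \<circ> \<sigma>) a)))"
    unfolding pdet_def by (rule setum_permutations_compose_left[OF q])
  also have "\<dots> = (\<Sum>\<sigma> | \<sigma> permutes S. of_int (sign q) *
      (of_int (sign \<sigma>) * (\<Prod>a\<in>S. M a (q (\<sigma> a)))))"
  proof (rule sum.cong[OF refl])
    fix \<sigma> assume "\<sigma> \<in> {\<sigma>. \<sigma> permutes S}"
    then have "permutation \<sigma>" "permutation q"
      using S q permutation_permutes by blast+
    then show "of_int (sign (q \<circ> \<sigma>)) * (\<Prod>a\<in>S. M a ((q \<circ> \<sigma>) a)) =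
        of_int (sign q) * (of_int (sign \<sigma>) * (\<Prod>a\<in>S. M a (q (\<sigma> a))))"
      by (simp add: sign_compose mult.assoc)
  qed
  also have "\<dots> = of_int (sign q) * pdet S (\<lambda>a b. M a (q b))"
    unfolding pdet_def by (rule sum_distrib_left[symmetric])
  finally have "pdet S M = of_int (sign q) * pdet S (\<lambda>a b. M a (q b))" .
  moreover have "of_int (sign q) * of_int (sign q) = (1 :: 'b)"
    by (simp flip: of_int_mult)
  ultimately show ?thesis
    by (simp flip: mult.assoc)
qed

lemma pdet_identical_columns:
  fixes M :: "'i \<Rightarrow> 'i \<Rightarrow> complex"
  assumes S: "finite S" and bc: "b \<in> S" "c \<in> S" "b \<noteq> c" and eq: "\<And>a. a \<in> S \<Longrightarrow> M a b = M a c"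
  shows "pdet S M = 0"
proof -
  let ?q = "Transposition.transpose b c"
  have "pdet S M = pdet S (\<lambda>a b. M a (?q b))"
    by (rule pdet_cong) (auto simp: Transposition.transpose_def eq)
  also have "\<dots> = - pdet S M"
    using pdet_permute_columns[OF S permutes_swap_id[OF bc(1,2)], of M] bc(3) by (simp add: sign_swap_id)
  finally show ?thesis
    by simp
qed

text \<open>A numbering of the indices turns this into the determinant of a four-block matrix.\<close>

lemma pdet_two_blocks:
  fixes M :: "'i \<Rightarrow> 'i \<Rightarrow> 'a::idom"
  assumes fin: "finite A" "finite B" and disj: "A \<inter> B = {}"
    and zero: "\<And>a b. a \<in> A \<Longrightarrow> b \<in> B \<Longrightarrow> M a b = 0"
  shows "pdet (A \<union> B) M = pdet A M * pdet B M"
proof -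
  let ?m = "card A" and ?n = "card B"
  obtain f g where f: "bij_betw f {0..<?m} A" and g: "bij_betw g {0..<?n} B"
    using ex_bij_betw_nat_finite[OF fin(1)] ex_bij_betw_nat_finite[OF fin(2)] by blast
  define e where "e k = (if k < ?m then f k else g (k - ?m))" for k
  have f_in: "f k \<in> A" if "k < ?m" for k
    using bij_betwE[OF f] that by simp
  have g_in: "g k \<in> B" if "k < ?n" for k
    using bij_betwE[OF g] that by simp
  have inj_e: "inj_on e {0..<?m + ?n}"
  proof (rule inj_onI)
    fix k l assume kl: "k \<in> {0..<?m + ?n}" "l \<in> {0..<?m + ?n}" "e k = e l"
    then have "f k \<noteq> g (l - ?m)" if "k < ?m" "\<not> l < ?m"
      using f_in[of k] g_in[of "l - ?m"] that disj by auto
    moreover have "g (k - ?m) \<noteq> f l" if "\<not> k < ?m" "l < ?m"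
      using f_in[of l] g_in[of "k - ?m"] that kl disj by auto
    moreover have "k = l" if nk: "\<not> k < ?m" and nl: "\<not> l < ?m"
    proof -
      have "k - ?m < ?n" "l - ?m < ?n"
        using kl(1,2) nk nl by (simp_all add: less_diff_conv2)
      then have "k - ?m = l - ?m"
        using inj_onD[OF bij_betw_imp_inj_on[OF g], of "k - ?m" "l - ?m"] kl(3) nk nl by (simp add: e_def)
      then show ?thesis
        using nk nl by simp
    qed
    ultimately show "k = l"
      using kl inj_onD[OF bij_betw_imp_inj_on[OF f], of k l]
      by (cases "k < ?m"; cases "l < ?m") (auto simp: e_def)
  qed
  have "e ` {0..<?m + ?n} \<subseteq> A \<union> B"
    using f_in g_in by (auto simp: e_def)
  moreover have "card (e ` {0..<?m + ?n}) = card (A \<union> B)"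
    using fin disj by (simp add: card_image[OF inj_e] card_Un_disjoint)
  ultimately have "e ` {0..<?m + ?n} = A \<union> B"
    using fin by (intro card_subset_eq) auto
  then have "pdet (A \<union> B) M = Determinant.det (Matrix.mat (?m + ?n) (?m + ?n) (\<lambda>(i, j). M (e i) (e j)))"
    using det_mat_eq_pdet_image[OF inj_e, of M] by simp
  also have "Matrix.mat (?m + ?n) (?m + ?n) (\<lambda>(i, j). M (e i) (e j)) = four_block_mat
      (Matrix.mat ?m ?m (\<lambda>(i, j). M (f i) (f j))) (0\<^sub>m ?m ?n)
      (Matrix.mat ?n ?m (\<lambda>(i, j). M (g i) (f j))) (Matrix.mat ?n ?n (\<lambda>(i, j). M (g i) (g j)))"
    by (rule eq_matI) (auto simp: e_def zero f_in g_in)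
  also have "Determinant.det \<dots> = Determinant.det (Matrix.mat ?m ?m (\<lambda>(i, j). M (f i) (f j))) *
      Determinant.det (Matrix.mat ?n ?n (\<lambda>(i, j). M (g i) (g j)))"
    by (rule det_four_block_mat_upper_right_zero) auto
  also have "\<dots> = pdet A M * pdet B M"
    using det_mat_eq_pdet_image[OF bij_betw_imp_inj_on[OF f], of M] bij_betw_imp_surj_on[OF f]
      det_mat_eq_pdet_image[OF bij_betw_imp_inj_on[OF g], of M] bij_betw_imp_surj_on[OF g] by simp
  finally show ?thesis .
qed

text \<open>The block with the largest value of \<open>\<beta>\<close> splits off by \<open>pdet_two_blocks\<close>; the rest is induction.\<close>

lemma pdet_block_triangular:
  fixes \<beta> :: "'i \<Rightarrow> nat" and M :: "'i \<Rightarrow> 'i \<Rightarrow> 'a::idom"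
  assumes S: "finite S"
    and zero: "\<And>a b. a \<in> S \<Longrightarrow> b \<in> S \<Longrightarrow> \<beta> b < \<beta> a \<Longrightarrow> M a b = 0"
    and range: "\<beta> ` S \<subseteq> {l..<h}"
  shows "pdet S M = (\<Prod>k=l..<h. pdet {a\<in>S. \<beta> a = k} M)"
  using assms
proof (induction h arbitrary: S)
  case 0
  then show ?case by simp
next
  case (Suc h)
  show ?case
  proof (cases "l \<le> h")
    case True
    let ?A = "{a\<in>S. \<beta> a = h}" and ?B = "{a\<in>S. \<beta> a < h}"
    have S: "S = ?A \<union> ?B"
      using Suc.prems(3) by force
    have "pdet S M = pdet ?A M * pdet ?B M"
      by (subst S, rule pdet_two_blocks) (use Suc.prems in auto)
    moreover have "pdet ?B M = (\<Prod>k=l..<h. pdet {a\<in>?B. \<beta> a = k} M)"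
      using Suc.prems by (intro Suc.IH) auto
    moreover have "{a\<in>?B. \<beta> a = k} = {a\<in>S. \<beta> a = k}" if "k \<in> {l..<h}" for k
      using that by auto
    ultimately show ?thesis
      using True by (simp add: mult.commute)
  next
    case False
    then have "S = {}"
      using Suc.prems(3) by auto
    then show ?thesis
      by simp
  qed
qed

lemma det1_transpose: "det1 n (\<lambda>i j. f j i) = det1 n f"
proof -
  have "Matrix.mat n n (\<lambda>(i, j). f (Suc j) (Suc i)) = transpose_mat (Matrix.mat n n (\<lambda>(i, j). f (Suc i) (Suc j)))"
    by (rule eq_matI) auto
  then show ?thesis
    unfolding det1_def by (simp add: det_transpose[of _ n])
qed

lemma det1_mult: "det1 n (\<lambda>i j. \<Sum>l=1..n. f i l * g l j) = det1 n f * det1 n g"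
proof -
  let ?m = "\<lambda>h. Matrix.mat n n (\<lambda>(i, j). h (Suc i) (Suc j))"
  have "(\<Sum>l=1..n. f i l * g l j) = (\<Sum>l=0..<n. f i (Suc l) * g (Suc l) j)" for i j
    using sum.shift_bounds_Suc_ivl[of "\<lambda>l. f i l * g l j" 0 n]
    by (simp add: atLeastLessThanSuc_atLeastAtMost)
  then have "?m (\<lambda>i j. \<Sum>l=1..n. f i l * g l j) = ?m f * ?m g"
    by (intro eq_matI) (auto simp: scalar_prod_def)
  then show ?thesis
    unfolding det1_def by (simp add: det_mult[of _ n])
qed

lemma det1_cong:
  assumes "\<And>i j. i \<in> {1..n} \<Longrightarrow> j \<in> {1..n} \<Longrightarrow> f i j = g i j"
  shows "det1 n f = det1 n g"
  unfolding det1_eq_pdet by (rule pdet_cong) (use assms in auto)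

lemma det1_image:
  assumes "inj_on g {1..n}"
  shows "pdet (g ` {1..n}) f = det1 n (\<lambda>i j. f (g i) (g j))"
  unfolding det1_eq_pdet by (rule pdet_reindex) (use assms in auto)

text \<open>The weight has one determinant of size \<open>m\<close>, that of the functions \<open>\<upsilon>\<^sub>i\<close>; it is brought to size
  \<open>m + 1\<close> in order to be multiplied with the determinant of level \<open>m + 1\<close>.\<close>

lemma det1_bordered_identity:
  "det1 (Suc n) (\<lambda>i l. if i \<le> n then (if l \<le> n then f i l else 0) else (if l \<le> n then 0 else 1)) = det1 n f"
proof -
  let ?M = "\<lambda>i l. if i \<le> n then (if l \<le> n then f i l else 0) else (if l \<le> n then 0 else 1)"
  have "pdet ({1..n} \<union> {Suc n}) ?M = pdet {1..n} ?M * pdet {Suc n} ?M"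
    by (rule pdet_two_blocks) auto
  moreover have "{1..n} \<union> {Suc n} = {1..Suc n}"
    by auto
  moreover have "pdet {1..n} ?M = pdet {1..n} f"
    by (rule pdet_cong) auto
  moreover have "pdet {Suc n} ?M = 1"
    by (simp add: pdet_def permutes_sing)
  ultimately show ?thesis
    unfolding det1_eq_pdet by simp
qed

section \<open>Adjoining one index\<close>

text \<open>A permutation of \<open>insert q S\<close> either fixes \<open>q\<close> or arises from a permutation \<open>\<tau>\<close> of \<open>S\<close> by rerouting
  one of its steps \<open>a \<rightarrow> \<tau> a\<close> through \<open>q\<close>.\<close>

lemma sum_permutations_insert:
  fixes f :: "('i \<Rightarrow> 'i) \<Rightarrow> 'b::comm_monoid_add"
  assumes S: "finite S" and q: "q \<notin> S"
  shows "(\<Sum>\<sigma> | \<sigma> permutes insert q S. f \<sigma>) =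
    (\<Sum>\<tau> | \<tau> permutes S. f \<tau> + (\<Sum>a\<in>S. f (Transposition.transpose q (\<tau> a) \<circ> \<tau>)))"
proof -
  have "(\<Sum>\<sigma> | \<sigma> permutes insert q S. f \<sigma>) =
    (\<Sum>\<tau> | \<tau> permutes S. \<Sum>b\<in>insert q S. f (Transposition.transpose q b \<circ> \<tau>))"
    by (subst sum_over_permutations_insert[OF S q]) (rule sum.swap)
  also have "\<dots> = (\<Sum>\<tau> | \<tau> permutes S. f \<tau> + (\<Sum>a\<in>S. f (Transposition.transpose q (\<tau> a) \<circ> \<tau>)))"
  proof (rule sum.cong[OF refl])
    fix \<tau> assume "\<tau> \<in> {\<tau>. \<tau> permutes S}"
    then have \<tau>: "\<tau> permutes S" by simp
    have "(\<Sum>a\<in>S. f (Transposition.transpose q (\<tau> a) \<circ> \<tau>)) =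
        (\<Sum>b\<in>S. f (Transposition.transpose q b \<circ> \<tau>))"
      by (rule sum.reindex_bij_betw[OF permutes_imp_bij[OF \<tau>]])
    then show "(\<Sum>b\<in>insert q S. f (Transposition.transpose q b \<circ> \<tau>)) =
        f \<tau> + (\<Sum>a\<in>S. f (Transposition.transpose q (\<tau> a) \<circ> \<tau>))"
      using S q by simp
  qed
  finally show ?thesis .
qed

lemma prod_permutation_detour:
  fixes M :: "'i \<Rightarrow> 'i \<Rightarrow> 'b::comm_monoid_mult"
  assumes S: "finite S" and q: "q \<notin> S" and a: "a \<in> S" and \<tau>: "\<tau> permutes S"
  shows "(\<Prod>c\<in>insert q S. M c ((Transposition.transpose q (\<tau> a) \<circ> \<tau>) c)) =
    (\<Prod>c\<in>S - {a}. M c (\<tau> c)) * (M a q * M q (\<tau> a))"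
proof -
  have split: "(\<Prod>c\<in>insert q S. h c) = (\<Prod>c\<in>S - {a}. h c) * (h a * h q)" for h :: "'i \<Rightarrow> 'b"
    using S q a by (simp add: prod.remove[OF S a] mult_ac)
  have "\<tau> q = q"
    using \<tau> q by (rule permutes_not_in)
  moreover have "M c ((Transposition.transpose q (\<tau> a) \<circ> \<tau>) c) = M c (\<tau> c)" if "c \<in> S - {a}" for c
  proof -
    have "\<tau> c \<noteq> \<tau> a"
      using that permutes_inj[OF \<tau>] by (auto simp: inj_def)
    moreover have "\<tau> c \<noteq> q"
      using that permutes_in_image[OF \<tau>, of c] q by auto
    ultimately show ?thesis
      by (simp add: Transposition.transpose_def)
  qed
  ultimately show ?thesis
    unfolding split using q by (simp add: Transposition.transpose_def)
qed

text \<open>The dependence on \<open>q\<close> is confined to the two factors of one detour, which is what makes it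
  possible to integrate over the position of \<open>q\<close>. A detour changes the sign of the permutation.\<close>

lemma pdet_insert:
  fixes M :: "'i \<Rightarrow> 'i \<Rightarrow> 'a::comm_ring_1"
  assumes S: "finite S" and q: "q \<notin> S" and diag: "M q q = 0"
  shows "pdet (insert q S) M = - (\<Sum>\<tau> | \<tau> permutes S. of_int (sign \<tau>) *
    (\<Sum>a\<in>S. (\<Prod>c\<in>S - {a}. M c (\<tau> c)) * (M a q * M q (\<tau> a))))"
proof -
  let ?f = "\<lambda>\<sigma>. of_int (sign \<sigma>) * (\<Prod>a\<in>insert q S. M a (\<sigma> a))"
  have "pdet (insert q S) M = (\<Sum>\<tau> | \<tau> permutes S. ?f \<tau> +
      (\<Sum>a\<in>S. ?f (Transposition.transpose q (\<tau> a) \<circ> \<tau>)))"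
    unfolding pdet_def by (rule sum_permutations_insert[OF S q])
  also have "\<dots> = (\<Sum>\<tau> | \<tau> permutes S. - (of_int (sign \<tau>) *
    (\<Sum>a\<in>S. (\<Prod>c\<in>S - {a}. M c (\<tau> c)) * (M a q * M q (\<tau> a)))))"
  proof (rule sum.cong[OF refl])
    fix \<tau> assume "\<tau> \<in> {\<tau>. \<tau> permutes S}"
    then have \<tau>: "\<tau> permutes S" by simp
    have "?f \<tau> = 0"
      using S q diag permutes_not_in[OF \<tau> q] by simp
    moreover have "sign (Transposition.transpose q (\<tau> a) \<circ> \<tau>) = - sign \<tau>" if "a \<in> S" for a
    proof -
      have "q \<noteq> \<tau> a"
        using permutes_in_image[OF \<tau>, of a] that q by auto
      moreover have "permutation \<tau>"
        using \<tau> S permutation_permutes by blast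
      ultimately show ?thesis
        by (simp add: sign_compose permutation_swap_id sign_swap_id)
    qed
    then have "(\<Sum>a\<in>S. ?f (Transposition.transpose q (\<tau> a) \<circ> \<tau>)) =
        (\<Sum>a\<in>S. - (of_int (sign \<tau>) * ((\<Prod>c\<in>S - {a}. M c (\<tau> c)) * (M a q * M q (\<tau> a)))))"
      using prod_permutation_detour[OF S q _ \<tau>, of _ M] by (intro sum.cong refl) auto
    ultimately show "?f \<tau> + (\<Sum>a\<in>S. ?f (Transposition.transpose q (\<tau> a) \<circ> \<tau>)) =
        - (of_int (sign \<tau>) * (\<Sum>a\<in>S. (\<Prod>c\<in>S - {a}. M c (\<tau> c)) * (M a q * M q (\<tau> a))))"
      by (simp add: sum_negf sum_distrib_left)
  qed
  finally show ?thesis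
    by (simp add: sum_negf)
qed

text \<open>The counterpart of \<open>pdet_insert\<close> for matrices of absolute values.\<close>

lemma permanent_insert:
  fixes M :: "'i \<Rightarrow> 'i \<Rightarrow> 'a::comm_semiring_1"
  assumes S: "finite S" and q: "q \<notin> S" and diag: "M q q = 0"
  shows "(\<Sum>\<sigma> | \<sigma> permutes insert q S. \<Prod>a\<in>insert q S. M a (\<sigma> a)) =
    (\<Sum>\<tau> | \<tau> permutes S. \<Sum>a\<in>S. (\<Prod>c\<in>S - {a}. M c (\<tau> c)) * (M a q * M q (\<tau> a)))"
proof -
  have "(\<Prod>a\<in>insert q S. M a (\<tau> a)) = 0" if "\<tau> permutes S" for \<tau>
    using S q diag permutes_not_in[OF that q] by simp
  then show ?thesis
    by (subst sum_permutations_insert[OF S q])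
      (auto intro!: sum.cong simp: prod_permutation_detour[OF S q] simp del: o_apply)
qed

text \<open>A step \<open>a \<rightarrow> \<sigma> a\<close> with \<open>n < v (\<sigma> a)\<close> either passes \<open>n\<close> or starts beyond \<open>n\<close>, and all steps that start
  beyond \<open>n\<close> are of this kind. Since \<open>\<sigma>\<close> is a bijection, the number of steps passing \<open>n\<close> depends only
  on \<open>t\<close> and \<open>v\<close>.\<close>

lemma crossing_count:
  fixes t v :: "'i \<Rightarrow> nat"
  assumes J: "finite J" and \<sigma>: "\<sigma> permutes J" and tv: "\<And>a. a \<in> J \<Longrightarrow> t a \<le> v (\<sigma> a)"
  shows "card {a\<in>J. t a \<le> n \<and> n < v (\<sigma> a)} + card {a\<in>J. n < t a} = card {b\<in>J. n < v b}"
proof -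
  have "card {b\<in>J. n < v b} = card {a\<in>J. n < v (\<sigma> a)}"
  proof -
    have "\<sigma> ` {a\<in>J. n < v (\<sigma> a)} = {b\<in>J. n < v b}"
    proof (intro equalityI subsetI)
      fix b assume b: "b \<in> {b\<in>J. n < v b}"
      then have "b \<in> \<sigma> ` J"
        using permutes_image[OF \<sigma>] by simp
      then show "b \<in> \<sigma> ` {a\<in>J. n < v (\<sigma> a)}"
        using b by auto
    qed (use permutes_in_image[OF \<sigma>] in auto)
    then show ?thesis
      using card_image[of \<sigma> "{a\<in>J. n < v (\<sigma> a)}"] permutes_inj_on[OF \<sigma>] by auto
  qed
  also have "{a\<in>J. n < v (\<sigma> a)} = {a\<in>J. t a \<le> n \<and> n < v (\<sigma> a)} \<union> {a\<in>J. n < t a}"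
    using tv by force
  also have "card \<dots> = card {a\<in>J. t a \<le> n \<and> n < v (\<sigma> a)} + card {a\<in>J. n < t a}"
    using J by (intro card_Un_disjoint) auto
  finally show ?thesis ..
qed

section \<open>Schur complements\<close>

lemma det_schur_complement:
  fixes A B C D A' :: "'a::field mat"
  assumes A: "A \<in> carrier_mat n n" and A': "A' \<in> carrier_mat n n" and inv: "A' * A = 1\<^sub>m n" "A * A' = 1\<^sub>m n"
    and B: "B \<in> carrier_mat n k" and C: "C \<in> carrier_mat k n" and D: "D \<in> carrier_mat k k"
  shows "Determinant.det (four_block_mat A B C D) =
    Determinant.det A * Determinant.det (D - C * (A' * B))"
proof -
  \<comment> \<open>Multiplication by \<open>?L\<close> eliminates the lower left block and does not change the determinant.\<close>
  let ?L = "four_block_mat (1\<^sub>m n) (0\<^sub>m n k) (- (C * A')) (1\<^sub>m k)"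
  have CA': "- (C * A') \<in> carrier_mat k n" and CA: "C * A' \<in> carrier_mat k n"
    using C A' by auto
  have "- (C * A') * A + 1\<^sub>m k * C = 0\<^sub>m k n"
  proof -
    have "- (C * A') * A = - (C * A' * A)"
      using CA A by (intro uminus_mult_left_mat) auto
    also have "C * A' * A = C"
      using C A' A inv by (simp add: assoc_mult_mat[OF C A' A])
    finally show ?thesis
      using C uminus_l_inv_mat[OF C] by simp
  qed
  moreover have "- (C * A') * B + 1\<^sub>m k * D = D - C * (A' * B)"
  proof -
    have "- (C * A') * B = - (C * A' * B)"
      using CA B by (intro uminus_mult_left_mat) auto
    then show ?thesis
      using C A' B D by (auto simp: assoc_mult_mat[OF C A' B] intro!: eq_matI)
  qed
  moreover have "1\<^sub>m n * A + 0\<^sub>m n k * C = A" "1\<^sub>m n * B + 0\<^sub>m n k * D = B"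
    using A B C D by auto
  ultimately have prod: "?L * four_block_mat A B C D = four_block_mat A B (0\<^sub>m k n) (D - C * (A' * B))"
    using mult_four_block_mat[OF one_carrier_mat zero_carrier_mat CA' one_carrier_mat A B C D] by simp
  have "Determinant.det ?L = 1"
    using det_four_block_mat_upper_right_zero[OF one_carrier_mat refl CA' one_carrier_mat] by simp
  then have "Determinant.det (four_block_mat A B C D) = Determinant.det (?L * four_block_mat A B C D)"
    using det_mult[of ?L "n + k" "four_block_mat A B C D"] A B C D CA' by simp
  also have "\<dots> = Determinant.det A * Determinant.det (D - C * (A' * B))"
    unfolding prod using A B C D A' by (intro det_four_block_mat_lower_left_zero) auto
  finally show ?thesis .
qed

section \<open>Iterated convolutions\<close>

text \<open>\<open>push k f\<close> and \<open>pull k g\<close> convolve \<open>k\<close> times with \<open>\<phi>\<close>, from the right and from the left. The versions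
  \<open>apush\<close> and \<open>apull\<close> use the absolute value of \<open>\<phi>\<close> and take values in \<open>[0, \<infinity>]\<close>, where Tonelli's theorem
  allows all rearrangements; they dominate the signed ones, so finiteness of a single
  absolute integral justifies each use of Fubini's theorem.\<close>

locale kernel =
  fixes \<phi> :: "real \<Rightarrow> real \<Rightarrow> complex"
  assumes kernel_measurable: "(\<lambda>(x, y). \<phi> x y) \<in> borel_measurable (borel \<Otimes>\<^sub>M borel)"
begin

lemma kernel_comp [measurable (raw)]:
  assumes "a \<in> borel_measurable N" "b \<in> borel_measurable N"
  shows "(\<lambda>w. \<phi> (a w) (b w)) \<in> borel_measurable N"
  using measurable_compose[OF measurable_Pair[OF assms] kernel_measurable] by simp

primrec push :: "nat \<Rightarrow> (real \<Rightarrow> complex) \<Rightarrow> real \<Rightarrow> complex" where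
  "push 0 f = f"
| "push (Suc k) f = conv_left (push k f) \<phi>"

lemma push_eq_funpow: "push k f = ((\<lambda>h. conv_left h \<phi>) ^^ k) f"
  by (induction k) auto

primrec pull :: "nat \<Rightarrow> (real \<Rightarrow> complex) \<Rightarrow> real \<Rightarrow> complex" where
  "pull 0 f = f"
| "pull (Suc k) f = conv_right \<phi> (pull k f)"

lemma pull_eq_funpow: "pull k f = (conv_right \<phi> ^^ k) f"
  by (induction k) auto

definition abs_left :: "(real \<Rightarrow> ennreal) \<Rightarrow> real \<Rightarrow> ennreal" where
  "abs_left h y = (\<integral>\<^sup>+x. h x * ennreal (norm (\<phi> x y)) \<partial>lborel)"

definition abs_right :: "(real \<Rightarrow> ennreal) \<Rightarrow> real \<Rightarrow> ennreal" where
  "abs_right h x = (\<integral>\<^sup>+y. ennreal (norm (\<phi> x y)) * h y \<partial>lborel)"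

primrec apush :: "nat \<Rightarrow> (real \<Rightarrow> ennreal) \<Rightarrow> real \<Rightarrow> ennreal" where
  "apush 0 f = f"
| "apush (Suc k) f = abs_left (apush k f)"

primrec apull :: "nat \<Rightarrow> (real \<Rightarrow> ennreal) \<Rightarrow> real \<Rightarrow> ennreal" where
  "apull 0 f = f"
| "apull (Suc k) f = abs_right (apull k f)"

lemma push_measurable_param:
  assumes "(\<lambda>(a, x). F a x) \<in> borel_measurable (N \<Otimes>\<^sub>M borel)"
  shows "(\<lambda>(a, y). push k (F a) y) \<in> borel_measurable (N \<Otimes>\<^sub>M borel)"
proof (induction k)
  case (Suc k)
  define P where "P = (\<lambda>a. push k (F a))"
  have [measurable]: "(\<lambda>(a, x). P a x) \<in> borel_measurable (N \<Otimes>\<^sub>M borel)"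
    using Suc by (simp add: P_def)
  have "(\<lambda>(a, y). conv_left (P a) \<phi> y) \<in> borel_measurable (N \<Otimes>\<^sub>M borel)"
    unfolding conv_left_def case_prod_unfold by measurable
  then show ?case
    by (simp add: P_def)
qed (use assms in simp)

lemma apush_measurable_param:
  assumes "(\<lambda>(a, x). F a x) \<in> borel_measurable (N \<Otimes>\<^sub>M borel)"
  shows "(\<lambda>(a, y). apush k (F a) y) \<in> borel_measurable (N \<Otimes>\<^sub>M borel)"
proof (induction k)
  case (Suc k)
  define P where "P = (\<lambda>a. apush k (F a))"
  have [measurable]: "(\<lambda>(a, x). P a x) \<in> borel_measurable (N \<Otimes>\<^sub>M borel)"
    using Suc by (simp add: P_def)
  have "(\<lambda>(a, y). abs_left (P a) y) \<in> borel_measurable (N \<Otimes>\<^sub>M borel)"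
    unfolding abs_left_def case_prod_unfold by measurable
  then show ?case
    by (simp add: P_def)
qed (use assms in simp)

lemma push_measurable [measurable (raw)]:
  assumes [measurable]: "f \<in> borel_measurable borel"
  shows "push k f \<in> borel_measurable borel"
proof (induction k)
  case (Suc k)
  note [measurable] = Suc
  show ?case
    unfolding push.simps conv_left_def by measurable
qed (use assms in simp)

lemma pull_measurable [measurable (raw)]:
  assumes [measurable]: "f \<in> borel_measurable borel"
  shows "pull k f \<in> borel_measurable borel"
proof (induction k)
  case (Suc k)
  note [measurable] = Suc
  show ?case
    unfolding pull.simps conv_right_def by measurable
qed (use assms in simp)

lemma apush_measurable [measurable (raw)]:
  assumes [measurable]: "f \<in> borel_measurable borel"
  shows "apush k f \<in> borel_measurable borel"
proof (induction k)
  case (Suc k)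
  note [measurable] = Suc
  show ?case
    unfolding apush.simps abs_left_def by measurable
qed (use assms in simp)

lemma apull_measurable [measurable (raw)]:
  assumes [measurable]: "f \<in> borel_measurable borel"
  shows "apull k f \<in> borel_measurable borel"
proof (induction k)
  case (Suc k)
  note [measurable] = Suc
  show ?case
    unfolding apull.simps abs_right_def by measurable
qed (use assms in simp)

lemma abs_left_right:
  assumes [measurable]: "f \<in> borel_measurable borel" "g \<in> borel_measurable borel"
  shows "(\<integral>\<^sup>+y. abs_left f y * g y \<partial>lborel) = (\<integral>\<^sup>+x. f x * abs_right g x \<partial>lborel)"
proof -
  have "(\<integral>\<^sup>+y. abs_left f y * g y \<partial>lborel) =
      (\<integral>\<^sup>+y. \<integral>\<^sup>+x. f x * ennreal (norm (\<phi> x y)) * g y \<partial>lborel \<partial>lborel)"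
    unfolding abs_left_def by (subst nn_integral_multc) auto
  also have "\<dots> = (\<integral>\<^sup>+x. \<integral>\<^sup>+y. f x * ennreal (norm (\<phi> x y)) * g y \<partial>lborel \<partial>lborel)"
    by (rule lborel_pair.Fubini') measurable
  also have "\<dots> = (\<integral>\<^sup>+x. f x * abs_right g x \<partial>lborel)"
    unfolding abs_right_def mult.assoc by (subst nn_integral_cmult) auto
  finally show ?thesis .
qed

lemma apush_apull:
  assumes [measurable]: "f \<in> borel_measurable borel" "g \<in> borel_measurable borel"
  shows "(\<integral>\<^sup>+y. apush k f y * apull l g y \<partial>lborel) = (\<integral>\<^sup>+y. apush (k + l) f y * g y \<partial>lborel)"
proof (induction l arbitrary: k)
  case (Suc l)
  have "(\<integral>\<^sup>+y. apush k f y * apull (Suc l) g y \<partial>lborel) =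
      (\<integral>\<^sup>+y. apush (Suc k) f y * apull l g y \<partial>lborel)"
    by (simp add: abs_left_right[symmetric])
  also have "\<dots> = (\<integral>\<^sup>+y. apush (Suc k + l) f y * g y \<partial>lborel)"
    by (rule Suc)
  finally show ?case
    by simp
qed simp

lemma norm_LINT_le: "ennreal (norm (LINT x|M. f x)) \<le> (\<integral>\<^sup>+x. ennreal (norm (f x)) \<partial>M)"
  for f :: "'b \<Rightarrow> complex"
  using integral_norm_bound_ennreal[of M f] not_integrable_integral_eq[of M f] by (cases "integrable M f") auto

lemma norm_push_le:
  assumes "\<And>x. ennreal (norm (f x)) \<le> F x"
  shows "ennreal (norm (push k f y)) \<le> apush k F y"
proof (induction k arbitrary: y)
  case (Suc k)
  show ?case
    unfolding push.simps pull.simps apush.simps apull.simps conv_left_def abs_left_def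
    by (rule order_trans[OF norm_LINT_le], rule nn_integral_mono)
      (use Suc in \<open>auto simp: norm_mult ennreal_mult intro!: mult_right_mono\<close>)
qed (use assms in simp)

lemma norm_pull_le:
  assumes "\<And>x. ennreal (norm (f x)) \<le> F x"
  shows "ennreal (norm (pull k f y)) \<le> apull k F y"
proof (induction k arbitrary: y)
  case (Suc k)
  show ?case
    unfolding push.simps pull.simps apush.simps apull.simps conv_right_def abs_right_def
    by (rule order_trans[OF norm_LINT_le], rule nn_integral_mono)
      (use Suc in \<open>auto simp: norm_mult ennreal_mult intro!: mult_left_mono\<close>)
qed (use assms in simp)

lemma left_right:
  assumes [measurable]: "f \<in> borel_measurable borel" "g \<in> borel_measurable borel"
    and fin: "(\<integral>\<^sup>+x. ennreal (norm (f x)) * abs_right (\<lambda>y. ennreal (norm (g y))) x \<partial>lborel) < \<infinity>"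
  shows "(LINT y|lborel. conv_left f \<phi> y * g y) = (LINT x|lborel. f x * conv_right \<phi> g x)"
proof -
  have "integrable (lborel \<Otimes>\<^sub>M lborel) (\<lambda>(x, y). f x * \<phi> x y * g y)"
  proof (rule integrableI_bounded)
    show "(\<lambda>(x, y). f x * \<phi> x y * g y) \<in> borel_measurable (lborel \<Otimes>\<^sub>M lborel)"
      by measurable
    have "(\<integral>\<^sup>+p. ennreal (norm (case p of (x, y) \<Rightarrow> f x * \<phi> x y * g y)) \<partial>(lborel \<Otimes>\<^sub>M lborel)) =
        (\<integral>\<^sup>+x. \<integral>\<^sup>+y. ennreal (norm (f x * \<phi> x y * g y)) \<partial>lborel \<partial>lborel)"
      by (subst lborel.nn_integral_fst[symmetric]) simp_all
    also have "\<dots> = (\<integral>\<^sup>+x. ennreal (norm (f x)) * abs_right (\<lambda>y. ennreal (norm (g y))) x \<partial>lborel)"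
      unfolding abs_right_def by (simp add: norm_mult ennreal_mult mult.assoc nn_integral_cmult)
    finally show "(\<integral>\<^sup>+p. ennreal (norm (case p of (x, y) \<Rightarrow> f x * \<phi> x y * g y)) \<partial>(lborel \<Otimes>\<^sub>M lborel)) < \<infinity>"
      using fin by simp
  qed
  note swap = lborel_pair.Fubini_integral[OF this]
  have l: "conv_left f \<phi> y * g y = (LINT x|lborel. f x * \<phi> x y * g y)" for y
    by (simp add: conv_left_def)
  have r: "f x * conv_right \<phi> g x = (LINT y|lborel. f x * \<phi> x y * g y)" for x
    by (simp add: conv_right_def mult.assoc)
  show ?thesis
    unfolding l r by (rule swap)
qed

text \<open>Factors \<open>\<phi>\<close> move across the pairing one at a time by Fubini's theorem. All intermediate absolute
  integrals have the same value by \<open>apush_apull\<close>, so one finiteness assumption is enough. For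
  \<open>f = \<upsilon>\<^sub>i * \<phi>\<close> the bound \<open>F\<close> will be a sum of absolute values rather than the absolute value of \<open>f\<close>.\<close>

lemma push_pull:
  assumes [measurable]: "f \<in> borel_measurable borel" "g \<in> borel_measurable borel"
    and F: "F \<in> borel_measurable borel" "\<And>x. ennreal (norm (f x)) \<le> F x"
    and fin: "(\<integral>\<^sup>+y. apush (k + l) F y * ennreal (norm (g y)) \<partial>lborel) < \<infinity>"
  shows "(LINT y|lborel. push k f y * pull l g y) = (LINT y|lborel. push (k + l) f y * g y)"
  using fin
proof (induction l arbitrary: k)
  case (Suc l)
  let ?g = "\<lambda>y. ennreal (norm (g y))"
  note [measurable] = F(1)
  have "(\<integral>\<^sup>+x. ennreal (norm (push k f x)) * abs_right (\<lambda>y. ennreal (norm (pull l g y))) x \<partial>lborel)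
      \<le> (\<integral>\<^sup>+x. apush k F x * apull (Suc l) ?g x \<partial>lborel)"
  proof (rule nn_integral_mono, rule mult_mono)
    fix x
    show "ennreal (norm (push k f x)) \<le> apush k F x"
      by (rule norm_push_le[OF F(2)])
    show "abs_right (\<lambda>y. ennreal (norm (pull l g y))) x \<le> apull (Suc l) ?g x"
      unfolding push.simps pull.simps apush.simps apull.simps abs_right_def
      by (intro nn_integral_mono mult_left_mono norm_pull_le) auto
  qed auto
  also have "\<dots> < \<infinity>"
    using Suc.prems by (subst apush_apull) simp_all
  finally have "(LINT y|lborel. push k f y * pull (Suc l) g y) = (LINT y|lborel. push (Suc k) f y * pull l g y)"
    using left_right[of "push k f" "pull l g"] by simp
  also have "\<dots> = (LINT y|lborel. push (Suc k + l) f y * g y)"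
    using Suc.prems by (intro Suc.IH) simp
  finally show ?case
    by simp
qed simp

lemma apush_eq_apull:
  "apush k (\<lambda>y. ennreal (norm (\<phi> x y))) z = apull k (\<lambda>y. ennreal (norm (\<phi> y z))) x"
proof (cases k)
  case (Suc l)
  have "apush (Suc l) (\<lambda>y. ennreal (norm (\<phi> x y))) z =
     (\<integral>\<^sup>+w. apush l (\<lambda>y. ennreal (norm (\<phi> x y))) w * apull 0 (\<lambda>y. ennreal (norm (\<phi> y z))) w \<partial>lborel)"
    by (simp add: abs_left_def)
  also have "\<dots> = (\<integral>\<^sup>+w. apush 0 (\<lambda>y. ennreal (norm (\<phi> x y))) w * apull l (\<lambda>y. ennreal (norm (\<phi> y z))) w \<partial>lborel)"
    by (subst (1 2) apush_apull) simp_all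
  also have "\<dots> = apull (Suc l) (\<lambda>y. ennreal (norm (\<phi> y z))) x"
    by (simp add: abs_right_def)
  finally show ?thesis
    using Suc by simp
qed simp

text \<open>The kernel \<open>\<phi>\<^bsup>(n,r)\<^esup>\<close> may be read as a function of its second argument built up from the left or of
  its first argument built up from the right; rows of the bordered matrix need the former and columns
  the latter.\<close>

lemma push_eq_pull:
  assumes fin: "apush k (\<lambda>y. ennreal (norm (\<phi> x y))) z < \<infinity>"
  shows "push k (\<phi> x) z = pull k (\<lambda>y. \<phi> y z) x"
proof (cases k)
  case (Suc l)
  have "push (Suc l) (\<phi> x) z = (LINT w|lborel. push (0 + l) (\<phi> x) w * \<phi> w z)"
    by (simp add: conv_left_def)
  also have "\<dots> = (LINT w|lborel. push 0 (\<phi> x) w * pull l (\<lambda>y. \<phi> y z) w)"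
  proof (rule push_pull[symmetric, where F = "\<lambda>y. ennreal (norm (\<phi> x y))"])
    show "(\<integral>\<^sup>+y. apush (0 + l) (\<lambda>y. ennreal (norm (\<phi> x y))) y * ennreal (norm (\<phi> y z)) \<partial>lborel) < \<infinity>"
      using fin Suc by (simp add: abs_left_def)
  qed auto
  also have "\<dots> = pull (Suc l) (\<lambda>y. \<phi> y z) x"
    by (simp add: conv_right_def)
  finally show ?thesis
    using Suc by simp
qed simp

text \<open>In the Gram matrix the sum over the fixed configuration stands outside the convolutions with \<open>\<phi>\<close>.\<close>

lemma push_sum:
  assumes "finite S" and [measurable]: "\<And>s. s \<in> S \<Longrightarrow> f s \<in> borel_measurable borel"
    and fin: "\<And>s i y. s \<in> S \<Longrightarrow> i \<le> k \<Longrightarrow> apush i (\<lambda>x. ennreal (norm (f s x))) y < \<infinity>"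
  shows "push k (\<lambda>x. \<Sum>s\<in>S. c s * f s x) y = (\<Sum>s\<in>S. c s * push k (f s) y)"
  using fin
proof (induction k arbitrary: y)
  case (Suc k)
  have int: "integrable lborel (\<lambda>x. push k (f s) x * \<phi> x y)" if s: "s \<in> S" for s
  proof (rule integrableI_bounded)
    note [measurable] = assms(2)[OF s]
    show "(\<lambda>x. push k (f s) x * \<phi> x y) \<in> borel_measurable lborel"
      by measurable
    have "(\<integral>\<^sup>+x. ennreal (norm (push k (f s) x * \<phi> x y)) \<partial>lborel) \<le> apush (Suc k) (\<lambda>x. ennreal (norm (f s x))) y"
      unfolding push.simps pull.simps apush.simps apull.simps abs_left_def
      by (rule nn_integral_mono) (auto simp: norm_mult ennreal_mult intro!: mult_right_mono norm_push_le)
    also have "\<dots> < \<infinity>"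
      by (rule Suc.prems[OF s order_refl])
    finally show "(\<integral>\<^sup>+x. ennreal (norm (push k (f s) x * \<phi> x y)) \<partial>lborel) < \<infinity>" .
  qed
  have "push k (\<lambda>x. \<Sum>s\<in>S. c s * f s x) = (\<lambda>y. \<Sum>s\<in>S. c s * push k (f s) y)"
    using Suc.prems by (intro ext Suc.IH) simp
  then have "push (Suc k) (\<lambda>x. \<Sum>s\<in>S. c s * f s x) y =
      (LINT x|lborel. (\<Sum>s\<in>S. c s * (push k (f s) x * \<phi> x y)))"
    by (simp add: conv_left_def sum_distrib_right mult.assoc)
  also have "\<dots> = (\<Sum>s\<in>S. c s * push (Suc k) (f s) y)"
    using int by (subst Bochner_Integration.integral_sum) (auto simp: conv_left_def)
  finally show ?case .
qed simp

lemma apush_sum: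
  assumes "finite S" and [measurable]: "\<And>s. s \<in> S \<Longrightarrow> f s \<in> borel_measurable borel"
  shows "apush k (\<lambda>x. \<Sum>s\<in>S. c s * f s x) y = (\<Sum>s\<in>S. c s * apush k (f s) y)"
proof (induction k arbitrary: y)
  case (Suc k)
  have "apush k (\<lambda>x. \<Sum>s\<in>S. c s * f s x) = (\<lambda>y. \<Sum>s\<in>S. c s * apush k (f s) y)"
    using Suc by (auto simp: fun_eq_iff)
  then have "apush (Suc k) (\<lambda>x. \<Sum>s\<in>S. c s * f s x) y =
      (\<integral>\<^sup>+x. (\<Sum>s\<in>S. c s * (apush k (f s) x * ennreal (norm (\<phi> x y)))) \<partial>lborel)"
    by (simp add: abs_left_def sum_distrib_right mult.assoc)
  also have "\<dots> = (\<Sum>s\<in>S. c s * apush (Suc k) (f s) y)"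
    by (subst nn_integral_sum) (auto simp: abs_left_def nn_integral_cmult intro!: sum.cong)
  finally show ?case .
qed simp

abbreviation "absk \<equiv> (\<lambda>x y. complex_of_real (norm (\<phi> x y)))"

text \<open>The hypothesis on absolute convergence speaks of Bochner integrals, which are \<open>0\<close> when they
  diverge. Because every step is required to be integrable, they agree with the integrals in \<open>[0, \<infinity>]\<close>,
  and these are finite.\<close>

lemma conv_left_abs_finite:
  fixes u :: "real \<Rightarrow> real"
  assumes [measurable]: "u \<in> borel_measurable borel" and u: "\<And>x. 0 \<le> u x"
    and int: "\<And>i y. i < k \<Longrightarrow>
      integrable lborel (\<lambda>z. ((\<lambda>h. conv_left h absk) ^^ i) (\<lambda>x. complex_of_real (u x)) z * absk z y)"
  shows "((\<lambda>h. conv_left h absk) ^^ k) (\<lambda>x. complex_of_real (u x)) y =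
      complex_of_real (enn2real (apush k (\<lambda>x. ennreal (u x)) y)) \<and> apush k (\<lambda>x. ennreal (u x)) y < \<infinity>"
  using int
proof (induction k arbitrary: y)
  case (Suc k)
  define v where "v z = enn2real (apush k (\<lambda>x. ennreal (u x)) z)" for z
  have eq: "((\<lambda>h. conv_left h absk) ^^ k) (\<lambda>x. complex_of_real (u x)) = (\<lambda>z. complex_of_real (v z))"
    unfolding v_def by (intro ext conjunct1[OF Suc.IH] Suc.prems) (rule less_SucI)
  have v0: "0 \<le> v z" for z
    by (simp add: v_def)
  have av: "apush k (\<lambda>x. ennreal (u x)) z = ennreal (v z)" for z
    using conjunct2[OF Suc.IH[OF Suc.prems[OF less_SucI]], of z] by (simp add: v_def)
  have "integrable lborel (\<lambda>z. complex_of_real (v z * norm (\<phi> z y)))"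
    using Suc.prems[of k y] unfolding eq by simp
  then have i: "integrable lborel (\<lambda>z. v z * norm (\<phi> z y))"
    by (rule iffD1[OF complex_of_real_integrable_eq])
  have "apush (Suc k) (\<lambda>x. ennreal (u x)) y = (\<integral>\<^sup>+z. ennreal (v z * norm (\<phi> z y)) \<partial>lborel)"
    by (simp add: abs_left_def av ennreal_mult v0)
  also have "\<dots> = ennreal (LINT z|lborel. v z * norm (\<phi> z y))"
    using i by (rule nn_integral_eq_integral) (simp add: v_def)
  finally have a: "apush (Suc k) (\<lambda>x. ennreal (u x)) y = ennreal (LINT z|lborel. v z * norm (\<phi> z y))" .
  have "((\<lambda>h. conv_left h absk) ^^ Suc k) (\<lambda>x. complex_of_real (u x)) y =
      (LINT z|lborel. complex_of_real (v z * norm (\<phi> z y)))"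
    by (simp add: eq conv_left_def)
  also have "\<dots> = complex_of_real (LINT z|lborel. v z * norm (\<phi> z y))"
    by (rule integral_complex_of_real)
  finally show ?case
    using a by (simp add: v0)
qed (simp add: u)

lemma conv_right_abs_finite:
  fixes u :: "real \<Rightarrow> real"
  assumes [measurable]: "u \<in> borel_measurable borel" and u: "\<And>x. 0 \<le> u x"
    and int: "\<And>i x. i < k \<Longrightarrow>
      integrable lborel (\<lambda>z. absk x z * (conv_right absk ^^ i) (\<lambda>x. complex_of_real (u x)) z)"
  shows "(conv_right absk ^^ k) (\<lambda>x. complex_of_real (u x)) y =
      complex_of_real (enn2real (apull k (\<lambda>x. ennreal (u x)) y)) \<and> apull k (\<lambda>x. ennreal (u x)) y < \<infinity>"
  using int
proof (induction k arbitrary: y)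
  case (Suc k)
  define v where "v z = enn2real (apull k (\<lambda>x. ennreal (u x)) z)" for z
  have eq: "(conv_right absk ^^ k) (\<lambda>x. complex_of_real (u x)) = (\<lambda>z. complex_of_real (v z))"
    unfolding v_def by (intro ext conjunct1[OF Suc.IH] Suc.prems) (rule less_SucI)
  have v0: "0 \<le> v z" for z
    by (simp add: v_def)
  have av: "apull k (\<lambda>x. ennreal (u x)) z = ennreal (v z)" for z
    using conjunct2[OF Suc.IH[OF Suc.prems[OF less_SucI]], of z] by (simp add: v_def)
  have "integrable lborel (\<lambda>z. complex_of_real (norm (\<phi> y z) * v z))"
    using Suc.prems[of k y] unfolding eq by simp
  then have i: "integrable lborel (\<lambda>z. norm (\<phi> y z) * v z)"
    by (rule iffD1[OF complex_of_real_integrable_eq])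
  have "apull (Suc k) (\<lambda>x. ennreal (u x)) y = (\<integral>\<^sup>+z. ennreal (norm (\<phi> y z) * v z) \<partial>lborel)"
    by (simp add: abs_right_def av ennreal_mult v0)
  also have "\<dots> = ennreal (LINT z|lborel. norm (\<phi> y z) * v z)"
    using i by (rule nn_integral_eq_integral) (simp add: v_def)
  finally have a: "apull (Suc k) (\<lambda>x. ennreal (u x)) y = ennreal (LINT z|lborel. norm (\<phi> y z) * v z)" .
  have "(conv_right absk ^^ Suc k) (\<lambda>x. complex_of_real (u x)) y =
      (LINT z|lborel. complex_of_real (norm (\<phi> y z) * v z))"
    by (simp add: eq conv_right_def)
  also have "\<dots> = complex_of_real (LINT z|lborel. norm (\<phi> y z) * v z)"
    by (rule integral_complex_of_real)
  finally show ?case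
    using a by (simp add: v0)
qed (simp add: u)

end

lemma conv2_iterate: "((\<lambda>f. conv2 f g) ^^ k) h x = ((\<lambda>u. conv_left u g) ^^ k) (h x)"
  by (induction k) (auto simp: conv2_def conv_left_def fun_eq_iff)

section \<open>The bordered matrix of a point configuration\<close>

text \<open>The bounds are what absolute convergence gives for the integrals in \<open>[0, \<infinity>]\<close>. An iterated
  convolution between two levels among \<open>m+1, ..., m+L\<close> has fewer than \<open>L\<close> factors beyond its initial
  function.\<close>

locale bordered = kernel \<phi> for \<phi> :: "real \<Rightarrow> real \<Rightarrow> complex" +
  fixes m L :: nat and S :: "real set" and \<phi>v :: "real \<Rightarrow> complex"
    and \<upsilon> :: "nat \<Rightarrow> real \<Rightarrow> complex" and \<psi> :: "nat \<Rightarrow> real \<Rightarrow> complex"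
  assumes L_pos: "0 < L" and S_finite: "finite S"
    and virt_measurable [measurable]: "\<phi>v \<in> borel_measurable borel"
    and psi_measurable: "\<And>j. j \<in> {1..m+L} \<Longrightarrow> \<psi> j \<in> borel_measurable borel"
    and finite_kernel: "\<And>k x y. k < L \<Longrightarrow> apush k (\<lambda>z. ennreal (norm (\<phi> x z))) y < \<infinity>"
    and finite_upsilon: "\<And>i k y. i \<in> {1..m} \<Longrightarrow> k < L \<Longrightarrow>
      apush k (\<lambda>z. \<Sum>s\<in>S. ennreal (norm (\<upsilon> i s)) * ennreal (norm (\<phi> s z))) y < \<infinity>"
    and finite_virt: "\<And>k y. k < L \<Longrightarrow> apush k (\<lambda>z. ennreal (norm (\<phi>v z))) y < \<infinity>"
    and finite_psi: "\<And>j k y. j \<in> {1..m+L} \<Longrightarrow> k < L \<Longrightarrow> apull k (\<lambda>z. ennreal (norm (\<psi> j z))) y < \<infinity>"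
    and finite_gram_upsilon: "\<And>i j. i \<in> {1..m} \<Longrightarrow> j \<in> {1..m+L} \<Longrightarrow>
      (\<integral>\<^sup>+y. apush (L - 1) (\<lambda>z. \<Sum>s\<in>S. ennreal (norm (\<upsilon> i s)) * ennreal (norm (\<phi> s z))) y *
        ennreal (norm (\<psi> j y)) \<partial>lborel) < \<infinity>"
    and finite_gram_virt: "\<And>i j. i \<in> {m+1..m+L} \<Longrightarrow> j \<in> {1..m+L} \<Longrightarrow>
      (\<integral>\<^sup>+y. apush (m + L - i) (\<lambda>z. ennreal (norm (\<phi>v z))) y * ennreal (norm (\<psi> j y)) \<partial>lborel) < \<infinity>"
begin

text \<open>An index of the bordered matrix is \<open>Inl i\<close> with \<open>1 \<le> i \<le> m + L\<close> or \<open>Inr p\<close> for a point \<open>p\<close> of level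
  \<open>lev p\<close> and position \<open>x p\<close>. Each row \<open>a\<close> comes from a function \<open>row_fun x a\<close> that lives on the level
  \<open>row_start lev a\<close>: the convolution of \<open>\<upsilon>\<^sub>i\<close> with \<open>\<phi>\<close> on level \<open>m + 1\<close>, the function \<open>\<phi>(virt, _)\<close> on level \<open>i\<close>, or
  \<open>\<phi>(x, _)\<close> on the level after that of a point. Then \<open>row lev x a n\<close> is this function transported to level
  \<open>n\<close>, and \<open>0\<close> on earlier levels. Likewise \<open>col lev x b n\<close> transports \<open>\<psi>\<^sub>j\<close> from level \<open>m + L\<close>, or \<open>\<phi>(_, x)\<close> from the
  level before that of a point, back to level \<open>n\<close>; \<open>col_end lev b\<close> is the first level on which it is \<open>0\<close>.\<close>

definition source :: "nat \<Rightarrow> real \<Rightarrow> complex" where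
  "source i = (if i \<le> m then conv_fin S (\<upsilon> i) \<phi> else \<phi>v)"

definition abs_source :: "nat \<Rightarrow> real \<Rightarrow> ennreal" where
  "abs_source i = (if i \<le> m then (\<lambda>z. \<Sum>s\<in>S. ennreal (norm (\<upsilon> i s)) * ennreal (norm (\<phi> s z)))
     else (\<lambda>z. ennreal (norm (\<phi>v z))))"

definition row_fun :: "('p \<Rightarrow> real) \<Rightarrow> nat + 'p \<Rightarrow> real \<Rightarrow> complex" where
  "row_fun x a = (case a of Inl i \<Rightarrow> source i | Inr p \<Rightarrow> \<phi> (x p))"

definition abs_row_fun :: "('p \<Rightarrow> real) \<Rightarrow> nat + 'p \<Rightarrow> real \<Rightarrow> ennreal" where
  "abs_row_fun x a = (case a of Inl i \<Rightarrow> abs_source i | Inr p \<Rightarrow> (\<lambda>z. ennreal (norm (\<phi> (x p) z))))"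

definition col_fun :: "('p \<Rightarrow> real) \<Rightarrow> nat + 'p \<Rightarrow> real \<Rightarrow> complex" where
  "col_fun x b = (case b of Inl j \<Rightarrow> \<psi> j | Inr p \<Rightarrow> (\<lambda>z. \<phi> z (x p)))"

definition row_start :: "('p \<Rightarrow> nat) \<Rightarrow> nat + 'p \<Rightarrow> nat" where
  "row_start lev a = (case a of Inl i \<Rightarrow> max i (Suc m) | Inr p \<Rightarrow> Suc (lev p))"

definition col_end :: "('p \<Rightarrow> nat) \<Rightarrow> nat + 'p \<Rightarrow> nat" where
  "col_end lev b = (case b of Inl j \<Rightarrow> Suc (m + L) | Inr p \<Rightarrow> lev p)"

definition row :: "('p \<Rightarrow> nat) \<Rightarrow> ('p \<Rightarrow> real) \<Rightarrow> nat + 'p \<Rightarrow> nat \<Rightarrow> real \<Rightarrow> complex" where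
  "row lev x a n y = (if row_start lev a \<le> n then push (n - row_start lev a) (row_fun x a) y else 0)"

definition abs_row :: "('p \<Rightarrow> nat) \<Rightarrow> ('p \<Rightarrow> real) \<Rightarrow> nat + 'p \<Rightarrow> nat \<Rightarrow> real \<Rightarrow> ennreal" where
  "abs_row lev x a n y = (if row_start lev a \<le> n then apush (n - row_start lev a) (abs_row_fun x a) y else 0)"

definition col :: "('p \<Rightarrow> nat) \<Rightarrow> ('p \<Rightarrow> real) \<Rightarrow> nat + 'p \<Rightarrow> nat \<Rightarrow> real \<Rightarrow> complex" where
  "col lev x b n y = (if n < col_end lev b then pull (col_end lev b - Suc n) (col_fun x b) y else 0)"

definition abs_col :: "('p \<Rightarrow> nat) \<Rightarrow> ('p \<Rightarrow> real) \<Rightarrow> nat + 'p \<Rightarrow> nat \<Rightarrow> real \<Rightarrow> ennreal" where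
  "abs_col lev x b n y = (if n < col_end lev b
     then apull (col_end lev b - Suc n) (\<lambda>z. ennreal (norm (col_fun x b z))) y else 0)"

text \<open>The blocks are the Gram matrix (\<open>Inl\<close>, \<open>Inl\<close>), the functions of the process at the points (\<open>Inl\<close>, \<open>Inr\<close>
  and \<open>Inr\<close>, \<open>Inl\<close>), and \<open>\<phi>\<^bsup>(n,n')\<^esup>(x, x')\<close> for two points.\<close>

definition bmat :: "('p \<Rightarrow> nat) \<Rightarrow> ('p \<Rightarrow> real) \<Rightarrow> nat + 'p \<Rightarrow> nat + 'p \<Rightarrow> complex" where
  "bmat lev x a b = (case b of
     Inr p \<Rightarrow> row lev x a (lev p) (x p)
   | Inl j \<Rightarrow> (case a of
       Inl i \<Rightarrow> (LINT z|lborel. row lev x a (m + L) z * \<psi> j z)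
     | Inr p \<Rightarrow> col lev x b (lev p) (x p)))"

definition abs_bmat :: "('p \<Rightarrow> nat) \<Rightarrow> ('p \<Rightarrow> real) \<Rightarrow> nat + 'p \<Rightarrow> nat + 'p \<Rightarrow> ennreal" where
  "abs_bmat lev x a b = (case b of
     Inr p \<Rightarrow> abs_row lev x a (lev p) (x p)
   | Inl j \<Rightarrow> (case a of
       Inl i \<Rightarrow> (\<integral>\<^sup>+z. abs_row lev x a (m + L) z * ennreal (norm (\<psi> j z)) \<partial>lborel)
     | Inr p \<Rightarrow> abs_col lev x b (lev p) (x p)))"

definition idx :: "'p set \<Rightarrow> (nat + 'p) set" where
  "idx P = Inl ` {1..m+L} \<union> Inr ` P"

lemma idx_insert: "idx (insert q P) = insert (Inr q) (idx P)"
  by (auto simp: idx_def)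

lemma finite_idx [simp]: "finite P \<Longrightarrow> finite (idx P)"
  by (simp add: idx_def)

lemma Inr_idx_iff [simp]: "Inr p \<in> idx P \<longleftrightarrow> p \<in> P"
  by (auto simp: idx_def)

lemma Inl_idx_iff [simp]: "Inl i \<in> idx P \<longleftrightarrow> i \<in> {1..m+L}"
  by (auto simp: idx_def)

lemma source_measurable [measurable]: "source i \<in> borel_measurable borel"
proof (cases "i \<le> m")
  case True
  have "conv_fin S (\<upsilon> i) \<phi> \<in> borel_measurable borel"
    unfolding conv_fin_def by measurable
  then show ?thesis
    using True by (simp add: source_def)
qed (simp add: source_def)

lemma abs_source_measurable [measurable]: "abs_source i \<in> borel_measurable borel"
  unfolding abs_source_def by simp

lemma row_fun_measurable [measurable]: "row_fun x a \<in> borel_measurable borel"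
  unfolding row_fun_def by (cases a) simp_all

lemma abs_row_fun_measurable [measurable]: "abs_row_fun x a \<in> borel_measurable borel"
  unfolding abs_row_fun_def by (cases a) simp_all

lemma col_fun_measurable: "b \<in> idx P \<Longrightarrow> col_fun x b \<in> borel_measurable borel"
  unfolding col_fun_def using psi_measurable by (cases b) auto

lemma norm_source_le: "ennreal (norm (source i z)) \<le> abs_source i z"
proof -
  have "ennreal (norm (\<Sum>s\<in>S. \<upsilon> i s * \<phi> s z)) \<le> ennreal (\<Sum>s\<in>S. norm (\<upsilon> i s) * norm (\<phi> s z))"
    by (intro ennreal_leI order_trans[OF norm_sum]) (simp add: norm_mult)
  also have "\<dots> = (\<Sum>s\<in>S. ennreal (norm (\<upsilon> i s)) * ennreal (norm (\<phi> s z)))"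
    by (subst sum_ennreal[symmetric]) (auto simp: ennreal_mult)
  finally show ?thesis
    by (simp add: source_def abs_source_def conv_fin_def)
qed

lemma norm_row_fun_le: "ennreal (norm (row_fun x a z)) \<le> abs_row_fun x a z"
  unfolding row_fun_def abs_row_fun_def by (cases a) (simp_all add: norm_source_le)

lemma norm_row_le: "ennreal (norm (row lev x a n z)) \<le> abs_row lev x a n z"
  unfolding row_def abs_row_def by (auto intro: norm_push_le[OF norm_row_fun_le])

lemma norm_col_le: "ennreal (norm (col lev x a n z)) \<le> abs_col lev x a n z"
  unfolding col_def abs_col_def by (auto intro: norm_pull_le)

lemma norm_bmat_le: "ennreal (norm (bmat lev x a b)) \<le> abs_bmat lev x a b"
  unfolding bmat_def abs_bmat_def
  by (cases a; cases b)
    (auto simp: norm_row_le norm_col_le norm_mult ennreal_mult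
      intro!: order_trans[OF norm_LINT_le] nn_integral_mono mult_right_mono)

lemma bmat_nonzero_imp_le:
  assumes "bmat lev x a b \<noteq> 0" "a \<in> idx P" "b \<in> idx P" "lev ` P \<subseteq> {m+1..m+L}"
  shows "row_start lev a \<le> col_end lev b"
proof (cases b)
  case (Inl j)
  then show ?thesis
    using assms(2) assms(4) by (cases a) (force simp: row_start_def col_end_def)+
next
  case (Inr p)
  then show ?thesis
    using assms(1) by (auto simp: bmat_def row_def col_end_def split: if_splits)
qed

lemma abs_bmat_finite:
  assumes lev: "lev ` P \<subseteq> {m+1..m+L}" and a: "a \<in> idx P" and b: "b \<in> idx P"
  shows "abs_bmat lev x a b < \<infinity>"
proof (cases b)
  case bj: (Inl j)
  then have j: "j \<in> {1..m+L}"
    using b by simp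
  show ?thesis
  proof (cases a)
    case (Inl i)
    show ?thesis
    proof (cases "i \<le> m")
      case True
      then show ?thesis
        using finite_gram_upsilon[OF _ j, of i] a L_pos
        by (simp add: bj Inl abs_bmat_def abs_row_def row_start_def abs_row_fun_def abs_source_def)
    next
      case False
      then have "max i (Suc m) = i"
        by simp
      then show ?thesis
        using finite_gram_virt[OF _ j, of i] a False
        by (simp add: bj Inl abs_bmat_def abs_row_def row_start_def abs_row_fun_def abs_source_def)
    qed
  next
    case (Inr p)
    then have "lev p \<in> {m+1..m+L}"
      using a lev by auto
    then have "m + L - lev p < L"
      using L_pos by auto
    then show ?thesis
      using finite_psi[OF j]
      by (simp add: bj Inr abs_bmat_def abs_col_def col_end_def col_fun_def)
  qed
next
  case bp: (Inr p)
  then have p: "lev p \<in> {m+1..m+L}"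
    using b lev by auto
  show ?thesis
  proof (cases "row_start lev a \<le> lev p")
    case le: True
    show ?thesis
    proof (cases a)
      case (Inl i)
      then have "lev p - row_start lev a < L" "i \<in> {1..m+L}"
        using p a by (auto simp: row_start_def)
      then show ?thesis
        using finite_upsilon[of i "lev p - row_start lev a"] finite_virt[of "lev p - row_start lev a"]
        by (simp add: bp Inl abs_bmat_def abs_row_def abs_row_fun_def abs_source_def)
    next
      case (Inr p')
      then have "m + 1 \<le> lev p'"
        using a lev by auto
      then have "lev p - row_start lev a < L"
        using p Inr by (auto simp: row_start_def)
      then show ?thesis
        using finite_kernel by (simp add: bp Inr abs_bmat_def abs_row_def abs_row_fun_def)
    qed
  qed (simp add: bp abs_bmat_def abs_row_def)
qed

lemma abs_bmat_pairing:
  assumes lt: "row_start lev a < col_end lev b" and b: "b \<in> idx P"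
  shows "abs_bmat lev x a b = (\<integral>\<^sup>+z. apush (col_end lev b - Suc (row_start lev a)) (abs_row_fun x a) z *
    ennreal (norm (col_fun x b z)) \<partial>lborel)"
proof (cases b)
  case bp: (Inr p)
  then have "lev p - row_start lev a = Suc (lev p - Suc (row_start lev a))"
    using lt by (simp add: col_end_def)
  then show ?thesis
    using lt by (simp add: bp abs_bmat_def abs_row_def col_end_def col_fun_def abs_left_def)
next
  case bj: (Inl j)
  then have [measurable]: "\<psi> j \<in> borel_measurable borel"
    using b psi_measurable by simp
  show ?thesis
  proof (cases a)
    case (Inl i)
    then show ?thesis
      using lt by (simp add: bj abs_bmat_def abs_row_def col_end_def col_fun_def)
  next
    case (Inr p)
    then have eq: "m + L - lev p = Suc (m + L - Suc (lev p))" and lt': "lev p < Suc (m + L)"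
      using lt by (simp_all add: row_start_def col_end_def bj)
    have "abs_bmat lev x a b = (\<integral>\<^sup>+z. apush 0 (\<lambda>z. ennreal (norm (\<phi> (x p) z))) z *
       apull (m + L - Suc (lev p)) (\<lambda>z. ennreal (norm (\<psi> j z))) z \<partial>lborel)"
      using lt' by (simp add: bj Inr abs_bmat_def abs_col_def col_end_def col_fun_def eq abs_right_def)
    also have "\<dots> = (\<integral>\<^sup>+z. apush (0 + (m + L - Suc (lev p))) (\<lambda>z. ennreal (norm (\<phi> (x p) z))) z *
       ennreal (norm (\<psi> j z)) \<partial>lborel)"
      by (rule apush_apull) measurable
    finally show ?thesis
      by (simp add: bj Inr abs_row_fun_def col_fun_def row_start_def col_end_def)
  qed
qed

text \<open>When the row starts before the column ends, all four blocks are given by one formula: the pairing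
  of the two functions with the right number of convolutions in between.\<close>

lemma bmat_pairing:
  assumes lev: "lev ` P \<subseteq> {m+1..m+L}" and a: "a \<in> idx P" and b: "b \<in> idx P"
    and lt: "row_start lev a < col_end lev b"
  shows "bmat lev x a b = (LINT z|lborel. push (col_end lev b - Suc (row_start lev a)) (row_fun x a) z * col_fun x b z)"
proof (cases b)
  case bp: (Inr p)
  then have "lev p - row_start lev a = Suc (lev p - Suc (row_start lev a))"
    using lt by (simp add: col_end_def)
  then show ?thesis
    using lt by (simp add: bp bmat_def row_def col_end_def col_fun_def conv_left_def)
next
  case bj: (Inl j)
  then have [measurable]: "\<psi> j \<in> borel_measurable borel"
    using b psi_measurable by simp
  show ?thesis
  proof (cases a)
    case (Inl i)
    then show ?thesis
      using lt by (simp add: bj bmat_def row_def col_end_def col_fun_def)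
  next
    case (Inr p)
    then have eq: "m + L - lev p = Suc (m + L - Suc (lev p))" and lt': "lev p < Suc (m + L)"
      using lt by (simp_all add: row_start_def col_end_def bj)
    have fin: "(\<integral>\<^sup>+z. apush (0 + (m + L - Suc (lev p))) (\<lambda>z. ennreal (norm (\<phi> (x p) z))) z *
       ennreal (norm (\<psi> j z)) \<partial>lborel) < \<infinity>"
      using abs_bmat_finite[where x = x, OF lev a b] abs_bmat_pairing[OF lt b, of x]
      by (simp add: bj Inr abs_row_fun_def col_fun_def row_start_def col_end_def)
    have "bmat lev x a b = (LINT z|lborel. push 0 (\<phi> (x p)) z * pull (m + L - Suc (lev p)) (\<psi> j) z)"
      using lt' by (simp add: bj Inr bmat_def col_def col_end_def col_fun_def eq conv_right_def)
    also have "\<dots> = (LINT z|lborel. push (0 + (m + L - Suc (lev p))) (\<phi> (x p)) z * \<psi> j z)"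
      by (rule push_pull[OF _ _ _ _ fin]) auto
    finally show ?thesis
      by (simp add: bj Inr row_fun_def col_fun_def row_start_def col_end_def)
  qed
qed

text \<open>Both sides are the same pairing, computed at level \<open>n\<close> and at the last level before \<open>b\<close> ends.\<close>

lemma abs_detour:
  assumes b: "b \<in> idx P"
  shows "(\<integral>\<^sup>+y. abs_row lev x a n y * abs_col lev x b n y \<partial>lborel) =
    (if row_start lev a \<le> n \<and> n < col_end lev b then abs_bmat lev x a b else 0)"
proof (cases "row_start lev a \<le> n \<and> n < col_end lev b")
  case True
  note [measurable] = col_fun_measurable[OF b]
  have k: "n - row_start lev a + (col_end lev b - Suc n) = col_end lev b - Suc (row_start lev a)"
    using True by simp
  have "(\<integral>\<^sup>+y. abs_row lev x a n y * abs_col lev x b n y \<partial>lborel) =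
     (\<integral>\<^sup>+y. apush (n - row_start lev a) (abs_row_fun x a) y *
        apull (col_end lev b - Suc n) (\<lambda>z. ennreal (norm (col_fun x b z))) y \<partial>lborel)"
    using True by (simp add: abs_row_def abs_col_def)
  also have "\<dots> = (\<integral>\<^sup>+y. apush (col_end lev b - Suc (row_start lev a)) (abs_row_fun x a) y *
      ennreal (norm (col_fun x b y)) \<partial>lborel)"
    by (subst apush_apull) (simp_all add: k)
  also have "\<dots> = abs_bmat lev x a b"
    using True by (intro abs_bmat_pairing[symmetric, OF _ b]) simp
  finally show ?thesis
    using True by simp
next
  case False
  then have "abs_row lev x a n y * abs_col lev x b n y = 0" for y
    by (auto simp: abs_row_def abs_col_def)
  then show ?thesis
    unfolding if_not_P[OF False] by (simp only: nn_integral_const mult_zero_left)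
qed

lemma row_measurable [measurable]: "row lev x a n \<in> borel_measurable borel"
  unfolding row_def by measurable

lemma col_measurable: "b \<in> idx P \<Longrightarrow> col lev x b n \<in> borel_measurable borel"
  using col_fun_measurable[of b P x] unfolding col_def by measurable

lemma detour_integrable:
  assumes lev: "lev ` P \<subseteq> {m+1..m+L}" and a: "a \<in> idx P" and b: "b \<in> idx P"
  shows "integrable lborel (\<lambda>y. row lev x a n y * col lev x b n y)"
proof (rule integrableI_bounded)
  note [measurable] = col_measurable[OF b]
  show "(\<lambda>y. row lev x a n y * col lev x b n y) \<in> borel_measurable lborel"
    by measurable
  have "(\<integral>\<^sup>+y. ennreal (norm (row lev x a n y * col lev x b n y)) \<partial>lborel) \<le>
      (\<integral>\<^sup>+y. abs_row lev x a n y * abs_col lev x b n y \<partial>lborel)"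
    by (intro nn_integral_mono) (auto simp: norm_mult ennreal_mult intro!: mult_mono norm_row_le norm_col_le)
  also have "\<dots> < \<infinity>"
    using abs_bmat_finite[where x = x, OF lev a b] by (simp add: abs_detour[OF b])
  finally show "(\<integral>\<^sup>+y. ennreal (norm (row lev x a n y * col lev x b n y)) \<partial>lborel) < \<infinity>" .
qed

text \<open>The semigroup property of the bordered matrix: a detour through a point of level \<open>n\<close>, integrated
  over its position, is the direct step, provided that the step passes level \<open>n\<close>.\<close>

lemma detour:
  assumes lev: "lev ` P \<subseteq> {m+1..m+L}" and a: "a \<in> idx P" and b: "b \<in> idx P"
  shows "(LINT y|lborel. row lev x a n y * col lev x b n y) =
    (if row_start lev a \<le> n \<and> n < col_end lev b then bmat lev x a b else 0)"
proof (cases "row_start lev a \<le> n \<and> n < col_end lev b")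
  case True
  note [measurable] = col_fun_measurable[OF b]
  have lt: "row_start lev a < col_end lev b"
    using True by simp
  have k: "n - row_start lev a + (col_end lev b - Suc n) = col_end lev b - Suc (row_start lev a)"
    using True by simp
  have "(LINT y|lborel. row lev x a n y * col lev x b n y) =
     (LINT y|lborel. push (n - row_start lev a) (row_fun x a) y * pull (col_end lev b - Suc n) (col_fun x b) y)"
    using True by (simp add: row_def col_def)
  also have "\<dots> = (LINT y|lborel. push (n - row_start lev a + (col_end lev b - Suc n)) (row_fun x a) y * col_fun x b y)"
  proof (rule push_pull)
    show "(\<integral>\<^sup>+y. apush (n - row_start lev a + (col_end lev b - Suc n)) (abs_row_fun x a) y *
        ennreal (norm (col_fun x b y)) \<partial>lborel) < \<infinity>"
      using abs_bmat_finite[where x = x, OF lev a b] abs_bmat_pairing[OF lt b, of x] by (simp add: k)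
  qed (auto simp: norm_row_fun_le)
  also have "\<dots> = bmat lev x a b"
    unfolding k by (rule bmat_pairing[symmetric, OF lev a b lt])
  finally show ?thesis
    using True by simp
next
  case False
  then have "row lev x a n y * col lev x b n y = 0" for y
    by (auto simp: row_def col_def)
  then show ?thesis
    unfolding if_not_P[OF False] by (simp only: integral_zero)
qed

end

section \<open>Integrating out one point\<close>

lemma LINT_nested_sum:
  fixes h :: "'t \<Rightarrow> 'a \<Rightarrow> 'b \<Rightarrow> complex"
  assumes "\<And>t a. t \<in> T \<Longrightarrow> a \<in> A \<Longrightarrow> integrable M (h t a)"
  shows "(LINT y|M. c * (\<Sum>t\<in>T. s t * (\<Sum>a\<in>A. w t a * h t a y))) =
    c * (\<Sum>t\<in>T. s t * (\<Sum>a\<in>A. w t a * (LINT y|M. h t a y)))"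
proof -
  have 1: "integrable M (\<lambda>y. w t a * h t a y)" if "t \<in> T" "a \<in> A" for t a
    using assms[OF that] by (rule integrable_mult_right)
  have 2: "integrable M (\<lambda>y. s t * (\<Sum>a\<in>A. w t a * h t a y))" if "t \<in> T" for t
    by (rule integrable_mult_right, rule Bochner_Integration.integrable_sum, rule 1[OF that])
  have "(LINT y|M. c * (\<Sum>t\<in>T. s t * (\<Sum>a\<in>A. w t a * h t a y))) =
      c * (\<Sum>t\<in>T. LINT y|M. s t * (\<Sum>a\<in>A. w t a * h t a y))"
    by (simp only: integral_mult_right_zero Bochner_Integration.integral_sum[OF 2])
  also have "\<dots> = c * (\<Sum>t\<in>T. s t * (\<Sum>a\<in>A. w t a * (LINT y|M. h t a y)))"
    by (intro arg_cong2[where f = "(*)"] sum.cong refl)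
      (simp only: integral_mult_right_zero Bochner_Integration.integral_sum[OF 1])
  finally show ?thesis .
qed

lemma nn_integral_nested_sum:
  assumes "\<And>t a. t \<in> T \<Longrightarrow> a \<in> A \<Longrightarrow> h t a \<in> borel_measurable M"
  shows "(\<integral>\<^sup>+y. (\<Sum>t\<in>T. \<Sum>a\<in>A. w t a * h t a y) \<partial>M) = (\<Sum>t\<in>T. \<Sum>a\<in>A. w t a * (\<integral>\<^sup>+y. h t a y \<partial>M))"
proof -
  have 1: "(\<lambda>y. w t a * h t a y) \<in> borel_measurable M" if "t \<in> T" "a \<in> A" for t a
    using assms[OF that] by measurable
  then have 2: "(\<lambda>y. \<Sum>a\<in>A. w t a * h t a y) \<in> borel_measurable M" if "t \<in> T" for t
    using that by (intro borel_measurable_sum)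
  show ?thesis
    by (subst nn_integral_sum[OF 2], assumption)
      (intro sum.cong refl, subst nn_integral_sum[OF 1],
       auto intro!: sum.cong simp: nn_integral_cmult assms)
qed

interpretation lebesgue: product_sigma_finite "\<lambda>_. lborel :: real measure"
  by standard

context bordered
begin

text \<open>The next three lemmas isolate the dependence on the position of one point \<open>q\<close>: only the row and the
  column of \<open>q\<close> depend on it.\<close>

lemma bmat_update:
  assumes "q \<notin> P" "a \<in> idx P" "b \<in> idx P"
  shows "bmat lev (x(q := y)) a b = bmat lev x a b"
    and "abs_bmat lev (x(q := y)) a b = abs_bmat lev x a b"
proof -
  have f: "row_fun (x(q := y)) a = row_fun x a" "abs_row_fun (x(q := y)) a = abs_row_fun x a"
    "col_fun (x(q := y)) b = col_fun x b"
    using assms by (cases a; cases b; auto simp: row_fun_def abs_row_fun_def col_fun_def)+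
  then have r: "row lev (x(q := y)) a = row lev x a" "abs_row lev (x(q := y)) a = abs_row lev x a"
    "col lev (x(q := y)) b = col lev x b" "abs_col lev (x(q := y)) b = abs_col lev x b"
    by (intro ext, simp only: row_def abs_row_def col_def abs_col_def f)+
  show "bmat lev (x(q := y)) a b = bmat lev x a b"
    using assms r by (cases a; cases b) (auto simp: bmat_def)
  show "abs_bmat lev (x(q := y)) a b = abs_bmat lev x a b"
    using assms r by (cases a; cases b) (auto simp: abs_bmat_def)
qed

lemma bmat_row:
  assumes "q \<notin> P" "a \<in> idx P"
  shows "bmat lev (x(q := y)) a (Inr q) = row lev x a (lev q) y"
    and "abs_bmat lev (x(q := y)) a (Inr q) = abs_row lev x a (lev q) y"
proof -
  have "row_fun (x(q := y)) a = row_fun x a" "abs_row_fun (x(q := y)) a = abs_row_fun x a"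
    using assms by (cases a; auto simp: row_fun_def abs_row_fun_def)+
  then show "bmat lev (x(q := y)) a (Inr q) = row lev x a (lev q) y"
    and "abs_bmat lev (x(q := y)) a (Inr q) = abs_row lev x a (lev q) y"
    by (simp_all add: bmat_def abs_bmat_def row_def abs_row_def)
qed

lemma bmat_col:
  assumes "q \<notin> P" "b \<in> idx P" and lev: "lev ` P \<subseteq> {m+1..m+L}" "lev q \<in> {m+1..m+L}"
  shows "bmat lev (x(q := y)) (Inr q) b = col lev x b (lev q) y"
    and "abs_bmat lev (x(q := y)) (Inr q) b = abs_col lev x b (lev q) y"
proof -
  have "bmat lev (x(q := y)) (Inr q) b = col lev x b (lev q) y \<and>
    abs_bmat lev (x(q := y)) (Inr q) b = abs_col lev x b (lev q) y"
  proof (cases b)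
    case (Inl j)
    then show ?thesis
      by (simp add: bmat_def abs_bmat_def col_def abs_col_def col_fun_def)
  next
    case (Inr p)
    then have p: "p \<in> P" "p \<noteq> q"
      using assms by auto
    then have "lev p - Suc (lev q) < L"
      using lev by force
    from push_eq_pull[OF finite_kernel[OF this]] show ?thesis
      using p Inr
      by (simp add: bmat_def abs_bmat_def row_def abs_row_def col_def abs_col_def col_end_def
          row_start_def row_fun_def abs_row_fun_def col_fun_def apush_eq_apull)
  qed
  then show "bmat lev (x(q := y)) (Inr q) b = col lev x b (lev q) y"
    and "abs_bmat lev (x(q := y)) (Inr q) b = abs_col lev x b (lev q) y"
    by auto
qed

lemma card_Inl_Un_Inr:
  assumes "finite A" "finite B"
  shows "card (Inl ` A \<union> Inr ` B) = card A + card B"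
  using card_Plus[OF assms] by (simp add: Plus_def)

lemma bmat_diag: "bmat lev x (Inr q) (Inr q) = 0" "abs_bmat lev x (Inr q) (Inr q) = 0"
  by (simp_all add: bmat_def abs_bmat_def row_def abs_row_def row_start_def)

text \<open>The sign accounts for \<open>\<phi>\<^bsup>(n,n')\<^esup>\<close> entering the correlation kernel with a minus sign.\<close>

definition bdet :: "'p set \<Rightarrow> ('p \<Rightarrow> nat) \<Rightarrow> ('p \<Rightarrow> real) \<Rightarrow> complex" where
  "bdet P lev x = (-1) ^ card P * pdet (idx P) (bmat lev x)"

definition abs_perm :: "'p set \<Rightarrow> ('p \<Rightarrow> nat) \<Rightarrow> ('p \<Rightarrow> real) \<Rightarrow> ennreal" where
  "abs_perm P lev x = (\<Sum>\<sigma> | \<sigma> permutes idx P. \<Prod>a\<in>idx P. abs_bmat lev x a (\<sigma> a))"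

text \<open>By \<open>crossing_count\<close> the number of steps passing level \<open>n\<close> is the number of columns ending after \<open>n\<close>
  minus the number of rows starting after \<open>n\<close>. The columns are the \<open>m + L\<close> functions \<open>\<psi>\<^sub>j\<close> and the points of
  level above \<open>n\<close>; the rows are the \<open>m + L - n\<close> virtual ones with \<open>i > n\<close> and the points of level at least
  \<open>n\<close>.\<close>

lemma detour_count:
  assumes P: "finite P" and lev: "lev ` P \<subseteq> {m+1..m+L}" and n: "n \<in> {m+1..m+L}"
    and \<sigma>: "\<sigma> permutes idx P" and nz: "(\<Prod>a\<in>idx P. bmat lev x a (\<sigma> a)) \<noteq> 0"
  shows "card {a\<in>idx P. row_start lev a \<le> n \<and> n < col_end lev (\<sigma> a)} + card {p\<in>P. lev p = n} = n"
proof -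
  have "row_start lev a \<le> col_end lev (\<sigma> a)" if "a \<in> idx P" for a
    using that nz P by (intro bmat_nonzero_imp_le[OF _ that _ lev, of x]) (auto simp: permutes_in_image[OF \<sigma>])
  then have "card {a\<in>idx P. row_start lev a \<le> n \<and> n < col_end lev (\<sigma> a)} + card {a\<in>idx P. n < row_start lev a} =
      card {b\<in>idx P. n < col_end lev b}"
    using P \<sigma> by (intro crossing_count) auto
  moreover have "card {a\<in>idx P. n < row_start lev a} = (m + L - n) + card {p\<in>P. n \<le> lev p}"
  proof -
    have "{a\<in>idx P. n < row_start lev a} = Inl ` {n+1..m+L} \<union> Inr ` {p\<in>P. n \<le> lev p}"
      using n by (auto simp: idx_def row_start_def)
    then show ?thesis
      using P by (simp add: card_Inl_Un_Inr)
  qed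
  moreover have "card {b\<in>idx P. n < col_end lev b} = (m + L) + card {p\<in>P. n < lev p}"
  proof -
    have "{b\<in>idx P. n < col_end lev b} = Inl ` {1..m+L} \<union> Inr ` {p\<in>P. n < lev p}"
      using n by (auto simp: idx_def col_end_def)
    then show ?thesis
      using P by (simp add: card_Inl_Un_Inr)
  qed
  moreover have "card {p\<in>P. n \<le> lev p} = card {p\<in>P. n < lev p} + card {p\<in>P. lev p = n}"
  proof -
    have "{p\<in>P. n \<le> lev p} = {p\<in>P. n < lev p} \<union> {p\<in>P. lev p = n}"
      by auto
    also have "card \<dots> = card {p\<in>P. n < lev p} + card {p\<in>P. lev p = n}"
      using P by (intro card_Un_disjoint) auto
    finally show ?thesis .
  qed
  moreover have "n \<le> m + L"
    using n by simp
  ultimately show ?thesis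
    by linarith
qed

text \<open>Otherwise the number of steps passing level \<open>n\<close> in a nonzero term would be negative.\<close>

lemma bdet_overfull:
  assumes P: "finite P" and lev: "lev ` P \<subseteq> {m+1..m+L}" and n: "n \<in> {m+1..m+L}"
    and over: "n < card {p\<in>P. lev p = n}"
  shows "bdet P lev x = 0"
proof -
  have "(\<Prod>a\<in>idx P. bmat lev x a (\<sigma> a)) = 0" if "\<sigma> permutes idx P" for \<sigma>
  proof (rule ccontr)
    assume "(\<Prod>a\<in>idx P. bmat lev x a (\<sigma> a)) \<noteq> 0"
    from detour_count[OF P lev n that this] over show False
      by linarith
  qed
  then show ?thesis
    by (auto simp: bdet_def pdet_def)
qed

lemma bdet_expand:
  assumes P: "finite P" and q: "q \<notin> P" and lev: "lev ` P \<subseteq> {m+1..m+L}" "lev q \<in> {m+1..m+L}"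
  shows "bdet (insert q P) lev (x(q := y)) = (-1) ^ card P * (\<Sum>\<tau> | \<tau> permutes idx P. of_int (sign \<tau>) *
    (\<Sum>a\<in>idx P. (\<Prod>c\<in>idx P - {a}. bmat lev x c (\<tau> c)) *
      (row lev x a (lev q) y * col lev x (\<tau> a) (lev q) y)))"
proof -
  \<comment> \<open>The sign of the additional point cancels the sign of the detour.\<close>
  have "bdet (insert q P) lev (x(q := y)) = - ((-1) ^ card P) * pdet (insert (Inr q) (idx P)) (bmat lev (x(q := y)))"
    using P q by (simp add: bdet_def idx_insert)
  also have "\<dots> = (-1) ^ card P * (\<Sum>\<tau> | \<tau> permutes idx P. of_int (sign \<tau>) *
    (\<Sum>a\<in>idx P. (\<Prod>c\<in>idx P - {a}. bmat lev (x(q := y)) c (\<tau> c)) *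
      (bmat lev (x(q := y)) a (Inr q) * bmat lev (x(q := y)) (Inr q) (\<tau> a))))"
    using P q by (subst pdet_insert) (simp_all add: bmat_diag)
  also have "\<dots> = (-1) ^ card P * (\<Sum>\<tau> | \<tau> permutes idx P. of_int (sign \<tau>) *
    (\<Sum>a\<in>idx P. (\<Prod>c\<in>idx P - {a}. bmat lev x c (\<tau> c)) *
      (row lev x a (lev q) y * col lev x (\<tau> a) (lev q) y)))"
    by (intro arg_cong2[where f = "(*)"] refl sum.cong prod.cong)
      (auto simp: bmat_update[OF q] bmat_row[OF q] bmat_col[OF q _ lev] permutes_in_image)
  finally show ?thesis .
qed

lemma abs_perm_expand:
  assumes P: "finite P" and q: "q \<notin> P" and lev: "lev ` P \<subseteq> {m+1..m+L}" "lev q \<in> {m+1..m+L}"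
  shows "abs_perm (insert q P) lev (x(q := y)) = (\<Sum>\<tau> | \<tau> permutes idx P.
    \<Sum>a\<in>idx P. (\<Prod>c\<in>idx P - {a}. abs_bmat lev x c (\<tau> c)) *
      (abs_row lev x a (lev q) y * abs_col lev x (\<tau> a) (lev q) y))"
proof -
  have "abs_perm (insert q P) lev (x(q := y)) = (\<Sum>\<tau> | \<tau> permutes idx P.
    \<Sum>a\<in>idx P. (\<Prod>c\<in>idx P - {a}. abs_bmat lev (x(q := y)) c (\<tau> c)) *
      (abs_bmat lev (x(q := y)) a (Inr q) * abs_bmat lev (x(q := y)) (Inr q) (\<tau> a)))"
    unfolding abs_perm_def idx_insert using P q by (subst permanent_insert) (simp_all add: bmat_diag)
  also have "\<dots> = (\<Sum>\<tau> | \<tau> permutes idx P.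
    \<Sum>a\<in>idx P. (\<Prod>c\<in>idx P - {a}. abs_bmat lev x c (\<tau> c)) *
      (abs_row lev x a (lev q) y * abs_col lev x (\<tau> a) (lev q) y))"
    by (intro arg_cong2[where f = "(*)"] refl sum.cong prod.cong)
      (auto simp: bmat_update[OF q] bmat_row[OF q] bmat_col[OF q _ lev] permutes_in_image)
  finally show ?thesis .
qed

text \<open>Each term of \<open>bdet P\<close> arises once for every step that passes the level of \<open>q\<close>, and by \<open>detour_count\<close>
  the number of these steps is the same for all terms.\<close>

lemma bdet_integrate_out:
  assumes P: "finite P" and q: "q \<notin> P" and lev: "lev ` P \<subseteq> {m+1..m+L}" "lev q \<in> {m+1..m+L}"
  shows "(LINT y|lborel. bdet (insert q P) lev (x(q := y))) =
    (of_nat (lev q) - of_nat (card {p\<in>P. lev p = lev q})) * bdet P lev x"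
proof -
  let ?n = "lev q"
  let ?g = "\<lambda>\<tau> a. if row_start lev a \<le> ?n \<and> ?n < col_end lev (\<tau> a) then bmat lev x a (\<tau> a) else 0"
  have int: "integrable lborel (\<lambda>y. row lev x a ?n y * col lev x (\<tau> a) ?n y)"
    if "\<tau> permutes idx P" "a \<in> idx P" for \<tau> a
    using that by (intro detour_integrable[OF lev(1)]) (auto simp: permutes_in_image)
  have "(LINT y|lborel. bdet (insert q P) lev (x(q := y))) =
    (-1) ^ card P * (\<Sum>\<tau> | \<tau> permutes idx P. of_int (sign \<tau>) *
      (\<Sum>a\<in>idx P. (\<Prod>c\<in>idx P - {a}. bmat lev x c (\<tau> c)) *
        (LINT y|lborel. row lev x a ?n y * col lev x (\<tau> a) ?n y)))"
    unfolding bdet_expand[OF P q lev]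
    by (rule LINT_nested_sum) (auto intro: int)
  also have "\<dots> = (-1) ^ card P * (\<Sum>\<tau> | \<tau> permutes idx P. of_int (sign \<tau>) *
      (\<Sum>a\<in>idx P. (\<Prod>c\<in>idx P - {a}. bmat lev x c (\<tau> c)) * ?g \<tau> a))"
    by (intro arg_cong2[where f = "(*)"] refl sum.cong detour[OF lev(1)]) (auto simp: permutes_in_image)
  also have "\<dots> = (-1) ^ card P * (\<Sum>\<tau> | \<tau> permutes idx P. of_int (sign \<tau>) *
      ((of_nat ?n - of_nat (card {p\<in>P. lev p = ?n})) * (\<Prod>a\<in>idx P. bmat lev x a (\<tau> a))))"
  proof (intro arg_cong2[where f = "(*)"] refl sum.cong)
    fix \<tau> assume "\<tau> \<in> {\<tau>. \<tau> permutes idx P}"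
    then have \<tau>: "\<tau> permutes idx P" by simp
    let ?A = "{a\<in>idx P. row_start lev a \<le> ?n \<and> ?n < col_end lev (\<tau> a)}"
    let ?p = "\<Prod>a\<in>idx P. bmat lev x a (\<tau> a)"
    have "(\<Sum>a\<in>idx P. (\<Prod>c\<in>idx P - {a}. bmat lev x c (\<tau> c)) * ?g \<tau> a) =
        (\<Sum>a\<in>idx P. if row_start lev a \<le> ?n \<and> ?n < col_end lev (\<tau> a) then ?p else 0)"
    proof (rule sum.cong[OF refl])
      fix a assume "a \<in> idx P"
      then have "?p = bmat lev x a (\<tau> a) * (\<Prod>c\<in>idx P - {a}. bmat lev x c (\<tau> c))"
        using P by (intro prod.remove) auto
      then show "(\<Prod>c\<in>idx P - {a}. bmat lev x c (\<tau> c)) * ?g \<tau> a =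
          (if row_start lev a \<le> ?n \<and> ?n < col_end lev (\<tau> a) then ?p else 0)"
        by simp
    qed
    also have "\<dots> = (\<Sum>a\<in>?A. ?p)"
      using P by (intro sum.inter_filter[symmetric]) simp
    also have "\<dots> = of_nat (card ?A) * ?p"
      by (rule sum_constant)
    also have "\<dots> = (of_nat ?n - of_nat (card {p\<in>P. lev p = ?n})) * ?p"
    proof (cases "?p = 0")
      case False
      from detour_count[OF P lev(1,2) \<tau> this]
      have "of_nat (card ?A + card {p\<in>P. lev p = ?n}) = (of_nat ?n :: complex)"
        by (rule arg_cong)
      then have "of_nat (card ?A) = (of_nat ?n - of_nat (card {p\<in>P. lev p = ?n}) :: complex)"
        unfolding of_nat_add eq_diff_eq .
      then show ?thesis
        by (rule arg_cong)
    qed (simp only: mult_zero_right)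
    finally show "(\<Sum>a\<in>idx P. (\<Prod>c\<in>idx P - {a}. bmat lev x c (\<tau> c)) * ?g \<tau> a) =
        (of_nat ?n - of_nat (card {p\<in>P. lev p = ?n})) * ?p" .
  qed
  also have "\<dots> = (of_nat ?n - of_nat (card {p\<in>P. lev p = ?n})) * bdet P lev x"
    unfolding bdet_def pdet_def sum_distrib_left by (intro sum.cong refl) (simp only: mult_ac)
  finally show ?thesis .
qed

section \<open>Integrability of the bordered determinant\<close>

lemma bmat_measurable:
  fixes P :: "'p set"
  assumes a: "a \<in> idx P" and b: "b \<in> idx P"
  shows "(\<lambda>x. bmat lev x a b) \<in> borel_measurable (lborel_on P)"
proof (cases b)
  case bp: (Inr p)
  then have p: "(\<lambda>x. x p) \<in> borel_measurable (lborel_on P)"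
    using b measurable_component_singleton[of p P "\<lambda>_. lborel"] by simp
  show ?thesis
  proof (cases a)
    case (Inl i)
    have "(\<lambda>x. push k (source i) (x p)) \<in> borel_measurable (lborel_on P)" for k
      by (rule measurable_compose[OF p]) measurable
    then show ?thesis
      unfolding bp bmat_def row_def
      by (cases "row_start lev a \<le> lev p") (simp_all add: Inl row_fun_def)
  next
    case (Inr p')
    then have p': "(\<lambda>x. x p') \<in> borel_measurable (lborel_on P)"
      using a measurable_component_singleton[of p' P "\<lambda>_. lborel"] by simp
    have "(\<lambda>x. push k (\<phi> (x p')) (x p)) \<in> borel_measurable (lborel_on P)" for k
      using measurable_compose[OF measurable_Pair[OF p' p] push_measurable_param[OF kernel_measurable, of k]]
      by simp
    then show ?thesis
      unfolding bp bmat_def row_def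
      by (cases "row_start lev a \<le> lev p") (simp_all add: Inr row_fun_def)
  qed
next
  case bj: (Inl j)
  then have [measurable]: "\<psi> j \<in> borel_measurable borel"
    using b psi_measurable by simp
  show ?thesis
  proof (cases a)
    case (Inl i)
    then show ?thesis
      unfolding bj bmat_def row_def by (simp add: Inl row_fun_def row_start_def cong: if_cong)
  next
    case (Inr p)
    then have p: "(\<lambda>x. x p) \<in> borel_measurable (lborel_on P)"
      using a measurable_component_singleton[of p P "\<lambda>_. lborel"] by simp
    have "(\<lambda>x. pull k (\<psi> j) (x p)) \<in> borel_measurable (lborel_on P)" for k
      by (rule measurable_compose[OF p]) measurable
    then show ?thesis
      unfolding bj bmat_def col_def
      by (cases "lev p < col_end lev (Inl j :: nat + 'p)") (simp_all add: Inr col_fun_def)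
  qed
qed

lemma abs_bmat_measurable:
  fixes P :: "'p set"
  assumes a: "a \<in> idx P" and b: "b \<in> idx P"
  shows "(\<lambda>x. abs_bmat lev x a b) \<in> borel_measurable (lborel_on P)"
proof (cases b)
  case bp: (Inr p)
  then have p: "(\<lambda>x. x p) \<in> borel_measurable (lborel_on P)"
    using b measurable_component_singleton[of p P "\<lambda>_. lborel"] by simp
  show ?thesis
  proof (cases a)
    case (Inl i)
    have "(\<lambda>x. apush k (abs_source i) (x p)) \<in> borel_measurable (lborel_on P)" for k
      by (rule measurable_compose[OF p]) measurable
    then show ?thesis
      unfolding bp abs_bmat_def abs_row_def
      by (cases "row_start lev a \<le> lev p") (simp_all add: Inl abs_row_fun_def)
  next
    case (Inr p')
    then have p': "(\<lambda>x. x p') \<in> borel_measurable (lborel_on P)"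
      using a measurable_component_singleton[of p' P "\<lambda>_. lborel"] by simp
    have k: "(\<lambda>(x, y). ennreal (norm (\<phi> x y))) \<in> borel_measurable (borel \<Otimes>\<^sub>M borel)"
      by measurable
    have "(\<lambda>x. apush k (\<lambda>z. ennreal (norm (\<phi> (x p') z))) (x p)) \<in> borel_measurable (lborel_on P)" for k
      using measurable_compose[OF measurable_Pair[OF p' p] apush_measurable_param[OF k, of k]]
      by simp
    then show ?thesis
      unfolding bp abs_bmat_def abs_row_def
      by (cases "row_start lev a \<le> lev p") (simp_all add: Inr abs_row_fun_def)
  qed
next
  case bj: (Inl j)
  then have [measurable]: "\<psi> j \<in> borel_measurable borel"
    using b psi_measurable by simp
  show ?thesis
  proof (cases a)
    case (Inl i)
    then show ?thesis
      unfolding bj abs_bmat_def abs_row_def by (simp add: Inl abs_row_fun_def row_start_def cong: if_cong)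
  next
    case (Inr p)
    then have p: "(\<lambda>x. x p) \<in> borel_measurable (lborel_on P)"
      using a measurable_component_singleton[of p P "\<lambda>_. lborel"] by simp
    have "(\<lambda>x. apull k (\<lambda>z. ennreal (norm (\<psi> j z))) (x p)) \<in> borel_measurable (lborel_on P)" for k
      by (rule measurable_compose[OF p]) measurable
    then show ?thesis
      unfolding bj abs_bmat_def abs_col_def
      by (cases "lev p < col_end lev (Inl j :: nat + 'p)") (simp_all add: Inr col_fun_def)
  qed
qed

lemma bdet_measurable [measurable]: "bdet P lev \<in> borel_measurable (lborel_on P)"
  unfolding bdet_def[abs_def] pdet_def
  by (intro borel_measurable_times borel_measurable_const borel_measurable_sum borel_measurable_prod
      bmat_measurable) (auto simp: permutes_in_image)

lemma abs_perm_measurable [measurable]: "abs_perm P lev \<in> borel_measurable (lborel_on P)"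
  unfolding abs_perm_def[abs_def]
  by (intro borel_measurable_sum borel_measurable_prod_ennreal abs_bmat_measurable)
    (auto simp: permutes_in_image)

lemma abs_row_measurable: "abs_row lev x a n \<in> borel_measurable borel"
  unfolding abs_row_def
  by (cases "row_start lev a \<le> n") (simp_all add: apush_measurable abs_row_fun_measurable)

lemma abs_col_measurable: "b \<in> idx P \<Longrightarrow> abs_col lev x b n \<in> borel_measurable borel"
  using col_fun_measurable[of b P x] unfolding abs_col_def
  by (cases "n < col_end lev b") (simp_all add: apull_measurable)

text \<open>The same induction without signs: integrating out one point bounds the permanent by the smaller
  one times the number of indices, and without points it is a finite sum of products of absolute
  Gram entries.\<close>

lemma abs_perm_finite:
  assumes "finite P" and "lev ` P \<subseteq> {m+1..m+L}"
  shows "(\<integral>\<^sup>+x. abs_perm P lev x \<partial>(lborel_on P)) < \<infinity>"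
  using assms
proof (induction P)
  case empty
  have "(\<Prod>a\<in>idx {}. abs_bmat lev x a (\<sigma> a)) < \<infinity>" if \<sigma>: "\<sigma> permutes idx {}" for \<sigma> and x :: "'a \<Rightarrow> real"
  proof -
    have "abs_bmat lev x a (\<sigma> a) < \<infinity>" if "a \<in> idx {}" for a
      using abs_bmat_finite[OF empty that, of "\<sigma> a" x] that permutes_in_image[OF \<sigma>, of a] by simp
    then show ?thesis
      by (auto simp: less_top[symmetric] ennreal_prod_eq_top)
  qed
  then have "abs_perm {} lev x < \<infinity>" for x
    unfolding abs_perm_def infinity_ennreal_def
    by (subst ennreal_sum_less_top) (simp_all add: finite_permutations)
  then show ?case
    by (simp add: PiM_empty nn_integral_count_space_finite)
next
  case (insert q P)
  then have lev: "lev ` P \<subseteq> {m+1..m+L}" "lev q \<in> {m+1..m+L}"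
    by auto
  have slice: "(\<integral>\<^sup>+y. abs_perm (insert q P) lev (x(q := y)) \<partial>lborel) \<le> of_nat (card (idx P)) * abs_perm P lev x" for x
  proof -
    have m: "(\<lambda>y. abs_row lev x a (lev q) y * abs_col lev x (\<tau> a) (lev q) y) \<in> borel_measurable lborel"
      if "\<tau> permutes idx P" "a \<in> idx P" for \<tau> a
    proof -
      have "\<tau> a \<in> idx P"
        using that by (simp add: permutes_in_image)
      then show ?thesis
        using borel_measurable_times_ennreal[OF abs_row_measurable abs_col_measurable] by simp
    qed
    have "(\<integral>\<^sup>+y. abs_perm (insert q P) lev (x(q := y)) \<partial>lborel) =
      (\<Sum>\<tau> | \<tau> permutes idx P. \<Sum>a\<in>idx P. (\<Prod>c\<in>idx P - {a}. abs_bmat lev x c (\<tau> c)) *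
        (\<integral>\<^sup>+y. abs_row lev x a (lev q) y * abs_col lev x (\<tau> a) (lev q) y \<partial>lborel))"
      unfolding abs_perm_expand[OF insert(1,2) lev]
      by (rule nn_integral_nested_sum) (rule m, simp_all)
    also have "\<dots> \<le> (\<Sum>\<tau> | \<tau> permutes idx P. \<Sum>a\<in>idx P. (\<Prod>c\<in>idx P - {a}. abs_bmat lev x c (\<tau> c)) *
        abs_bmat lev x a (\<tau> a))"
      by (intro sum_mono mult_left_mono) (auto simp: abs_detour[where P = P] permutes_in_image)
    also have "\<dots> = of_nat (card (idx P)) * abs_perm P lev x"
      unfolding abs_perm_def sum_distrib_left
    proof (rule sum.cong[OF refl])
      fix \<tau> assume "\<tau> \<in> {\<tau>. \<tau> permutes idx P}"
      have "(\<Prod>c\<in>idx P - {a}. abs_bmat lev x c (\<tau> c)) * abs_bmat lev x a (\<tau> a) =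
          (\<Prod>c\<in>idx P. abs_bmat lev x c (\<tau> c))" if "a \<in> idx P" for a
        using insert(1) that prod.remove[of "idx P" a "\<lambda>c. abs_bmat lev x c (\<tau> c)"]
        by (simp add: mult.commute)
      then show "(\<Sum>a\<in>idx P. (\<Prod>c\<in>idx P - {a}. abs_bmat lev x c (\<tau> c)) * abs_bmat lev x a (\<tau> a)) =
          of_nat (card (idx P)) * (\<Prod>a\<in>idx P. abs_bmat lev x a (\<tau> a))"
        by simp
    qed
    finally show ?thesis .
  qed
  have "(\<integral>\<^sup>+x. abs_perm (insert q P) lev x \<partial>(lborel_on (insert q P))) =
     (\<integral>\<^sup>+x. \<integral>\<^sup>+y. abs_perm (insert q P) lev (x(q := y)) \<partial>lborel \<partial>(lborel_on P))"
    using insert(1,2) by (rule lebesgue.product_nn_integral_insert) measurable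
  also have "\<dots> \<le> (\<integral>\<^sup>+x. of_nat (card (idx P)) * abs_perm P lev x \<partial>(lborel_on P))"
    by (intro nn_integral_mono slice)
  also have "\<dots> = of_nat (card (idx P)) * (\<integral>\<^sup>+x. abs_perm P lev x \<partial>(lborel_on P))"
    by (rule nn_integral_cmult) measurable
  also have "\<dots> < \<infinity>"
    using insert.IH[OF lev(1)] by (simp add: ennreal_mult_less_top of_nat_less_top)
  finally show ?case .
qed

lemma norm_bdet_le: "ennreal (norm (bdet P lev x)) \<le> abs_perm P lev x"
proof -
  have "norm (bdet P lev x) \<le> (\<Sum>\<sigma> | \<sigma> permutes idx P. \<Prod>a\<in>idx P. norm (bmat lev x a (\<sigma> a)))"
    unfolding bdet_def pdet_def norm_mult
    by (rule order_trans[OF mult_left_mono[OF norm_sum]])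
      (auto simp: norm_mult norm_power prod_norm simp flip: of_int_abs)
  then have "ennreal (norm (bdet P lev x)) \<le> (\<Sum>\<sigma> | \<sigma> permutes idx P. \<Prod>a\<in>idx P. ennreal (norm (bmat lev x a (\<sigma> a))))"
    by (simp add: prod_ennreal sum_ennreal prod_nonneg ennreal_leI)
  also have "\<dots> \<le> abs_perm P lev x"
    unfolding abs_perm_def by (intro sum_mono prod_mono_ennreal norm_bmat_le)
  finally show ?thesis .
qed

lemma bdet_integrable:
  assumes "finite P" and "lev ` P \<subseteq> {m+1..m+L}"
  shows "integrable (lborel_on P) (bdet P lev)"
proof (rule integrableI_bounded)
  have "(\<integral>\<^sup>+x. ennreal (norm (bdet P lev x)) \<partial>(lborel_on P)) \<le>
      (\<integral>\<^sup>+x. abs_perm P lev x \<partial>(lborel_on P))"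
    by (intro nn_integral_mono norm_bdet_le)
  also have "\<dots> < \<infinity>"
    by (rule abs_perm_finite[OF assms])
  finally show "(\<integral>\<^sup>+x. ennreal (norm (bdet P lev x)) \<partial>(lborel_on P)) < \<infinity>" .
qed measurable

end

lemma finite_labels [simp]: "finite (labels m L)"
  by (simp add: labels_def)

context bordered
begin

section \<open>Relabelling points\<close>

lemma bmat_relabel: "bmat lev x (map_sum id g a) (map_sum id g b) = bmat (lev \<circ> g) (x \<circ> g) a b"
proof -
  have "row_start lev (map_sum id g a) = row_start (lev \<circ> g) a" "row_fun x (map_sum id g a) = row_fun (x \<circ> g) a"
    by (cases a; simp add: row_start_def row_fun_def)+
  then have "row lev x (map_sum id g a) = row (lev \<circ> g) (x \<circ> g) a"
    by (intro ext) (simp only: row_def)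
  moreover have "col_end lev (map_sum id g b) = col_end (lev \<circ> g) b" "col_fun x (map_sum id g b) = col_fun (x \<circ> g) b"
    by (cases b; simp add: col_end_def col_fun_def)+
  then have "col lev x (map_sum id g b) = col (lev \<circ> g) (x \<circ> g) b"
    by (intro ext) (simp only: col_def)
  ultimately show ?thesis
    unfolding bmat_def by (cases a; cases b) simp_all
qed

lemma bdet_relabel:
  assumes P: "finite P" and g: "inj_on g P"
  shows "bdet (g ` P) lev x = bdet P (lev \<circ> g) (x \<circ> g)"
proof -
  have "idx (g ` P) = map_sum id g ` idx P"
    unfolding idx_def image_Un image_image map_sum.simps id_apply ..
  moreover have "inj_on (map_sum id g) (idx P)"
  proof (rule inj_onI)
    fix a b assume "a \<in> idx P" "b \<in> idx P" "map_sum id g a = map_sum id g b"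
    then show "a = b"
      using inj_onD[OF g] by (cases a; cases b) simp_all
  qed
  ultimately show ?thesis
    using P g by (simp only: bdet_def pdet_reindex finite_idx bmat_relabel card_image)
qed

lemma bdet_cong:
  assumes "\<And>p. p \<in> P \<Longrightarrow> lev p = lev' p" "\<And>p. p \<in> P \<Longrightarrow> x p = x' p"
  shows "bdet P lev x = bdet P lev' x'"
proof -
  have "bmat lev x a b = bmat lev' x' a b" if a: "a \<in> idx P" and b: "b \<in> idx P" for a b
  proof -
    have "row_start lev a = row_start lev' a" "row_fun x a = row_fun x' a"
      using a assms by (cases a; simp add: row_start_def row_fun_def)+
    then have "row lev x a = row lev' x' a"
      by (intro ext) (simp only: row_def)
    moreover have "col_end lev b = col_end lev' b" "col_fun x b = col_fun x' b"
      using b assms by (cases b; simp add: col_end_def col_fun_def)+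
    then have "col lev x b = col lev' x' b"
      by (intro ext) (simp only: col_def)
    ultimately show ?thesis
      using a b assms unfolding bmat_def by (cases a; cases b) simp_all
  qed
  then have "pdet (idx P) (bmat lev x) = pdet (idx P) (bmat lev' x')"
    by (rule pdet_cong)
  then show ?thesis
    by (simp only: bdet_def)
qed

text \<open>The two points have equal columns.\<close>

lemma bdet_coincidence:
  assumes "finite P" "p \<in> P" "p' \<in> P" "p \<noteq> p'" "lev p = lev p'" "x p = x p'"
  shows "bdet P lev x = 0"
proof -
  have "pdet (idx P) (bmat lev x) = 0"
    using assms by (intro pdet_identical_columns[of _ "Inr p" "Inr p'"]) (auto simp: bmat_def)
  then show ?thesis
    by (simp add: bdet_def)
qed

section \<open>The weight as a bordered determinant\<close>

text \<open>This pairs every row with the column that it meets in the weight. The rows \<open>\<upsilon>\<^sub>1, ..., \<upsilon>\<^sub>m\<close> and the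
  virtual row \<open>m + 1\<close> meet the points of level \<open>m + 1\<close>; the points of level \<open>k\<close> and the virtual row
  \<open>k + 1\<close> meet the points of level \<open>k + 1\<close>; the points of level \<open>m + L\<close> meet the functions \<open>\<psi>\<^sub>j\<close>.\<close>

definition next_col :: "nat + (nat \<times> nat) \<Rightarrow> nat + (nat \<times> nat)" where
  "next_col a = (case a of
     Inl i \<Rightarrow> Inr (max i (Suc m), i)
   | Inr (k, s) \<Rightarrow> if k < m + L then Inr (Suc k, s) else Inl s)"

lemma labels_levels: "fst ` labels m L \<subseteq> {m+1..m+L}"
  by (auto simp: labels_def)

lemma col_end_next_col:
  "a \<in> idx (labels m L) \<Longrightarrow> col_end fst (next_col a) = row_start fst a"
  by (auto simp: idx_def labels_def next_col_def col_end_def row_start_def)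

lemma bij_next_col: "bij_betw next_col (idx (labels m L)) (idx (labels m L))"
proof -
  have "inj_on next_col (idx (labels m L))"
    by (auto simp: inj_on_def idx_def labels_def next_col_def max_def split: if_splits)
  moreover have "next_col ` idx (labels m L) \<subseteq> idx (labels m L)"
    using L_pos by (auto simp: idx_def labels_def next_col_def max_def)
  ultimately show ?thesis
    unfolding bij_betw_def by (intro conjI endo_inj_surj) simp_all
qed

text \<open>After the columns are permuted by \<open>next_col\<close>, the level at which row \<open>a\<close> starts and the level at
  which column \<open>a\<close> ends agree. An entry whose row starts after its column ends is \<open>0\<close>, so the matrix is
  block triangular with respect to this level. No convolution is left in a
  diagonal block: it consists of values of \<open>\<phi>\<close>, \<open>\<phi>(virt, _)\<close> and \<open>\<psi>\<^sub>j\<close>, except on level \<open>m + 1\<close>, where \<open>\<upsilon>\<^sub>i\<close> is summed against \<open>\<phi>\<close>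
  and the Cauchy--Binet formula for square matrices applies.\<close>

lemma weight_eq_bdet:
  assumes xm: "inj_on xm {1..m}" and S: "S = xm ` {1..m}"
  obtains c where "c \<noteq> 0" "\<And>X. weight m L xm \<phi> \<phi>v \<upsilon> \<psi> X = c * bdet (labels m L) fst X"
proof -
  let ?J = "idx (labels m L)"
  let ?q = "restrict_id next_col ?J"
  have q: "?q permutes ?J"
    by (rule permutes_restrict_id[OF bij_next_col])
  have J: "finite ?J"
    by simp
  have sum_S: "(\<Sum>s\<in>S. h s) = (\<Sum>l=1..m. h (xm l))" for h :: "real \<Rightarrow> complex"
    using sum.reindex[OF xm, of h] by (simp add: S)
  have split_ends: "(\<Prod>k=Suc m..<Suc (Suc (m + L)). h k) = h (Suc m) * (\<Prod>k=Suc (Suc m)..m+L. h k) * h (Suc (m + L))"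
    for h :: "nat \<Rightarrow> complex"
  proof -
    have "{Suc m..<Suc (Suc (m + L))} = insert (Suc m) (insert (Suc (m + L)) {Suc (Suc m)..m+L})"
      using L_pos by auto
    then show ?thesis
      using L_pos by (simp add: mult_ac)
  qed
  have main: "of_int (sign ?q) * pdet ?J (bmat fst X) = weight m L xm \<phi> \<phi>v \<upsilon> \<psi> X" for X
  proof -
    define B where "B k = {a\<in>?J. row_start fst a = k}" for k
    let ?N = "\<lambda>a b. bmat fst X a (next_col b)"
    have "of_int (sign ?q) * pdet ?J (bmat fst X) = pdet ?J (\<lambda>a b. bmat fst X a (?q b))"
      using pdet_permute_columns[OF J q, of "bmat fst X"] by simp
    also have "\<dots> = pdet ?J ?N"
      by (rule pdet_cong) simp
    also have "\<dots> = (\<Prod>k=Suc m..<Suc (Suc (m + L)). pdet (B k) ?N)"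
      unfolding B_def
    proof (rule pdet_block_triangular[OF J])
      fix a b assume ab: "a \<in> ?J" "b \<in> ?J" "row_start fst b < row_start fst a"
      have "next_col b \<in> ?J"
        using bij_next_col ab(2) by (auto simp: bij_betw_def)
      then show "?N a b = 0"
        using bmat_nonzero_imp_le[of fst X a "next_col b" "labels m L"] ab labels_levels
        by (auto simp: col_end_next_col)
    qed (use L_pos in \<open>auto simp: idx_def labels_def row_start_def\<close>)
    also have "\<dots> = pdet (B (Suc m)) ?N * (\<Prod>k=Suc (Suc m)..m+L. pdet (B k) ?N) * pdet (B (Suc (m + L))) ?N"
      by (rule split_ends)
    finally have blocks: "of_int (sign ?q) * pdet ?J (bmat fst X) =
        pdet (B (Suc m)) ?N * (\<Prod>k=Suc (Suc m)..m+L. pdet (B k) ?N) * pdet (B (Suc (m + L))) ?N" .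
    let ?D = "\<lambda>k. det1 k (\<lambda>i j. if i = k then \<phi>v (entry m xm X k j)
        else \<phi> (entry m xm X (k - 1) i) (entry m xm X k j))"
    have bottom: "pdet (B (Suc m)) ?N = det1 m (\<lambda>i j. \<upsilon> i (xm j)) * ?D (Suc m)"
    proof -
      have "B (Suc m) = Inl ` {1..Suc m}"
        using L_pos by (auto simp: B_def idx_def labels_def row_start_def max_def split: if_splits)
      then have "pdet (B (Suc m)) ?N = det1 (Suc m) (\<lambda>i j. ?N (Inl i) (Inl j))"
        by (simp only: det1_image[OF inj_on_subset[OF inj_Inl subset_UNIV]])
      also have "\<dots> = det1 (Suc m) (\<lambda>i j. \<Sum>l=1..Suc m.
          (if i \<le> m then (if l \<le> m then \<upsilon> i (xm l) else 0) else (if l \<le> m then 0 else 1)) *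
          (if l = Suc m then \<phi>v (X (Suc m, j)) else \<phi> (xm l) (X (Suc m, j))))"
      proof (rule det1_cong)
        fix i j assume ij: "i \<in> {1..Suc m}" "j \<in> {1..Suc m}"
        then have "?N (Inl i) (Inl j) = source i (X (Suc m, j))"
          by (simp add: next_col_def bmat_def row_def row_start_def row_fun_def max_def)
        also have "\<dots> = (\<Sum>l=1..Suc m.
          (if i \<le> m then (if l \<le> m then \<upsilon> i (xm l) else 0) else (if l \<le> m then 0 else 1)) *
          (if l = Suc m then \<phi>v (X (Suc m, j)) else \<phi> (xm l) (X (Suc m, j))))"
          by (simp add: source_def conv_fin_def sum_S)
        finally show "?N (Inl i) (Inl j) = \<dots>" .
      qed
      also have "\<dots> = det1 m (\<lambda>i j. \<upsilon> i (xm j)) *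
          det1 (Suc m) (\<lambda>l j. if l = Suc m then \<phi>v (X (Suc m, j)) else \<phi> (xm l) (X (Suc m, j)))"
        by (simp only: det1_mult det1_bordered_identity)
      also have "\<dots> = det1 m (\<lambda>i j. \<upsilon> i (xm j)) * ?D (Suc m)"
        by (intro arg_cong2[where f = "(*)"] refl det1_cong) (simp add: entry_def)
      finally show ?thesis .
    qed
    have middle: "pdet (B k) ?N = ?D k" if k: "k \<in> {Suc (Suc m)..m+L}" for k
    proof -
      let ?g = "\<lambda>s. if s = k then Inl k else Inr (k - 1, s)"
      have "B k = ?g ` {1..k}"
      proof (intro equalityI subsetI)
        fix a assume a: "a \<in> B k"
        show "a \<in> ?g ` {1..k}"
        proof (cases a)
          case (Inl i)
          then have "i = k"
            using a k by (auto simp: B_def row_start_def max_def split: if_splits)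
          then show ?thesis
            using Inl k by (auto intro!: image_eqI[of _ _ k])
        next
          case (Inr p)
          then obtain s where "p = (k - 1, s)" "s \<in> {1..k - 1}"
            using a k by (cases p) (auto simp: B_def row_start_def labels_def)
          then show ?thesis
            using Inr k by (auto intro!: image_eqI[of _ _ s])
        qed
      next
        fix a assume "a \<in> ?g ` {1..k}"
        then show "a \<in> B k"
          using k by (auto simp: B_def row_start_def labels_def split: if_splits)
      qed
      moreover have "inj_on ?g {1..k}"
        by (auto simp: inj_on_def split: if_splits)
      ultimately have "pdet (B k) ?N = det1 k (\<lambda>i j. ?N (?g i) (?g j))"
        by (simp only: det1_image)
      also have "\<dots> = ?D k"
      proof (rule det1_cong)
        fix i j assume ij: "i \<in> {1..k}" "j \<in> {1..k}"
        have "next_col (?g j) = Inr (k, j)"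
          using k by (auto simp: next_col_def)
        then show "?N (?g i) (?g j) = (if i = k then \<phi>v (entry m xm X k j)
            else \<phi> (entry m xm X (k - 1) i) (entry m xm X k j))"
          using k by (auto simp: bmat_def row_def row_start_def row_fun_def source_def entry_def)
      qed
      finally show ?thesis .
    qed
    have top: "pdet (B (Suc (m + L))) ?N = det1 (m + L) (\<lambda>i j. \<psi> i (entry m xm X (m + L) j))"
    proof -
      have "B (Suc (m + L)) = (\<lambda>s. Inr (m + L, s)) ` {1..m+L}"
        using L_pos by (auto simp: B_def idx_def labels_def row_start_def)
      moreover have "inj_on (\<lambda>s. Inr (m + L, s) :: nat + nat \<times> nat) {1..m+L}"
        by (auto simp: inj_on_def)
      ultimately have "pdet (B (Suc (m + L))) ?N = det1 (m + L) (\<lambda>i j. ?N (Inr (m + L, i)) (Inr (m + L, j)))"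
        by (simp only: det1_image)
      also have "\<dots> = det1 (m + L) (\<lambda>i j. \<psi> j (entry m xm X (m + L) i))"
        using L_pos by (intro det1_cong)
          (simp add: next_col_def bmat_def col_def col_end_def col_fun_def entry_def)
      finally show ?thesis
        using det1_transpose[of "m + L" "\<lambda>i j. \<psi> i (entry m xm X (m + L) j)"] by simp
    qed
    have "(\<Prod>k=m+1..m+L. h k) = h (Suc m) * (\<Prod>k=Suc (Suc m)..m+L. h k)" for h :: "nat \<Rightarrow> complex"
      using L_pos prod.atLeast_Suc_atMost[of "m + 1" "m + L" h] by simp
    from this[of ?D] have "(\<Prod>k=m+1..m+L. ?D k) = ?D (Suc m) * (\<Prod>k=Suc (Suc m)..m+L. ?D k)" .
    moreover have "(\<Prod>k=Suc (Suc m)..m+L. pdet (B k) ?N) = (\<Prod>k=Suc (Suc m)..m+L. ?D k)"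
      using middle by (rule prod.cong[OF refl])
    ultimately show ?thesis
      unfolding blocks bottom top weight_def by (simp only: mult.assoc)
  qed
  show thesis
  proof (rule that)
    let ?c = "of_int (sign ?q) * (-1) ^ card (labels m L) :: complex"
    show "?c \<noteq> 0"
      by simp
    fix X
    have "(-1) ^ card (labels m L) * (-1) ^ card (labels m L) = (1 :: complex)"
      by (simp flip: power_mult_distrib)
    then show "weight m L xm \<phi> \<phi>v \<upsilon> \<psi> X = ?c * bdet (labels m L) fst X"
      unfolding main[of X, symmetric] bdet_def by (simp add: mult_ac)
  qed
qed

section \<open>The correlation kernel\<close>

abbreviation "gram_mat \<equiv> gram m L S \<phi> \<phi>v \<upsilon> \<psi>"

text \<open>The definition of the Gram matrix sums over the fixed configuration after the convolutions,
  \<open>bmat\<close> before them.\<close>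

lemma gram_entry:
  assumes "i < m + L" "j < m + L"
  shows "gram_mat $$ (i, j) = bmat lev x (Inl (Suc i)) (Inl (Suc j))"
proof (cases "Suc i \<le> m")
  case True
  have "row lev x (Inl (Suc i)) (m + L) z = conv_fin S (\<upsilon> (Suc i)) (phi_conv \<phi> m (m + L)) z" for z
  proof -
    have "row lev x (Inl (Suc i)) (m + L) z = push (L - 1) (\<lambda>y. \<Sum>s\<in>S. \<upsilon> (Suc i) s * \<phi> s y) z"
      using True L_pos by (simp add: row_def row_start_def row_fun_def source_def conv_fin_def[abs_def])
    also have "\<dots> = (\<Sum>s\<in>S. \<upsilon> (Suc i) s * push (L - 1) (\<phi> s) z)"
      using L_pos finite_kernel by (intro push_sum S_finite) auto
    also have "\<dots> = conv_fin S (\<upsilon> (Suc i)) (phi_conv \<phi> m (m + L)) z"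
      using L_pos by (simp add: conv_fin_def phi_conv_def conv2_iterate push_eq_funpow)
    finally show ?thesis .
  qed
  then show ?thesis
    using assms True by (simp add: gram_def bmat_def conv_pair_def)
next
  case False
  then have "max (Suc i) (Suc m) = Suc i"
    by simp
  then have "row lev x (Inl (Suc i)) (m + L) z = phi_virt \<phi> \<phi>v (Suc i) (m + L) z" for z
    using assms False by (simp add: row_def row_start_def row_fun_def source_def phi_virt_def push_eq_funpow)
  then show ?thesis
    using assms False by (simp add: gram_def bmat_def conv_pair_def)
qed

lemma bdet_empty:
  fixes lev :: "'p \<Rightarrow> nat"
  shows "bdet {} lev x = Determinant.det gram_mat"
proof -
  have "inj_on (\<lambda>i. Inl (Suc i) :: nat + 'p) {0..<m + L}"
    by (auto simp: inj_on_def)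
  moreover
  have "idx ({} :: 'p set) = (\<lambda>i. Inl (Suc i)) ` {0..<m + L}"
    by (auto simp: idx_def image_iff Bex_def) (metis Suc_pred' Suc_le_eq less_eq_Suc_le)
  ultimately have "bdet {} lev x =
      Determinant.det (Matrix.mat (m + L) (m + L) (\<lambda>(i, j). bmat lev x (Inl (Suc i)) (Inl (Suc j))))"
    unfolding bdet_def using det_mat_eq_pdet_image[of "\<lambda>i. Inl (Suc i)" "m + L" "bmat lev x"]
    by simp
  also have "Matrix.mat (m + L) (m + L) (\<lambda>(i, j). bmat lev x (Inl (Suc i)) (Inl (Suc j))) = gram_mat"
  proof (rule eq_matI)
    have dim: "dim_row gram_mat = m + L" "dim_col gram_mat = m + L"
      by (simp_all add: gram_def)
    then show "dim_row (Matrix.mat (m + L) (m + L) (\<lambda>(i, j). bmat lev x (Inl (Suc i)) (Inl (Suc j)))) = dim_row gram_mat"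
      "dim_col (Matrix.mat (m + L) (m + L) (\<lambda>(i, j). bmat lev x (Inl (Suc i)) (Inl (Suc j)))) = dim_col gram_mat"
      by simp_all
    fix i j assume "i < dim_row gram_mat" "j < dim_col gram_mat"
    then show "Matrix.mat (m + L) (m + L) (\<lambda>(i, j). bmat lev x (Inl (Suc i)) (Inl (Suc j))) $$ (i, j) = gram_mat $$ (i, j)"
      using dim by (simp add: gram_entry[of _ _ lev x])
  qed
  finally show ?thesis .
qed

text \<open>The Schur complement of the Gram block is \<open>\<phi>\<^bsup>(n,n')\<^esup> - \<Psi> G\<^sup>-\<^sup>1 \<Upsilon> = - K\<close>, where \<open>\<Upsilon>\<close> and \<open>\<Psi>\<close> are the blocks next to it.
  In the kernel the virtual rows run up to \<open>n\<^sub>2\<close> only, but the others vanish at a point of level \<open>n\<^sub>2\<close>.\<close>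

lemma bdet_eq_det_kernel:
  assumes det: "Determinant.det gram_mat \<noteq> 0" and p: "\<And>a. a < n \<Longrightarrow> fst (p a) \<in> {m+1..m+L}"
  shows "bdet {..<n} (fst \<circ> p) (snd \<circ> p) = Determinant.det gram_mat *
    Determinant.det (Matrix.mat n n (\<lambda>(a, b). correlation_kernel m L S \<phi> \<phi>v \<upsilon> \<psi> (p a) (p b)))"
proof -
  let ?K = "correlation_kernel m L S \<phi> \<phi>v \<upsilon> \<psi>"
  define N where "N = m + L"
  define lev where "lev = fst \<circ> p"
  define x where "x = snd \<circ> p"
  have G: "gram_mat \<in> carrier_mat N N"
    by (simp add: gram_def N_def)
  obtain G' where G': "mat_inverse gram_mat = Some G'" "gram_mat * G' = 1\<^sub>m N" "G' * gram_mat = 1\<^sub>m N"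
    "G' \<in> carrier_mat N N"
    using det_non_zero_imp_unit[OF G det, of undefined] mat_inverse(1)[OF G, of undefined] mat_inverse(2)[OF G]
    by (cases "mat_inverse gram_mat") auto
  let ?e = "\<lambda>k. if k < N then Inl (Suc k) else Inr (k - N)"
  let ?B = "Matrix.mat N n (\<lambda>(i, b). bmat lev x (Inl (Suc i)) (Inr b))"
  let ?C = "Matrix.mat n N (\<lambda>(a, j). bmat lev x (Inr a) (Inl (Suc j)))"
  let ?D = "Matrix.mat n n (\<lambda>(a, b). bmat lev x (Inr a) (Inr b))"
  let ?KM = "Matrix.mat n n (\<lambda>(a, b). ?K (p a) (p b))"
  have "idx {..<n} = ?e ` {0..<N + n}"
  proof (intro equalityI subsetI)
    fix c assume "c \<in> idx {..<n}"
    then consider i where "c = Inl i" "i \<in> {1..N}" | a where "c = Inr a" "a < n"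
      by (auto simp: idx_def N_def)
    then show "c \<in> ?e ` {0..<N + n}"
    proof cases
      case 1
      then show ?thesis
        by (intro image_eqI[of _ _ "i - 1"]) auto
    next
      case 2
      then show ?thesis
        by (intro image_eqI[of _ _ "N + a"]) auto
    qed
  next
    fix c assume "c \<in> ?e ` {0..<N + n}"
    then show "c \<in> idx {..<n}"
      by (auto simp: idx_def N_def)
  qed
  moreover have "inj_on ?e {0..<N + n}"
    by (auto simp: inj_on_def split: if_splits)
  ultimately have "pdet (idx {..<n}) (bmat lev x) =
      Determinant.det (Matrix.mat (N + n) (N + n) (\<lambda>(i, j). bmat lev x (?e i) (?e j)))"
    using det_mat_eq_pdet_image[of ?e "N + n" "bmat lev x"] by (simp only:)
  also have "Matrix.mat (N + n) (N + n) (\<lambda>(i, j). bmat lev x (?e i) (?e j)) = four_block_mat gram_mat ?B ?C ?D"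
    using G by (intro eq_matI) (auto simp: gram_entry[of _ _ lev x] N_def[symmetric])
  also have "Determinant.det \<dots> = Determinant.det gram_mat * Determinant.det (?D - ?C * (G' * ?B))"
    by (rule det_schur_complement[OF G G'(4,3,2)]) auto
  also have "?D - ?C * (G' * ?B) = (-1) \<cdot>\<^sub>m ?KM"
  proof (rule eq_matI)
    fix a b assume "a < dim_row ((-1) \<cdot>\<^sub>m ?KM)" "b < dim_col ((-1) \<cdot>\<^sub>m ?KM)"
    then have ab: "a < n" "b < n"
      by auto
    obtain na xa nb xb where pa: "p a = (na, xa)" and pb: "p b = (nb, xb)"
      by fastforce
    have na: "na \<in> {m+1..m+L}" and nb: "nb \<in> {m+1..m+L}"
      using p[OF ab(1)] p[OF ab(2)] pa pb by auto
    let ?U = "\<lambda>i. bmat lev x (Inl i) (Inr b)" and ?P = "\<lambda>j. bmat lev x (Inr a) (Inl j)"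
    have inv: "inverse_transpose gram_mat (Suc i) (Suc j) = G' $$ (j, i)" if "i < N" "j < N" for i j
      using that G' by (simp add: inverse_transpose_def)
    have U1: "upsilon_conv m S \<phi> \<upsilon> i nb xb = ?U i" if "i \<in> {1..m}" for i
    proof -
      have "max i (Suc m) = Suc m" "nb \<noteq> m"
        using that nb by simp_all
      then show ?thesis
        using that nb pb by (simp add: upsilon_conv_def bmat_def row_def row_start_def row_fun_def source_def
            push_eq_funpow lev_def x_def)
    qed
    have U2: "phi_virt \<phi> \<phi>v i nb xb = ?U i" if "i \<in> {m+1..m+L}" for i
    proof -
      have "max i (Suc m) = i"
        using that by simp
      then show ?thesis
        using that nb pb by (simp add: phi_virt_def bmat_def row_def row_start_def row_fun_def source_def
            push_eq_funpow lev_def x_def)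
    qed
    have P: "psi_conv m L \<phi> \<psi> j na xa = ?P j" for j
      using na pa by (simp add: psi_conv_def bmat_def col_def col_end_def col_fun_def pull_eq_funpow lev_def x_def)
    have F: "phi_conv \<phi> na nb xa xb = bmat lev x (Inr a) (Inr b)"
      using pa pb by (simp add: phi_conv_def bmat_def row_def row_start_def row_fun_def push_eq_funpow
          conv2_iterate lev_def x_def)
    let ?t = "\<lambda>i. \<Sum>j=1..m+L. inverse_transpose gram_mat i j * ?U i * ?P j"
    have "(\<Sum>i=m+1..nb. \<Sum>j=1..m+L. inverse_transpose gram_mat i j *
          phi_virt \<phi> \<phi>v i nb xb * psi_conv m L \<phi> \<psi> j na xa) = (\<Sum>i=m+1..m+L. ?t i)"
    proof (rule sum.mono_neutral_cong_left)
      show "\<forall>i\<in>{m+1..m+L} - {m+1..nb}. ?t i = 0"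
        using nb pb by (auto simp: U2[symmetric] phi_virt_def)
    qed (use nb in \<open>auto simp: U2 P\<close>)
    moreover have "(\<Sum>i=1..m. \<Sum>j=1..m+L. inverse_transpose gram_mat i j *
          upsilon_conv m S \<phi> \<upsilon> i nb xb * psi_conv m L \<phi> \<psi> j na xa) = (\<Sum>i=1..m. ?t i)"
      by (simp add: U1 P)
    moreover have "(\<Sum>i=1..m. ?t i) + (\<Sum>i=m+1..m+L. ?t i) = (\<Sum>i=1..m+L. ?t i)"
      by (subst sum.ub_add_nat[of 1 m]) simp_all
    ultimately have K: "?K (p a) (p b) = - bmat lev x (Inr a) (Inr b) + (\<Sum>i=1..N. ?t i)"
      unfolding pa pb by (simp add: correlation_kernel_def F N_def)
    have shift: "(\<Sum>i=1..N. h i) = (\<Sum>i=0..<N. h (Suc i))" for h :: "nat \<Rightarrow> complex"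
      using sum.shift_bounds_Suc_ivl[of h 0 N] by (simp add: atLeastLessThanSuc_atLeastAtMost)
    have "(?C * (G' * ?B)) $$ (a, b) = (\<Sum>j=0..<N. ?P (Suc j) * (\<Sum>i=0..<N. G' $$ (j, i) * ?U (Suc i)))"
      using ab G'(4) by (simp add: scalar_prod_def)
    also have "\<dots> = (\<Sum>j=0..<N. \<Sum>i=0..<N. G' $$ (j, i) * ?U (Suc i) * ?P (Suc j))"
      by (simp add: sum_distrib_left mult_ac)
    also have "\<dots> = (\<Sum>i=0..<N. \<Sum>j=0..<N. G' $$ (j, i) * ?U (Suc i) * ?P (Suc j))"
      by (rule sum.swap)
    also have "\<dots> = (\<Sum>i=1..N. ?t i)"
      unfolding N_def[symmetric] shift by (intro sum.cong refl) (simp add: inv)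
    finally show "(?D - ?C * (G' * ?B)) $$ (a, b) = ((-1) \<cdot>\<^sub>m ?KM) $$ (a, b)"
      using ab G'(4) K by simp
  qed (use G'(4) in auto)
  finally have "pdet (idx {..<n}) (bmat lev x) =
      Determinant.det gram_mat * ((-1) ^ n * Determinant.det ?KM)"
    by simp
  moreover have "(-1) ^ n * (-1) ^ n = (1 :: complex)"
    by (simp flip: power_mult_distrib)
  ultimately show ?thesis
    unfolding bdet_def lev_def[symmetric] x_def[symmetric] by simp
qed

end

section \<open>Absolute convergence\<close>

text \<open>The integrals required to exist are the successive steps towards at most \<open>L - 1\<close> convolutions with
  \<open>\<phi>\<close>, so the bounds follow from \<open>conv_left_abs_finite\<close> and \<open>conv_right_abs_finite\<close>, and those for the
  Gram matrix from one further integration.\<close>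

lemma bordered_of_converge:
  assumes L: "0 < L" and S: "finite S"
    and \<phi>: "(\<lambda>(x, y). \<phi> x y) \<in> borel_measurable (borel \<Otimes>\<^sub>M borel)"
    and \<phi>v [measurable]: "\<phi>v \<in> borel_measurable borel"
    and \<psi>: "\<And>j. j \<in> {1..m+L} \<Longrightarrow> \<psi> j \<in> borel_measurable borel"
    and conv: "convolutions_converge m L S \<phi> \<phi>v \<upsilon> \<psi>"
  shows "bordered \<phi> m L S \<phi>v \<upsilon> \<psi>"
proof -
  interpret kernel \<phi>
    by (rule kernel.intro[OF \<phi>])
  let ?v = "\<lambda>x. complex_of_real (norm (\<phi>v x))"
    and ?u = "\<lambda>i x. complex_of_real (norm (\<upsilon> i x))"
    and ?p = "\<lambda>j x. complex_of_real (norm (\<psi> j x))"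
  from conv have
    H1: "\<And>n r x y. m \<le> n \<Longrightarrow> n < r \<Longrightarrow> r < m + L \<Longrightarrow> integrable lborel (\<lambda>z. phi_conv absk n r x z * absk z y)"
    and H2: "\<And>n r y. m < n \<Longrightarrow> n \<le> r \<Longrightarrow> r < m + L \<Longrightarrow> integrable lborel (\<lambda>z. phi_virt absk ?v n r z * absk z y)"
    and H3: "\<And>i r y. 1 \<le> i \<Longrightarrow> i \<le> m \<Longrightarrow> m < r \<Longrightarrow> r < m + L \<Longrightarrow>
      integrable lborel (\<lambda>z. upsilon_conv m S absk ?u i r z * absk z y)"
    and H4: "\<And>j r x. 1 \<le> j \<Longrightarrow> j \<le> m + L \<Longrightarrow> m < r \<Longrightarrow> r \<le> m + L \<Longrightarrow>
      integrable lborel (\<lambda>z. absk x z * psi_conv m L absk ?p j r z)"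
    and H5: "\<And>i j. 1 \<le> i \<Longrightarrow> i \<le> m \<Longrightarrow> 1 \<le> j \<Longrightarrow> j \<le> m + L \<Longrightarrow>
      integrable lborel (\<lambda>z. conv_fin S (?u i) (phi_conv absk m (m + L)) z * ?p j z)"
    and H6: "\<And>i j. m < i \<Longrightarrow> i \<le> m + L \<Longrightarrow> 1 \<le> j \<Longrightarrow> j \<le> m + L \<Longrightarrow>
      integrable lborel (\<lambda>z. phi_virt absk ?v i (m + L) z * ?p j z)"
    unfolding convolutions_converge_def Let_def by blast+
  have ker: "((\<lambda>h. conv_left h absk) ^^ k) (absk x) y =
      complex_of_real (enn2real (apush k (\<lambda>z. ennreal (norm (\<phi> x z))) y)) \<and>
      apush k (\<lambda>z. ennreal (norm (\<phi> x z))) y < \<infinity>" if k: "k < L" for k x y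
  proof (rule conv_left_abs_finite)
    fix i y assume i: "i < k"
    show "integrable lborel (\<lambda>z. ((\<lambda>h. conv_left h absk) ^^ i) (absk x) z * absk z y)"
      using H1[of m "m + i + 1" x y] i k by (simp add: phi_conv_def conv2_iterate)
  qed auto
  have vir: "((\<lambda>h. conv_left h absk) ^^ k) ?v y =
      complex_of_real (enn2real (apush k (\<lambda>z. ennreal (norm (\<phi>v z))) y)) \<and>
      apush k (\<lambda>z. ennreal (norm (\<phi>v z))) y < \<infinity>" if k: "k < L" for k y
  proof (rule conv_left_abs_finite)
    fix i y assume i: "i < k"
    show "integrable lborel (\<lambda>z. ((\<lambda>h. conv_left h absk) ^^ i) ?v z * absk z y)"
      using H2[of "m + 1" "m + 1 + i" y] i k by (simp add: phi_virt_def)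
  qed auto
  have ups: "apush k (\<lambda>z. \<Sum>s\<in>S. ennreal (norm (\<upsilon> i s)) * ennreal (norm (\<phi> s z))) y < \<infinity>"
    if i: "i \<in> {1..m}" and k: "k < L" for i k y
  proof -
    let ?w = "\<lambda>z. \<Sum>s\<in>S. norm (\<upsilon> i s) * norm (\<phi> s z)"
    have w: "conv_fin S (?u i) absk = (\<lambda>z. complex_of_real (?w z))"
      by (simp add: conv_fin_def fun_eq_iff)
    have "apush k (\<lambda>z. ennreal (?w z)) y < \<infinity>"
    proof (rule conjunct2[OF conv_left_abs_finite])
      fix l y assume l: "l < k"
      show "integrable lborel (\<lambda>z. ((\<lambda>h. conv_left h absk) ^^ l) (\<lambda>z. complex_of_real (?w z)) z * absk z y)"
        using H3[of i "m + 1 + l" y] i l k by (simp add: upsilon_conv_def w)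
    qed (auto intro!: sum_nonneg)
    moreover have "ennreal (?w z) = (\<Sum>s\<in>S. ennreal (norm (\<upsilon> i s)) * ennreal (norm (\<phi> s z)))" for z
      by (subst sum_ennreal[symmetric]) (auto simp: ennreal_mult)
    ultimately show ?thesis
      by simp
  qed
  have psi: "apull k (\<lambda>z. ennreal (norm (\<psi> j z))) y < \<infinity>" if j: "j \<in> {1..m+L}" and k: "k < L" for j k y
  proof -
    note [measurable] = \<psi>[OF j]
    show ?thesis
    proof (rule conjunct2[OF conv_right_abs_finite])
      fix l x assume l: "l < k"
      then have "m + L - (m + L - l) = l"
        using k by simp
      then show "integrable lborel (\<lambda>z. absk x z * (conv_right absk ^^ l) (?p j) z)"
        using H4[of j "m + L - l" x] j l k by (simp add: psi_conv_def)
    qed auto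
  qed
  have gram_finite: "(\<integral>\<^sup>+y. ennreal (f y) * ennreal (norm (\<psi> j y)) \<partial>lborel) < \<infinity>"
    if "integrable lborel (\<lambda>y. complex_of_real (f y) * ?p j y)" "\<And>y. 0 \<le> f y" for f j
  proof -
    have "integrable lborel (\<lambda>y. complex_of_real (f y * norm (\<psi> j y)))"
      using that(1) by simp
    then have i: "integrable lborel (\<lambda>y. f y * norm (\<psi> j y))"
      by (rule iffD1[OF complex_of_real_integrable_eq])
    have "(\<integral>\<^sup>+y. ennreal (f y) * ennreal (norm (\<psi> j y)) \<partial>lborel) = (\<integral>\<^sup>+y. ennreal (f y * norm (\<psi> j y)) \<partial>lborel)"
      using that(2) by (simp add: ennreal_mult)
    also have "\<dots> = ennreal (LINT y|lborel. f y * norm (\<psi> j y))"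
      using i by (rule nn_integral_eq_integral) (simp add: that(2))
    finally show ?thesis
      by simp
  qed
  show ?thesis
  proof (intro bordered.intro bordered_axioms.intro kernel_axioms)
    show "0 < L" "finite S" "\<phi>v \<in> borel_measurable borel"
      by (rule L S \<phi>v)+
    show "\<psi> j \<in> borel_measurable borel" if "j \<in> {1..m+L}" for j
      using that by (rule \<psi>)
    show "apush k (\<lambda>z. ennreal (norm (\<phi> x z))) y < \<infinity>" if "k < L" for k x y
      using ker[OF that] ..
    show "apush k (\<lambda>z. ennreal (norm (\<phi>v z))) y < \<infinity>" if "k < L" for k y
      using vir[OF that] ..
    show "apush k (\<lambda>z. \<Sum>s\<in>S. ennreal (norm (\<upsilon> i s)) * ennreal (norm (\<phi> s z))) y < \<infinity>"
      if "i \<in> {1..m}" "k < L" for i k y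
      using that by (rule ups)
    show "apull k (\<lambda>z. ennreal (norm (\<psi> j z))) y < \<infinity>" if "j \<in> {1..m+L}" "k < L" for j k y
      using that by (rule psi)
  next
    fix i j assume i: "i \<in> {1..m}" and j: "j \<in> {1..m+L}"
    define f where "f y = (\<Sum>s\<in>S. norm (\<upsilon> i s) * enn2real (apush (L - 1) (\<lambda>z. ennreal (norm (\<phi> s z))) y))" for y
    have "conv_fin S (?u i) (phi_conv absk m (m + L)) z = complex_of_real (f z)" for z
      using L ker[of "L - 1"] by (simp add: conv_fin_def phi_conv_def conv2_iterate f_def)
    then have "integrable lborel (\<lambda>y. complex_of_real (f y) * ?p j y)"
      using H5[of i j] i j by simp
    moreover have "0 \<le> f y" for y
      unfolding f_def by (auto intro!: sum_nonneg)
    moreover have "apush (L - 1) (\<lambda>z. \<Sum>s\<in>S. ennreal (norm (\<upsilon> i s)) * ennreal (norm (\<phi> s z))) y = ennreal (f y)" for y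
    proof -
      have "ennreal (f y) = (\<Sum>s\<in>S. ennreal (norm (\<upsilon> i s)) *
          ennreal (enn2real (apush (L - 1) (\<lambda>z. ennreal (norm (\<phi> s z))) y)))"
        unfolding f_def by (subst sum_ennreal[symmetric]) (auto simp: ennreal_mult)
      also have "\<dots> = (\<Sum>s\<in>S. ennreal (norm (\<upsilon> i s)) * apush (L - 1) (\<lambda>z. ennreal (norm (\<phi> s z))) y)"
        using L ker[of "L - 1"] by simp
      also have "\<dots> = apush (L - 1) (\<lambda>z. \<Sum>s\<in>S. ennreal (norm (\<upsilon> i s)) * ennreal (norm (\<phi> s z))) y"
        by (rule apush_sum[symmetric, OF S]) measurable
      finally show ?thesis ..
    qed
    ultimately show "(\<integral>\<^sup>+y. apush (L - 1) (\<lambda>z. \<Sum>s\<in>S. ennreal (norm (\<upsilon> i s)) * ennreal (norm (\<phi> s z))) y *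
        ennreal (norm (\<psi> j y)) \<partial>lborel) < \<infinity>"
      using gram_finite[of f j] by simp
  next
    fix i j assume i: "i \<in> {m+1..m+L}" and j: "j \<in> {1..m+L}"
    have k: "m + L - i < L"
      using i by auto
    define f where "f y = enn2real (apush (m + L - i) (\<lambda>z. ennreal (norm (\<phi>v z))) y)" for y
    have "phi_virt absk ?v i (m + L) z = complex_of_real (f z)" for z
      using i vir[OF k] by (simp add: phi_virt_def f_def)
    then have "integrable lborel (\<lambda>y. complex_of_real (f y) * ?p j y)"
      using H6[of i j] i j by simp
    moreover have "apush (m + L - i) (\<lambda>z. ennreal (norm (\<phi>v z))) y = ennreal (f y)" for y
      using vir[OF k, of y] by (simp add: f_def)
    moreover have "0 \<le> f y" for y
      by (simp add: f_def)
    ultimately show "(\<integral>\<^sup>+y. apush (m + L - i) (\<lambda>z. ennreal (norm (\<phi>v z))) y * ennreal (norm (\<psi> j y)) \<partial>lborel) < \<infinity>"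
      using gram_finite[of f j] by simp
  qed
qed

section \<open>Products of Lebesgue measure\<close>

text \<open>The points of a tuple are indexed by their labels in the configuration and by \<open>0, ..., n-1\<close> in the
  correlation function.\<close>

lemma distr_PiM_lborel_reindex:
  assumes I: "finite I" and f: "inj_on f I"
  shows "distr (lborel_on (f ` I)) (lborel_on I) (\<lambda>x. \<lambda>i\<in>I. x (f i)) = (lborel_on I)"
proof (rule lebesgue.PiM_eqI[OF I])
  fix A :: "'a \<Rightarrow> real set" assume A: "\<And>i. i \<in> I \<Longrightarrow> A i \<in> sets lborel"
  let ?g = "\<lambda>x. \<lambda>i\<in>I. x (f i)"
  have g: "?g \<in> measurable (lborel_on (f ` I)) (lborel_on I)"
    by (intro measurable_restrict measurable_component_singleton) simp
  have "?g -` Pi\<^sub>E I A \<inter> space (lborel_on (f ` I)) = (\<Pi>\<^sub>E k\<in>f ` I. A (inv_into I f k))"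
    using f by (auto simp: space_PiM PiE_def Pi_def extensional_def inv_into_f_f)
  moreover have "emeasure (lborel_on (f ` I)) (\<Pi>\<^sub>E k\<in>f ` I. A (inv_into I f k)) =
      (\<Prod>k\<in>f ` I. emeasure lborel (A (inv_into I f k)))"
    using I A f by (intro lebesgue.emeasure_PiM) (auto simp: inv_into_f_f)
  moreover have "\<dots> = (\<Prod>i\<in>I. emeasure lborel (A i))"
    using f by (simp add: prod.reindex inv_into_f_f)
  moreover have "Pi\<^sub>E I A \<in> sets (lborel_on I)"
    using I A by (intro sets_PiM_I_finite) auto
  ultimately show "emeasure (distr (lborel_on (f ` I)) (lborel_on I) ?g) (Pi\<^sub>E I A) =
      (\<Prod>i\<in>I. emeasure lborel (A i))"
    using g by (simp add: emeasure_distr)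
qed simp

lemma integral_PiM_lborel_reindex:
  fixes h :: "('i \<Rightarrow> real) \<Rightarrow> complex"
  assumes I: "finite I" and f: "inj_on f I" and h: "h \<in> borel_measurable (lborel_on I)"
  shows "(LINT x|(lborel_on (f ` I)). h (\<lambda>i\<in>I. x (f i))) = (LINT x|(lborel_on I). h x)"
proof -
  have g: "(\<lambda>x. \<lambda>i\<in>I. x (f i)) \<in> measurable (lborel_on (f ` I)) (lborel_on I)"
    by (intro measurable_restrict measurable_component_singleton) simp
  show ?thesis
    using integral_distr[OF g h] by (simp add: distr_PiM_lborel_reindex[OF I f])
qed

text \<open>The reference measure lives on pairs of a level and a position. A power of it is a sum over
  the assignments \<open>l\<close> of levels of powers of Lebesgue measure, since it gives a box the measure
  \<open>\<Prod>\<^sub>a \<Sum>\<^sub>k lborel (E a)\<^sub>k = \<Sum>\<^sub>l \<Prod>\<^sub>a lborel (E a)\<^sub>l\<^sub>(\<^sub>a\<^sub>)\<close>, where \<open>(E a)\<^sub>k\<close> is the part of \<open>E a\<close> on level \<open>k\<close>.\<close>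

lemma distr_leveled_PiM:
  fixes V :: "nat set"
  assumes A: "finite A" and V: "finite V"
  shows "distr (count_space (A \<rightarrow>\<^sub>E V) \<Otimes>\<^sub>M (lborel_on A)) (\<Pi>\<^sub>M a\<in>A. count_space V \<Otimes>\<^sub>M lborel)
      (\<lambda>p. \<lambda>a\<in>A. (fst p a, snd p a)) = (\<Pi>\<^sub>M a\<in>A. count_space V \<Otimes>\<^sub>M (lborel :: real measure))"
    and "(\<lambda>p. \<lambda>a\<in>A. (fst p a, snd p a)) \<in> measurable (count_space (A \<rightarrow>\<^sub>E V) \<Otimes>\<^sub>M (lborel_on A))
      (\<Pi>\<^sub>M a\<in>A. count_space V \<Otimes>\<^sub>M (lborel :: real measure))"
proof -
  let ?C = "count_space (A \<rightarrow>\<^sub>E V) \<Otimes>\<^sub>M (lborel_on A)"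
    and ?R = "count_space V \<Otimes>\<^sub>M (lborel :: real measure)" and ?T = "\<lambda>p. \<lambda>a\<in>A. (fst p a, snd p a)"
  interpret V: sigma_finite_measure "count_space V"
    by (rule sigma_finite_measure_count_space_finite[OF V])
  interpret VL: pair_sigma_finite "count_space V" "lborel :: real measure"
    by standard
  interpret R: product_sigma_finite "\<lambda>_. ?R"
    by standard
  interpret PL: finite_product_sigma_finite "\<lambda>_. lborel :: real measure" A
    by standard (rule A)
  show T: "?T \<in> measurable ?C (\<Pi>\<^sub>M a\<in>A. ?R)"
  proof (intro measurable_restrict measurable_Pair)
    fix a assume a: "a \<in> A"
    show "(\<lambda>p. fst p a) \<in> measurable ?C (count_space V)"
    proof (rule measurable_compose[OF measurable_fst])
      show "(\<lambda>l. l a) \<in> measurable (count_space (A \<rightarrow>\<^sub>E V)) (count_space V)"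
        using a by auto
    qed
    show "(\<lambda>p. snd p a) \<in> measurable ?C lborel"
      using a by (intro measurable_compose[OF measurable_snd] measurable_component_singleton)
  qed
  show "distr ?C (\<Pi>\<^sub>M a\<in>A. ?R) ?T = (\<Pi>\<^sub>M a\<in>A. ?R)"
  proof (rule R.PiM_eqI[OF A])
    fix E :: "'a \<Rightarrow> (nat \<times> real) set" assume E: "\<And>a. a \<in> A \<Longrightarrow> E a \<in> sets ?R"
    have box: "Pi\<^sub>E A E \<in> sets (\<Pi>\<^sub>M a\<in>A. ?R)"
      using A E by (intro sets_PiM_I_finite) auto
    have slice: "Pair k -` E a \<in> sets lborel" if "a \<in> A" for k a
      using sets_Pair1[OF E[OF that], of k] by simp
    have "emeasure (distr ?C (\<Pi>\<^sub>M a\<in>A. ?R) ?T) (Pi\<^sub>E A E) = emeasure ?C (?T -` Pi\<^sub>E A E \<inter> space ?C)"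
      by (rule emeasure_distr[OF T box])
    also have "\<dots> = (\<integral>\<^sup>+l. emeasure (lborel_on A) (Pair l -` (?T -` Pi\<^sub>E A E \<inter> space ?C)) \<partial>count_space (A \<rightarrow>\<^sub>E V))"
      by (rule PL.emeasure_pair_measure_alt) (rule measurable_sets[OF T box])
    also have "\<dots> = (\<Sum>l\<in>A \<rightarrow>\<^sub>E V. emeasure (lborel_on A) (Pair l -` (?T -` Pi\<^sub>E A E \<inter> space ?C)))"
      using A V by (intro nn_integral_count_space_finite finite_PiE) auto
    also have "\<dots> = (\<Sum>l\<in>A \<rightarrow>\<^sub>E V. \<Prod>a\<in>A. emeasure lborel (Pair (l a) -` E a))"
    proof (rule sum.cong[OF refl])
      fix l assume l: "l \<in> A \<rightarrow>\<^sub>E V"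
      have "Pair l -` (?T -` Pi\<^sub>E A E \<inter> space ?C) = (\<Pi>\<^sub>E a\<in>A. Pair (l a) -` E a)"
        using l by (auto simp: space_pair_measure space_PiM PiE_def Pi_def extensional_def)
      then show "emeasure (lborel_on A) (Pair l -` (?T -` Pi\<^sub>E A E \<inter> space ?C)) =
          (\<Prod>a\<in>A. emeasure lborel (Pair (l a) -` E a))"
        using lebesgue.emeasure_PiM[OF A slice] by simp
    qed
    also have "\<dots> = (\<Prod>a\<in>A. \<Sum>k\<in>V. emeasure lborel (Pair k -` E a))"
      using A V by (intro prod_sum_PiE[symmetric]) auto
    also have "\<dots> = (\<Prod>a\<in>A. emeasure ?R (E a))"
      using E V by (intro prod.cong refl)
        (simp add: lborel.emeasure_pair_measure_alt nn_integral_count_space_finite)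
    finally show "emeasure (distr ?C (\<Pi>\<^sub>M a\<in>A. ?R) ?T) (Pi\<^sub>E A E) = (\<Prod>a\<in>A. emeasure ?R (E a))" .
  qed simp
qed

lemma leveled_integral:
  fixes V :: "nat set" and f :: "('a \<Rightarrow> nat \<times> real) \<Rightarrow> complex"
  assumes A: "finite A" and V: "finite V"
    and f: "f \<in> borel_measurable (\<Pi>\<^sub>M a\<in>A. count_space V \<Otimes>\<^sub>M lborel)"
    and int: "\<And>l. l \<in> A \<rightarrow>\<^sub>E V \<Longrightarrow> integrable (lborel_on A) (\<lambda>x. f (\<lambda>a\<in>A. (l a, x a)))"
  shows "integrable (\<Pi>\<^sub>M a\<in>A. count_space V \<Otimes>\<^sub>M lborel) f"
    and "(LINT p|(\<Pi>\<^sub>M a\<in>A. count_space V \<Otimes>\<^sub>M lborel). f p) =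
      (\<Sum>l\<in>A \<rightarrow>\<^sub>E V. LINT x|(lborel_on A). f (\<lambda>a\<in>A. (l a, x a)))"
proof -
  let ?M = "lborel_on A"
  let ?C = "count_space (A \<rightarrow>\<^sub>E V) \<Otimes>\<^sub>M ?M"
    and ?R = "\<Pi>\<^sub>M a\<in>A. count_space V \<Otimes>\<^sub>M (lborel :: real measure)" and ?T = "\<lambda>p. \<lambda>a\<in>A. (fst p a, snd p a)"
  note T = distr_leveled_PiM(2)[OF A V] and D = distr_leveled_PiM(1)[OF A V]
  have fin: "finite (A \<rightarrow>\<^sub>E V)"
    using A V by (intro finite_PiE) auto
  interpret sigma_finite_measure "count_space (A \<rightarrow>\<^sub>E V)"
    by (rule sigma_finite_measure_count_space_finite[OF fin])
  interpret PL: finite_product_sigma_finite "\<lambda>_. lborel :: real measure" A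
    by standard (rule A)
  interpret pair_sigma_finite "count_space (A \<rightarrow>\<^sub>E V)" ?M
    by standard
  have fT: "(\<lambda>p. f (?T p)) \<in> borel_measurable ?C"
    by (rule measurable_compose[OF T f])
  have C: "integrable ?C (\<lambda>p. f (?T p))"
  proof (rule integrableI_bounded[OF fT])
    have "(\<integral>\<^sup>+p. ennreal (norm (f (?T p))) \<partial>?C) =
        (\<integral>\<^sup>+l. \<integral>\<^sup>+x. ennreal (norm (f (?T (l, x)))) \<partial>?M \<partial>count_space (A \<rightarrow>\<^sub>E V))"
      using fT by (intro PL.nn_integral_fst[symmetric]) simp
    also have "\<dots> = (\<Sum>l\<in>A \<rightarrow>\<^sub>E V. \<integral>\<^sup>+x. ennreal (norm (f (\<lambda>a\<in>A. (l a, x a)))) \<partial>?M)"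
      using fin by (simp add: nn_integral_count_space_finite)
    also have "\<dots> < \<infinity>"
      using fin int by (simp add: integrable_iff_bounded)
    finally show "(\<integral>\<^sup>+p. ennreal (norm (f (?T p))) \<partial>?C) < \<infinity>" .
  qed
  show "integrable ?R f"
    using C integrable_distr_eq[OF T f] by (simp add: D)
  have "(LINT p|?R. f p) = (LINT p|?C. f (?T p))"
    using integral_distr[OF T f] by (simp add: D)
  also have "\<dots> = (LINT l|count_space (A \<rightarrow>\<^sub>E V). LINT x|?M. f (?T (l, x)))"
    by (rule integral_fst'[symmetric, OF C])
  also have "\<dots> = (\<Sum>l\<in>A \<rightarrow>\<^sub>E V. LINT x|?M. f (\<lambda>a\<in>A. (l a, x a)))"
    using fin by (simp add: lebesgue_integral_count_space_finite)
  finally show "(LINT p|?R. f p) = (\<Sum>l\<in>A \<rightarrow>\<^sub>E V. LINT x|?M. f (\<lambda>a\<in>A. (l a, x a)))" .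
qed

lemma leveled_space:
  assumes p: "p \<in> space (\<Pi>\<^sub>M a\<in>A. count_space V \<Otimes>\<^sub>M (lborel :: real measure))" and a: "a \<in> A"
  shows "fst (p a) \<in> V"
proof -
  have "p \<in> A \<rightarrow>\<^sub>E V \<times> UNIV"
    using p by (simp add: space_PiM space_pair_measure)
  from PiE_mem[OF this a] show ?thesis
    by (simp add: mem_Times_iff)
qed

lemma leveled_measurable:
  fixes h :: "('a \<Rightarrow> nat) \<Rightarrow> ('a \<Rightarrow> real) \<Rightarrow> complex"
  assumes A: "finite A" and V: "finite V"
    and h: "\<And>l. l \<in> A \<rightarrow>\<^sub>E V \<Longrightarrow> h l \<in> borel_measurable (lborel_on A)"
  shows "(\<lambda>p. h (\<lambda>a\<in>A. fst (p a)) (\<lambda>a\<in>A. snd (p a))) \<in>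
    borel_measurable (\<Pi>\<^sub>M a\<in>A. count_space V \<Otimes>\<^sub>M lborel)"
proof -
  let ?R = "\<Pi>\<^sub>M a\<in>A. count_space V \<Otimes>\<^sub>M (lborel :: real measure)"
  have comp: "(\<lambda>p. p a) \<in> measurable ?R (count_space V \<Otimes>\<^sub>M lborel)" if "a \<in> A" for a
    by (rule measurable_component_singleton[OF that])
  let ?t = "\<lambda>l p. if \<forall>a\<in>A. fst (p a) = l a then h l (\<lambda>a\<in>A. snd (p a)) else 0"
  have "?t l \<in> borel_measurable ?R" if l: "l \<in> A \<rightarrow>\<^sub>E V" for l
  proof (rule measurable_If)
    have "(\<lambda>p. \<lambda>a\<in>A. snd (p a)) \<in> measurable ?R (lborel_on A)"
      by (rule measurable_restrict[OF measurable_compose[OF comp measurable_snd]])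
    then show "(\<lambda>p. h l (\<lambda>a\<in>A. snd (p a))) \<in> borel_measurable ?R"
      by (rule measurable_compose[OF _ h[OF l]])
    show "{p\<in>space ?R. \<forall>a\<in>A. fst (p a) = l a} \<in> sets ?R"
    proof (rule sets.sets_Collect_finite_All[OF _ A])
      fix a assume a: "a \<in> A"
      have "(\<lambda>p. fst (p a)) \<in> measurable ?R (count_space V)"
        by (rule measurable_compose[OF comp[OF a] measurable_fst])
      then have "(\<lambda>p. fst (p a)) -` {l a} \<inter> space ?R \<in> sets ?R"
        by (rule measurable_sets) (use PiE_mem[OF l a] in simp)
      also have "(\<lambda>p. fst (p a)) -` {l a} \<inter> space ?R = {p\<in>space ?R. fst (p a) = l a}"
        by blast
      finally show "{p\<in>space ?R. fst (p a) = l a} \<in> sets ?R" .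
    qed
  qed simp
  then have "(\<lambda>p. \<Sum>l\<in>A \<rightarrow>\<^sub>E V. ?t l p) \<in> borel_measurable ?R"
    by (rule borel_measurable_sum)
  moreover have "(\<Sum>l\<in>A \<rightarrow>\<^sub>E V. ?t l p) = h (\<lambda>a\<in>A. fst (p a)) (\<lambda>a\<in>A. snd (p a))" if p: "p \<in> space ?R" for p
  proof -
    let ?l = "\<lambda>a\<in>A. fst (p a)"
    have l: "?l \<in> A \<rightarrow>\<^sub>E V"
      unfolding restrict_PiE_iff using leveled_space[OF p] by blast
    have "(\<forall>a\<in>A. fst (p a) = l a) \<longleftrightarrow> l = ?l" if "l \<in> A \<rightarrow>\<^sub>E V" for l
      using PiE_arb[OF that] by (auto simp: fun_eq_iff)
    then have "(\<Sum>l\<in>A \<rightarrow>\<^sub>E V. ?t l p) = (\<Sum>l\<in>A \<rightarrow>\<^sub>E V. if l = ?l then h l (\<lambda>a\<in>A. snd (p a)) else 0)"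
      by (intro sum.cong refl) simp
    also have "\<dots> = h ?l (\<lambda>a\<in>A. snd (p a))"
      using l A V by (subst sum.delta) (auto intro: finite_PiE)
    finally show ?thesis .
  qed
  ultimately show ?thesis
    by (simp cong: measurable_cong)
qed

section \<open>Sorting the entries of each level\<close>

definition level_perms :: "nat \<Rightarrow> nat \<Rightarrow> (nat \<times> nat \<Rightarrow> nat \<times> nat) set" where
  "level_perms m L = {\<sigma>. \<sigma> permutes labels m L \<and> (\<forall>p\<in>labels m L. fst (\<sigma> p) = fst p)}"

definition relabel :: "nat \<Rightarrow> nat \<Rightarrow> (nat \<times> nat \<Rightarrow> nat \<times> nat) \<Rightarrow> (nat \<times> nat \<Rightarrow> real) \<Rightarrow> nat \<times> nat \<Rightarrow> real" where
  "relabel m L \<sigma> X = (\<lambda>p\<in>labels m L. X (\<sigma> p))"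

definition ordered_confs :: "nat \<Rightarrow> nat \<Rightarrow> (nat \<times> nat \<Rightarrow> real) set" where
  "ordered_confs m L = {X. \<forall>k\<in>{m+1..m+L}. (\<lambda>i. X (k, i)) \<in> Conf k}"

text \<open>The position that the entry \<open>p\<close> takes when its level is sorted in decreasing order.\<close>

definition level_rank :: "(nat \<times> nat \<Rightarrow> real) \<Rightarrow> nat \<times> nat \<Rightarrow> nat \<times> nat" where
  "level_rank X p = (fst p, Suc (card {j\<in>{1..fst p}. X p < X (fst p, j)}))"

lemma finite_level_perms: "finite (level_perms m L)"
  unfolding level_perms_def using finite_permutations[OF finite_labels, of m L]
  by (rule finite_subset[rotated]) auto

lemma id_level_perm: "id \<in> level_perms m L"
  by (simp add: level_perms_def permutes_id)

lemma mem_ordered_confs: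
  "X \<in> ordered_confs m L \<longleftrightarrow>
    (\<forall>k\<in>{m+1..m+L}. \<forall>i\<in>{1..k}. \<forall>j\<in>{1..k}. i \<le> j \<longrightarrow> X (k, j) \<le> X (k, i))"
  unfolding ordered_confs_def Conf_def by auto

lemma level_rank_less:
  assumes "k \<in> {m+1..m+L}" "i \<in> {1..k}" "X (k, j) < X (k, i)"
  shows "snd (level_rank X (k, i)) < snd (level_rank X (k, j))"
proof -
  have "{l\<in>{1..k}. X (k, i) < X (k, l)} \<subset> {l\<in>{1..k}. X (k, j) < X (k, l)}"
    using assms by force
  then show ?thesis
    by (simp add: level_rank_def psubset_card_mono)
qed

lemma level_rank_bij:
  assumes inj: "\<And>k. k \<in> {m+1..m+L} \<Longrightarrow> inj_on (\<lambda>i. X (k, i)) {1..k}"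
  shows "bij_betw (level_rank X) (labels m L) (labels m L)"
proof -
  have "inj_on (level_rank X) (labels m L)"
  proof (rule inj_onI)
    fix p q assume p: "p \<in> labels m L" and q: "q \<in> labels m L" and eq: "level_rank X p = level_rank X q"
    obtain k i j where pq: "p = (k, i)" "q = (k, j)"
      using eq by (cases p; cases q) (auto simp: level_rank_def)
    then have k: "k \<in> {m+1..m+L}" "i \<in> {1..k}" "j \<in> {1..k}"
      using p q by (auto simp: labels_def)
    have "\<not> X (k, j) < X (k, i)" "\<not> X (k, i) < X (k, j)"
      using level_rank_less[OF k(1,2), of X j] level_rank_less[OF k(1,3), of X i] eq pq by auto
    then have "i = j"
      using inj_onD[OF inj[OF k(1)], of i j] k by auto
    then show "p = q"
      by (simp add: pq)
  qed
  moreover have "level_rank X ` labels m L \<subseteq> labels m L"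
  proof
    fix r assume "r \<in> level_rank X ` labels m L"
    then obtain k i where r: "r = level_rank X (k, i)" "k \<in> {m+1..m+L}" "i \<in> {1..k}"
      by (auto simp: labels_def)
    have "card {j\<in>{1..k}. X (k, i) < X (k, j)} \<le> card ({1..k} - {i})"
      by (intro card_mono) auto
    then show "r \<in> labels m L"
      using r by (auto simp: level_rank_def labels_def)
  qed
  ultimately show ?thesis
    unfolding bij_betw_def using finite_labels endo_inj_surj by blast
qed

text \<open>In a decreasing level without ties the \<open>i\<close>-th entry is the one with \<open>i - 1\<close> larger entries.\<close>

lemma relabel_ordered_iff:
  assumes inj: "\<And>k. k \<in> {m+1..m+L} \<Longrightarrow> inj_on (\<lambda>i. X (k, i)) {1..k}" and \<sigma>: "\<sigma> \<in> level_perms m L"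
  shows "relabel m L \<sigma> X \<in> ordered_confs m L \<longleftrightarrow> (\<forall>p\<in>labels m L. level_rank X (\<sigma> p) = p)"
proof
  assume ord: "relabel m L \<sigma> X \<in> ordered_confs m L"
  show "\<forall>p\<in>labels m L. level_rank X (\<sigma> p) = p"
  proof
    fix p assume p: "p \<in> labels m L"
    obtain k i where ki: "p = (k, i)" "k \<in> {m+1..m+L}" "i \<in> {1..k}"
      using p by (auto simp: labels_def)
    define s where "s j = snd (\<sigma> (k, j))" for j
    have lab: "(k, j) \<in> labels m L" if "j \<in> {1..k}" for j
      using ki that by (auto simp: labels_def)
    have s: "\<sigma> (k, j) = (k, s j)" if "j \<in> {1..k}" for j
      using \<sigma> lab[OF that] by (auto simp: level_perms_def s_def prod_eq_iff)
    have s_in: "s j \<in> {1..k}" if "j \<in> {1..k}" for j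
      using \<sigma> lab[OF that] permutes_in_image[of \<sigma> "labels m L" "(k, j)"] s[OF that]
      by (auto simp: level_perms_def labels_def)
    have s_inj: "inj_on s {1..k}"
    proof (rule inj_onI)
      fix j l assume "j \<in> {1..k}" "l \<in> {1..k}" "s j = s l"
      then have "\<sigma> (k, j) = \<sigma> (k, l)"
        by (simp add: s)
      then show "j = l"
        using permutes_inj[of \<sigma> "labels m L"] \<sigma> by (auto simp: level_perms_def inj_def)
    qed
    have s_im: "s ` {1..k} = {1..k}"
      using s_in s_inj by (intro endo_inj_surj) auto
    have mono: "X (k, s j) \<le> X (k, s l)" if "l \<in> {1..k}" "j \<in> {1..k}" "l \<le> j" for l j
    proof -
      have "relabel m L \<sigma> X (k, j) \<le> relabel m L \<sigma> X (k, l)"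
        using ord that ki(2) unfolding mem_ordered_confs by blast
      then show ?thesis
        unfolding relabel_def using lab[OF that(1)] lab[OF that(2)] s[OF that(1)] s[OF that(2)] by simp
    qed
    have strict: "X (k, s i) < X (k, s j) \<longleftrightarrow> j < i" if j: "j \<in> {1..k}" for j
    proof
      assume "X (k, s i) < X (k, s j)"
      then show "j < i"
        using mono[OF ki(3) j] by (meson leI not_le)
    next
      assume "j < i"
      then have "X (k, s i) \<le> X (k, s j)"
        using mono[OF j ki(3)] by simp
      moreover have "s i \<noteq> s j"
        using inj_onD[OF s_inj _ ki(3) j] \<open>j < i\<close> by auto
      moreover have "X (k, s i) \<noteq> X (k, s j)"
        using inj_onD[OF inj[OF ki(2)] _ s_in[OF ki(3)] s_in[OF j]] \<open>s i \<noteq> s j\<close> by blast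
      ultimately show "X (k, s i) < X (k, s j)"
        by simp
    qed
    have "{l\<in>{1..k}. X (k, s i) < X (k, l)} = s ` {1..<i}"
    proof (intro equalityI subsetI)
      fix l assume l: "l \<in> {l\<in>{1..k}. X (k, s i) < X (k, l)}"
      then have "l \<in> s ` {1..k}"
        unfolding s_im by simp
      then obtain j where j: "j \<in> {1..k}" "l = s j"
        by blast
      then have "j < i"
        using l strict by blast
      then show "l \<in> s ` {1..<i}"
        using j by auto
    next
      fix l assume "l \<in> s ` {1..<i}"
      then obtain j where j: "j < i" "j \<in> {1..k}" "l = s j"
        using ki(3) by auto
      then show "l \<in> {l\<in>{1..k}. X (k, s i) < X (k, l)}"
        using strict[OF j(2)] s_in[OF j(2)] by blast
    qed
    moreover have "card (s ` {1..<i}) = i - 1"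
      using ki(3) by (subst card_image) (auto intro: inj_on_subset[OF s_inj])
    ultimately show "level_rank X (\<sigma> p) = p"
      using ki s[OF ki(3)] by (auto simp: level_rank_def)
  qed
next
  assume rank: "\<forall>p\<in>labels m L. level_rank X (\<sigma> p) = p"
  show "relabel m L \<sigma> X \<in> ordered_confs m L"
    unfolding mem_ordered_confs
  proof (intro ballI impI)
    fix k i j assume k: "k \<in> {m+1..m+L}" and i: "i \<in> {1..k}" and j: "j \<in> {1..k}" and le: "i \<le> j"
    have lab: "(k, l) \<in> labels m L" if "l \<in> {1..k}" for l
      using k that by (auto simp: labels_def)
    have s: "\<exists>s\<in>{1..k}. \<sigma> (k, l) = (k, s)" if "l \<in> {1..k}" for l
    proof -
      have "\<sigma> permutes labels m L" and fst: "fst (\<sigma> (k, l)) = k"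
        using \<sigma> lab[OF that] by (simp_all add: level_perms_def)
      then have "\<sigma> (k, l) \<in> labels m L"
        using lab[OF that] by (simp only: permutes_in_image)
      then have "snd (\<sigma> (k, l)) \<in> {1..k}"
        using fst by (auto simp: labels_def)
      then show ?thesis
        using fst by (metis prod.collapse)
    qed
    obtain s t where st: "\<sigma> (k, i) = (k, s)" "\<sigma> (k, j) = (k, t)" "s \<in> {1..k}" "t \<in> {1..k}"
      using s[OF i] s[OF j] by blast
    have "\<not> X (k, s) < X (k, t)"
    proof
      assume "X (k, s) < X (k, t)"
      from level_rank_less[OF k st(4) this] have "j < i"
        using rank[rule_format, OF lab[OF i]] rank[rule_format, OF lab[OF j]] st by simp
      then show False
        using le by simp
    qed
    then show "relabel m L \<sigma> X (k, j) \<le> relabel m L \<sigma> X (k, i)"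
      using st lab[OF i] lab[OF j] by (simp add: relabel_def)
  qed
qed

text \<open>Exactly one permutation sorts the configuration, namely the inverse of \<open>level_rank\<close>.\<close>

lemma sum_ordered_indicator:
  assumes inj: "\<And>k. k \<in> {m+1..m+L} \<Longrightarrow> inj_on (\<lambda>i. X (k, i)) {1..k}"
  shows "(\<Sum>\<sigma>\<in>level_perms m L. indicator (ordered_confs m L) (relabel m L \<sigma> X)) = (1 :: real)"
proof -
  let ?\<Lambda> = "labels m L"
  let ?r = "restrict_id (level_rank X) ?\<Lambda>"
  have r: "?r permutes ?\<Lambda>"
    by (rule permutes_restrict_id[OF level_rank_bij[OF inj]])
  define \<tau> where "\<tau> = inv_into UNIV ?r"
  have \<tau>: "\<tau> permutes ?\<Lambda>" "?r (\<tau> p) = p" "\<tau> (?r p) = p" for p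
    using permutes_inv[OF r] permutes_inverses[OF r] by (auto simp: \<tau>_def)
  have "fst (\<tau> p) = fst p" if "p \<in> ?\<Lambda>" for p
  proof -
    have "\<tau> p \<in> ?\<Lambda>"
      using that \<tau>(1) by (simp add: permutes_in_image)
    then have "level_rank X (\<tau> p) = p"
      using \<tau>(2)[of p] by simp
    then show ?thesis
      by (metis fst_conv level_rank_def)
  qed
  then have \<tau>_in: "\<tau> \<in> level_perms m L"
    using \<tau>(1) by (simp add: level_perms_def)
  have "relabel m L \<sigma> X \<in> ordered_confs m L \<longleftrightarrow> \<sigma> = \<tau>" if \<sigma>: "\<sigma> \<in> level_perms m L" for \<sigma>
  proof -
    have "(\<forall>p\<in>?\<Lambda>. level_rank X (\<sigma> p) = p) \<longleftrightarrow> \<sigma> = \<tau>"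
    proof
      assume a: "\<forall>p\<in>?\<Lambda>. level_rank X (\<sigma> p) = p"
      have \<sigma>p: "\<sigma> permutes ?\<Lambda>"
        using \<sigma> by (simp add: level_perms_def)
      show "\<sigma> = \<tau>"
      proof
        fix p show "\<sigma> p = \<tau> p"
        proof (cases "p \<in> ?\<Lambda>")
          case True
          then have "?r (\<sigma> p) = p"
            using a \<sigma>p by (simp add: permutes_in_image)
          then show ?thesis
            using \<tau>(3)[of "\<sigma> p"] by simp
        next
          case False
          then show ?thesis
            using \<sigma>p \<tau>(1) by (simp add: permutes_not_in)
        qed
      qed
    next
      assume "\<sigma> = \<tau>"
      then show "\<forall>p\<in>?\<Lambda>. level_rank X (\<sigma> p) = p"
        using \<tau>(1,2) by (metis permutes_in_image restrict_id_simps(1))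
    qed
    then show ?thesis
      using relabel_ordered_iff[OF inj \<sigma>] by simp
  qed
  then have "(\<Sum>\<sigma>\<in>level_perms m L. indicator (ordered_confs m L) (relabel m L \<sigma> X)) =
      (\<Sum>\<sigma>\<in>level_perms m L. if \<sigma> = \<tau> then 1 else 0 :: real)"
    by (intro sum.cong refl) (simp add: indicator_def)
  then show ?thesis
    using \<tau>_in finite_level_perms by simp
qed

lemma relabel_measurable:
  assumes "\<sigma> \<in> level_perms m L"
  shows "relabel m L \<sigma> \<in> measurable (lborel_on (labels m L)) (lborel_on (labels m L))"
  unfolding relabel_def[abs_def]
  by (intro measurable_restrict measurable_component_singleton)
    (use assms in \<open>auto simp: level_perms_def permutes_in_image\<close>)

lemma integral_relabel:
  fixes h :: "(nat \<times> nat \<Rightarrow> real) \<Rightarrow> complex"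
  assumes \<sigma>: "\<sigma> \<in> level_perms m L" and h: "h \<in> borel_measurable (lborel_on (labels m L))"
  shows "(LINT X|(lborel_on (labels m L)). h (relabel m L \<sigma> X)) = (LINT X|(lborel_on (labels m L)). h X)"
proof -
  have p: "\<sigma> permutes labels m L"
    using \<sigma> by (simp add: level_perms_def)
  show ?thesis
    using integral_PiM_lborel_reindex[OF finite_labels permutes_inj_on[OF p] h] permutes_image[OF p]
    by (simp add: relabel_def)
qed

lemma ordered_confs_sets:
  "ordered_confs m L \<inter> space (lborel_on (labels m L)) \<in> sets (lborel_on (labels m L))"
proof -
  let ?M = "lborel_on (labels m L)"
  have c: "(\<lambda>X. X p) \<in> borel_measurable ?M" if "p \<in> labels m L" for p
    using measurable_component_singleton[OF that, of "\<lambda>_. lborel :: real measure"] by simp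
  have pair: "{X\<in>space ?M. i \<le> j \<longrightarrow> X (k, j) \<le> X (k, i)} \<in> sets ?M"
    if "k \<in> {m+1..m+L}" "i \<in> {1..k}" "j \<in> {1..k}" for k i j
  proof (cases "i \<le> j")
    case True
    have "(k, i) \<in> labels m L" "(k, j) \<in> labels m L"
      using that by (auto simp: labels_def)
    then have "{X\<in>space ?M. X (k, j) \<le> X (k, i)} \<in> sets ?M"
      by (intro borel_measurable_le c)
    then show ?thesis
      using True by simp
  qed simp
  have all_j: "{X\<in>space ?M. \<forall>j\<in>{1..k}. i \<le> j \<longrightarrow> X (k, j) \<le> X (k, i)} \<in> sets ?M"
    if "k \<in> {m+1..m+L}" "i \<in> {1..k}" for k i
    by (rule sets.sets_Collect_finite_All[OF pair[OF that] finite_atLeastAtMost])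
  have all_i: "{X\<in>space ?M. \<forall>i\<in>{1..k}. \<forall>j\<in>{1..k}. i \<le> j \<longrightarrow> X (k, j) \<le> X (k, i)} \<in> sets ?M"
    if "k \<in> {m+1..m+L}" for k
    by (rule sets.sets_Collect_finite_All[OF all_j[OF that] finite_atLeastAtMost])
  have "{X\<in>space ?M. \<forall>k\<in>{m+1..m+L}. \<forall>i\<in>{1..k}. \<forall>j\<in>{1..k}. i \<le> j \<longrightarrow> X (k, j) \<le> X (k, i)} \<in> sets ?M"
    by (rule sets.sets_Collect_finite_All[OF all_i finite_atLeastAtMost])
  also have "{X\<in>space ?M. \<forall>k\<in>{m+1..m+L}. \<forall>i\<in>{1..k}. \<forall>j\<in>{1..k}. i \<le> j \<longrightarrow> X (k, j) \<le> X (k, i)} =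
      ordered_confs m L \<inter> space ?M"
    unfolding Int_def mem_ordered_confs by (rule Collect_cong) (rule conj_commute)
  finally show ?thesis .
qed

lemma integral_conf_measure:
  fixes h :: "(nat \<times> nat \<Rightarrow> real) \<Rightarrow> complex"
  shows "(LINT X|conf_measure m L. h X) =
    (LINT X|(lborel_on (labels m L)). indicator (ordered_confs m L) X *\<^sub>R h X)"
  unfolding conf_measure_def ordered_confs_def[symmetric]
  by (rule integral_restrict_space[OF ordered_confs_sets])

text \<open>The configurations in the statement are ordered, but integrating out points one by one requires
  free variables. A symmetric function that vanishes on ties does not distinguish the orderings
  of a level.\<close>

lemma integral_symmetrize:
  fixes h :: "(nat \<times> nat \<Rightarrow> real) \<Rightarrow> complex"
  assumes int: "integrable (lborel_on (labels m L)) h"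
    and sym: "\<And>\<sigma> X. \<sigma> \<in> level_perms m L \<Longrightarrow> h (relabel m L \<sigma> X) = h X"
    and ties: "\<And>k X. k \<in> {m+1..m+L} \<Longrightarrow> \<not> inj_on (\<lambda>i. X (k, i)) {1..k} \<Longrightarrow> h X = 0"
  shows "(LINT X|(lborel_on (labels m L)). h X) =
    of_nat (card (level_perms m L)) * (LINT X|conf_measure m L. h X)"
proof -
  let ?M = "lborel_on (labels m L)"
  let ?g = "\<lambda>X. indicator (ordered_confs m L) X *\<^sub>R h X"
  have g: "?g \<in> borel_measurable ?M"
  proof -
    have "(\<lambda>X. indicator (ordered_confs m L \<inter> space ?M) X *\<^sub>R h X) \<in> borel_measurable ?M"
      by (rule borel_measurable_scaleR[OF borel_measurable_indicator[OF ordered_confs_sets]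
            borel_measurable_integrable[OF int]])
    then show ?thesis
      by (rule measurable_cong[THEN iffD1, rotated]) (simp add: indicator_def)
  qed
  have gr: "integrable ?M (\<lambda>X. ?g (relabel m L \<sigma> X))" if \<sigma>: "\<sigma> \<in> level_perms m L" for \<sigma>
  proof (rule Bochner_Integration.integrable_bound[OF int])
    show "(\<lambda>X. ?g (relabel m L \<sigma> X)) \<in> borel_measurable ?M"
      by (rule measurable_compose[OF relabel_measurable[OF \<sigma>] g])
  qed (auto simp: sym[OF \<sigma>] indicator_def)
  have "h X = (\<Sum>\<sigma>\<in>level_perms m L. ?g (relabel m L \<sigma> X))" for X
  proof (cases "\<forall>k\<in>{m+1..m+L}. inj_on (\<lambda>i. X (k, i)) {1..k}")
    case True
    have "(\<Sum>\<sigma>\<in>level_perms m L. ?g (relabel m L \<sigma> X)) =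
        (\<Sum>\<sigma>\<in>level_perms m L. indicator (ordered_confs m L) (relabel m L \<sigma> X)) *\<^sub>R h X"
      by (simp add: sym scaleR_sum_left)
    then show ?thesis
      using sum_ordered_indicator[of m L X] True by simp
  next
    case False
    then have "h X = 0"
      using ties by blast
    then show ?thesis
      by (simp add: sym)
  qed
  then have "(LINT X|?M. h X) = (LINT X|?M. (\<Sum>\<sigma>\<in>level_perms m L. ?g (relabel m L \<sigma> X)))"
    by (rule Bochner_Integration.integral_cong[OF refl])
  also have "\<dots> = (\<Sum>\<sigma>\<in>level_perms m L. (LINT X|?M. ?g (relabel m L \<sigma> X)))"
    by (rule Bochner_Integration.integral_sum[OF gr])
  also have "\<dots> = (\<Sum>\<sigma>\<in>level_perms m L. (LINT X|?M. ?g X))"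
    by (intro sum.cong refl integral_relabel g)
  finally show ?thesis
    by (simp add: integral_conf_measure)
qed

section \<open>Counting labelled tuples\<close>

text \<open>The possible labellings of a tuple of points indexed by \<open>A\<close>.\<close>

definition label_maps :: "nat \<Rightarrow> nat \<Rightarrow> nat set \<Rightarrow> (nat \<Rightarrow> nat \<times> nat) set" where
  "label_maps m L A = {s \<in> A \<rightarrow>\<^sub>E labels m L. inj_on s A}"

text \<open>The number of bijections, level by level, from new points that complete \<open>P\<close> to \<open>k\<close> points on each
  level \<open>k\<close> to the labels that are left over. It is the product of the factors that appear when the
  complementary points are integrated out.\<close>

definition room :: "nat \<Rightarrow> nat \<Rightarrow> 'p set \<Rightarrow> ('p \<Rightarrow> nat) \<Rightarrow> nat" where
  "room m L P lev = (\<Prod>k=m+1..m+L. fact (k - card {p\<in>P. lev p = k}))"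

lemma finite_label_maps: "finite A \<Longrightarrow> finite (label_maps m L A)"
  unfolding label_maps_def using finite_PiE[of A "\<lambda>_. labels m L"] finite_labels by auto

lemma level_count_insert:
  assumes "finite P" "q \<notin> P"
  shows "card {p\<in>insert q P. lev p = k} = card {p\<in>P. lev p = k} + (if lev q = k then 1 else 0)"
proof -
  have "{p\<in>insert q P. lev p = k} = (if lev q = k then insert q {p\<in>P. lev p = k} else {p\<in>P. lev p = k})"
    by auto
  then show ?thesis
    using assms by simp
qed

lemma room_insert:
  assumes P: "finite P" "q \<notin> P" and q: "lev q \<in> {m+1..m+L}"
    and free: "card {p\<in>insert q P. lev p = lev q} \<le> lev q"
  shows "(lev q - card {p\<in>P. lev p = lev q}) * room m L (insert q P) lev = room m L P lev"
proof -
  let ?f = "\<lambda>P k. fact (k - card {p\<in>P. lev p = k}) :: nat"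
  have "(\<Prod>k\<in>{m+1..m+L} - {lev q}. ?f (insert q P) k) = (\<Prod>k\<in>{m+1..m+L} - {lev q}. ?f P k)"
    unfolding level_count_insert[OF P] by (rule prod.cong) auto
  moreover have "(lev q - card {p\<in>P. lev p = lev q}) * ?f (insert q P) (lev q) = ?f P (lev q)"
  proof -
    have "lev q - card {p\<in>P. lev p = lev q} = Suc (lev q - card {p\<in>insert q P. lev p = lev q})"
      using free unfolding level_count_insert[OF P] by simp
    then show ?thesis
      by simp
  qed
  ultimately show ?thesis
    using q unfolding room_def by (simp add: prod.remove[of _ "lev q"] flip: mult.assoc)
qed

lemma level_count_image:
  assumes "inj_on s A"
  shows "card {p\<in>s ` A. lev p = k} = card {a\<in>A. lev (s a) = k}"
proof -
  have "{p\<in>s ` A. lev p = k} = s ` {a\<in>A. lev (s a) = k}"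
    by auto
  then show ?thesis
    using assms by (simp add: card_image inj_on_subset)
qed

lemma card_level: "k \<in> {m+1..m+L} \<Longrightarrow> card {p\<in>labels m L. fst p = k} = k"
proof -
  assume "k \<in> {m+1..m+L}"
  then have "{p\<in>labels m L. fst p = k} = Pair k ` {1..k}"
    by (auto simp: labels_def)
  then show ?thesis
    by (simp add: card_image inj_on_def)
qed

lemma room_labels: "room m L (labels m L) fst = 1"
  unfolding room_def by (intro prod.neutral) (auto simp: card_level)

text \<open>Adjoining the point \<open>b\<close>, there are as many free labels on its level as \<open>room_insert\<close> takes away from
  the room. So the number of labellings with prescribed levels times the room left does not change.\<close>

lemma card_label_maps:
  assumes A: "finite A" and l: "l ` A \<subseteq> {m+1..m+L}"
    and free: "\<And>k. k \<in> {m+1..m+L} \<Longrightarrow> card {a\<in>A. l a = k} \<le> k"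
  shows "card {s\<in>label_maps m L A. \<forall>a\<in>A. fst (s a) = l a} * room m L A l = room m L ({} :: nat set) l"
  using assms
proof (induction A)
  case empty
  have "{s\<in>label_maps m L {}. \<forall>a\<in>{}. fst (s a) = l a} = {\<lambda>_. undefined}"
    by (auto simp: label_maps_def)
  then show ?case
    by simp
next
  case (insert b A)
  let ?S = "\<lambda>A. {s\<in>label_maps m L A. \<forall>a\<in>A. fst (s a) = l a}"
  let ?F = "\<lambda>s. {p\<in>labels m L. fst p = l b} - s ` A"
  have bl: "l b \<in> {m+1..m+L}"
    using insert.prems by auto
  have freeA: "card {a\<in>A. l a = k} \<le> k" if "k \<in> {m+1..m+L}" for k
    using insert.prems(2)[OF that] unfolding level_count_insert[OF insert.hyps] by simp
  have "bij_betw (\<lambda>(s, p). s(b := p)) (SIGMA s:?S A. ?F s) (?S (insert b A))"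
  proof (rule bij_betw_byWitness[where f' = "\<lambda>t. (restrict t A, t b)"])
    show "\<forall>x\<in>SIGMA s:?S A. ?F s. (\<lambda>t. (restrict t A, t b)) ((\<lambda>(s, p). s(b := p)) x) = x"
    proof
      fix x assume "x \<in> (SIGMA s:?S A. ?F s)"
      then obtain s p where x: "x = (s, p)" and s: "s \<in> A \<rightarrow>\<^sub>E labels m L"
        by (auto simp: label_maps_def)
      have "restrict (s(b := p)) A = s"
        by (rule ext) (use insert.hyps(2) PiE_arb[OF s] in \<open>auto simp: restrict_def\<close>)
      then show "(\<lambda>t. (restrict t A, t b)) ((\<lambda>(s, p). s(b := p)) x) = x"
        by (simp add: x)
    qed
    show "\<forall>t\<in>?S (insert b A). (\<lambda>(s, p). s(b := p)) (restrict t A, t b) = t"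
    proof
      fix t assume "t \<in> ?S (insert b A)"
      then have t: "t \<in> insert b A \<rightarrow>\<^sub>E labels m L"
        by (simp add: label_maps_def)
      have "(restrict t A)(b := t b) = t"
        by (rule ext) (use PiE_arb[OF t] in \<open>auto simp: restrict_def\<close>)
      then show "(\<lambda>(s, p). s(b := p)) (restrict t A, t b) = t"
        by simp
    qed
    show "(\<lambda>(s, p). s(b := p)) ` (SIGMA s:?S A. ?F s) \<subseteq> ?S (insert b A)"
    proof
      fix t assume "t \<in> (\<lambda>(s, p). s(b := p)) ` (SIGMA s:?S A. ?F s)"
      then obtain s p where t: "t = s(b := p)" "s \<in> ?S A" "p \<in> ?F s"
        by auto
      then have s: "s \<in> A \<rightarrow>\<^sub>E labels m L" "inj_on s A" "\<forall>a\<in>A. fst (s a) = l a"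
        and p: "p \<in> labels m L" "fst p = l b" "p \<notin> s ` A"
        by (simp_all add: label_maps_def)
      have "t \<in> insert b A \<rightarrow>\<^sub>E labels m L"
        unfolding t(1) using PiE_fun_upd[OF p(1) s(1)] .
      moreover have "inj_on t (insert b A)"
        unfolding t(1) using s(2) p(3) insert.hyps(2) by (auto simp: inj_on_def)
      moreover have "\<forall>a\<in>insert b A. fst (t a) = l a"
        unfolding t(1) using s(3) p(2) insert.hyps(2) by simp
      ultimately show "t \<in> ?S (insert b A)"
        by (simp add: label_maps_def)
    qed
    show "(\<lambda>t. (restrict t A, t b)) ` ?S (insert b A) \<subseteq> (SIGMA s:?S A. ?F s)"
    proof (rule image_subsetI)
      fix t assume "t \<in> ?S (insert b A)"
      then have t: "t \<in> insert b A \<rightarrow>\<^sub>E labels m L" "inj_on t (insert b A)" "\<forall>a\<in>insert b A. fst (t a) = l a"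
        by (simp_all add: label_maps_def)
      have "restrict t A \<in> A \<rightarrow>\<^sub>E labels m L" "t b \<in> labels m L"
        using t(1) by auto
      moreover have "inj_on (restrict t A) A" "t b \<notin> restrict t A ` A"
        using t(2) insert.hyps(2) by (auto simp: inj_on_def)
      ultimately show "(restrict t A, t b) \<in> (SIGMA s:?S A. ?F s)"
        using t(3) by (simp add: label_maps_def)
    qed
  qed
  then have "card (?S (insert b A)) = card (SIGMA s:?S A. ?F s)"
    by (simp add: bij_betw_same_card)
  also have "\<dots> = (\<Sum>s\<in>?S A. card (?F s))"
    using insert.hyps(1) finite_label_maps finite_labels by (intro card_SigmaI) auto
  also have "\<dots> = (\<Sum>s\<in>?S A. l b - card {a\<in>A. l a = l b})"
  proof (rule sum.cong[OF refl])
    fix s assume s: "s \<in> ?S A"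
    have "?F s = {p\<in>labels m L. fst p = l b} - {p\<in>s ` A. fst p = l b}"
      by auto
    also have "card \<dots> = card {p\<in>labels m L. fst p = l b} - card {p\<in>s ` A. fst p = l b}"
      using s insert.hyps(1) by (intro card_Diff_subset) (auto simp: label_maps_def)
    also have "card {p\<in>s ` A. fst p = l b} = card {a\<in>A. fst (s a) = l b}"
      using s by (intro level_count_image) (auto simp: label_maps_def)
    also have "{a\<in>A. fst (s a) = l b} = {a\<in>A. l a = l b}"
      using s by auto
    finally show "card (?F s) = l b - card {a\<in>A. l a = l b}"
      using card_level[OF bl] by simp
  qed
  finally have "card (?S (insert b A)) = card (?S A) * (l b - card {a\<in>A. l a = l b})"
    by simp
  then have "card (?S (insert b A)) * room m L (insert b A) l =
      card (?S A) * ((l b - card {a\<in>A. l a = l b}) * room m L (insert b A) l)"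
    by simp
  also have "\<dots> = card (?S A) * room m L A l"
    using room_insert[where lev = l, OF insert.hyps bl] insert.prems(2)[OF bl] by simp
  also have "\<dots> = room m L ({} :: nat set) l"
    using insert.IH insert.prems(1) freeA by simp
  finally show ?case .
qed

lemma label_mapsD:
  assumes "s \<in> label_maps m L A"
  shows "s ` A \<subseteq> labels m L" "inj_on s A" "a \<in> A \<Longrightarrow> fst (s a) \<in> {m+1..m+L}"
proof -
  show "s ` A \<subseteq> labels m L" "inj_on s A"
    using assms unfolding label_maps_def by (blast dest: PiE_mem)+
  then show "a \<in> A \<Longrightarrow> fst (s a) \<in> {m+1..m+L}"
    by (force simp: labels_def)
qed

lemma tuple_count_eq_sum:
  "of_nat (tuple_count m L n B X) =
    (\<Sum>s\<in>label_maps m L {..<n}. indicator B (\<lambda>a\<in>{..<n}. (fst (s a), X (s a))) :: complex)"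
proof -
  have "{s \<in> {..<n} \<rightarrow>\<^sub>E labels m L. inj_on s {..<n} \<and> (\<lambda>a\<in>{..<n}. (fst (s a), X (s a))) \<in> B} =
      {s\<in>label_maps m L {..<n}. (\<lambda>a\<in>{..<n}. (fst (s a), X (s a))) \<in> B}"
    by (auto simp: label_maps_def)
  then have "of_nat (tuple_count m L n B X) =
      (\<Sum>s\<in>{s\<in>label_maps m L {..<n}. (\<lambda>a\<in>{..<n}. (fst (s a), X (s a))) \<in> B}. 1 :: complex)"
    by (simp add: tuple_count_def)
  also have "\<dots> = (\<Sum>s\<in>label_maps m L {..<n}. if (\<lambda>a\<in>{..<n}. (fst (s a), X (s a))) \<in> B then 1 else 0)"
    by (rule sum.inter_filter) (simp add: finite_label_maps)
  also have "\<dots> = (\<Sum>s\<in>label_maps m L {..<n}. indicator B (\<lambda>a\<in>{..<n}. (fst (s a), X (s a))))"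
    by (intro sum.cong refl) (simp add: indicator_def)
  finally show ?thesis .
qed

lemma image_filter: "f ` S = T \<Longrightarrow> f ` {s\<in>S. Q (f s)} = {t\<in>T. Q t}"
  by auto

lemma tuple_count_relabel:
  assumes \<sigma>: "\<sigma> \<in> level_perms m L"
  shows "tuple_count m L n B (relabel m L \<sigma> X) = tuple_count m L n B X"
proof -
  let ?A = "{..<n}" and ?S = "label_maps m L {..<n}"
  let ?f = "\<lambda>s. \<lambda>a\<in>?A. \<sigma> (s a)" and ?pts = "\<lambda>Y s. \<lambda>a\<in>?A. (fst (s a), Y (s a))"
  have p: "\<sigma> permutes labels m L" and lev: "\<And>p. p \<in> labels m L \<Longrightarrow> fst (\<sigma> p) = fst p"
    using \<sigma> by (auto simp: level_perms_def)
  have lab: "s a \<in> labels m L" if "s \<in> ?S" "a \<in> ?A" for s a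
    using label_mapsD(1)[OF that(1)] that(2) by blast
  have pts: "?pts (relabel m L \<sigma> X) s = ?pts X (?f s)" if "s \<in> ?S" for s
    by (rule restrict_ext) (simp add: relabel_def lev lab[OF that])
  have f_in: "?f s \<in> ?S" if s: "s \<in> ?S" for s
  proof -
    have "inj_on (\<sigma> \<circ> s) ?A"
      by (intro comp_inj_on label_mapsD[OF s] permutes_inj_on[OF p])
    then have "inj_on (?f s) ?A"
      by (simp add: inj_on_def)
    moreover have "?f s \<in> ?A \<rightarrow>\<^sub>E labels m L"
      unfolding restrict_PiE_iff permutes_in_image[OF p] using lab[OF s] by blast
    ultimately show ?thesis
      by (simp add: label_maps_def)
  qed
  have inj_f: "inj_on ?f ?S"
  proof (rule inj_onI)
    fix s t assume st: "s \<in> ?S" "t \<in> ?S" "?f s = ?f t"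
    show "s = t"
    proof (rule PiE_ext)
      show "s \<in> ?A \<rightarrow>\<^sub>E labels m L" "t \<in> ?A \<rightarrow>\<^sub>E labels m L"
        using st(1,2) by (simp_all add: label_maps_def)
      fix a assume "a \<in> ?A"
      then have "\<sigma> (s a) = \<sigma> (t a)"
        using fun_cong[OF st(3), of a] by simp
      then show "s a = t a"
        by (rule injD[OF permutes_inj[OF p]])
    qed
  qed
  have "?f ` ?S = ?S"
    using f_in by (intro endo_inj_surj inj_f finite_label_maps) auto
  from image_filter[OF this, of "\<lambda>s. ?pts X s \<in> B"]
  have "?f ` {s\<in>?S. ?pts X (?f s) \<in> B} = {s\<in>?S. ?pts X s \<in> B}" .
  moreover have "card (?f ` {s\<in>?S. ?pts X (?f s) \<in> B}) = card {s\<in>?S. ?pts X (?f s) \<in> B}"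
    by (rule card_image[OF inj_on_subset[OF inj_f]]) blast
  moreover have "{s\<in>?S. ?pts X (?f s) \<in> B} = {s\<in>?S. ?pts (relabel m L \<sigma> X) s \<in> B}"
    using pts by (intro Collect_cong conj_cong refl) (simp only:)
  ultimately have "card {s\<in>?S. ?pts (relabel m L \<sigma> X) s \<in> B} = card {s\<in>?S. ?pts X s \<in> B}"
    by (simp only:)
  then show ?thesis
    by (simp only: tuple_count_def label_maps_def mem_Collect_eq conj_assoc)
qed

lemma room_empty: "room m L {} lev = (\<Prod>k=m+1..m+L. fact k)"
  by (simp add: room_def)

section \<open>Correlation functions\<close>

context bordered
begin

abbreviation "\<Lambda> \<equiv> labels m L"

lemma labels_full: "k \<in> {m+1..m+L} \<Longrightarrow> P \<subseteq> \<Lambda> \<Longrightarrow> card {p\<in>P. fst p = k} \<le> k"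
  using card_mono[of "{p\<in>\<Lambda>. fst p = k}" "{p\<in>P. fst p = k}"] card_level[of k m L]
  by (auto simp: finite_labels)

text \<open>The points of \<open>R\<close> are integrated out one at a time; the test function \<open>g\<close> does not see them. Each
  step contributes the factor in \<open>room_insert\<close>.\<close>

lemma marginal:
  fixes g :: "(nat \<times> nat \<Rightarrow> real) \<Rightarrow> complex"
  assumes P: "P \<subseteq> \<Lambda>" and g: "g \<in> borel_measurable (lborel_on P)" and bound: "\<And>x. norm (g x) \<le> 1"
    and R: "finite R" "R \<subseteq> \<Lambda>" "P \<inter> R = {}"
  shows "of_nat (room m L (P \<union> R) fst) * (LINT X|(lborel_on (P \<union> R)). bdet (P \<union> R) fst X * g (restrict X P)) =
    of_nat (room m L P fst) * (LINT X|(lborel_on P). bdet P fst X * g X)"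
  using R
proof (induction R)
  case empty
  have "(LINT X|(lborel_on P). bdet P fst X * g (restrict X P)) =
      (LINT X|(lborel_on P). bdet P fst X * g X)"
    by (rule Bochner_Integration.integral_cong[OF refl]) (simp add: space_PiM PiE_restrict)
  then show ?case
    by (simp only: Un_empty_right)
next
  case (insert q R)
  let ?Q = "P \<union> R"
  have finP: "finite P"
    using P finite_labels by (rule finite_subset)
  have Q: "finite ?Q" "q \<notin> ?Q" "?Q \<subseteq> \<Lambda>" "q \<in> \<Lambda>"
    using finP P insert by auto
  have lev: "fst ` ?Q \<subseteq> {m+1..m+L}" "fst q \<in> {m+1..m+L}"
    using Q labels_levels by auto
  have Q': "finite (insert q ?Q)" "fst ` insert q ?Q \<subseteq> {m+1..m+L}"
    using Q lev by auto
  have restr: "(\<lambda>X. restrict X P) \<in> measurable (lborel_on (insert q ?Q)) (lborel_on P)"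
    by (rule measurable_restrict_subset) auto
  let ?h = "\<lambda>X. bdet (insert q ?Q) fst X * g (restrict X P)"
  have int: "integrable (lborel_on (insert q ?Q)) ?h"
  proof (rule Bochner_Integration.integrable_bound[OF bdet_integrable[OF Q']])
    show "?h \<in> borel_measurable (lborel_on (insert q ?Q))"
      by (rule borel_measurable_times[OF bdet_measurable measurable_compose[OF restr g]])
    show "AE X in (lborel_on (insert q ?Q)). norm (?h X) \<le> norm (bdet (insert q ?Q) fst X)"
      using bound by (intro AE_I2) (simp add: norm_mult mult_left_le)
  qed
  have "(LINT X|(lborel_on (insert q ?Q)). ?h X) =
      (LINT X|(lborel_on ?Q). (LINT y|lborel. ?h (X(q := y))))"
    by (rule lebesgue.product_integral_insert[OF Q(1,2) int])
  also have "\<dots> = (LINT X|(lborel_on ?Q). of_nat (fst q - card {p\<in>?Q. fst p = fst q}) *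
      (bdet ?Q fst X * g (restrict X P)))"
  proof (rule Bochner_Integration.integral_cong[OF refl])
    fix X :: "nat \<times> nat \<Rightarrow> real"
    have "restrict (X(q := y)) P = restrict X P" for y
      using Q(2) by (auto simp: restrict_def)
    then have "(LINT y|lborel. ?h (X(q := y))) = (LINT y|lborel. bdet (insert q ?Q) fst (X(q := y))) * g (restrict X P)"
      by simp
    also have "(LINT y|lborel. bdet (insert q ?Q) fst (X(q := y))) =
        (of_nat (fst q) - of_nat (card {p\<in>?Q. fst p = fst q})) * bdet ?Q fst X"
      by (rule bdet_integrate_out[OF Q(1,2) lev])
    also have "of_nat (fst q) - of_nat (card {p\<in>?Q. fst p = fst q}) =
        (of_nat (fst q - card {p\<in>?Q. fst p = fst q}) :: complex)"
      by (rule of_nat_diff[symmetric, OF labels_full[OF lev(2) Q(3)]])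
    finally show "(LINT y|lborel. ?h (X(q := y))) =
        of_nat (fst q - card {p\<in>?Q. fst p = fst q}) * (bdet ?Q fst X * g (restrict X P))"
      by (simp only: mult.assoc)
  qed
  also have "\<dots> = of_nat (fst q - card {p\<in>?Q. fst p = fst q}) *
      (LINT X|(lborel_on ?Q). bdet ?Q fst X * g (restrict X P))"
    by (rule integral_mult_right_zero)
  finally have step: "(LINT X|(lborel_on (insert q ?Q)). ?h X) =
      of_nat (fst q - card {p\<in>?Q. fst p = fst q}) *
      (LINT X|(lborel_on ?Q). bdet ?Q fst X * g (restrict X P))" .
  have "insert q ?Q \<subseteq> \<Lambda>"
    using Q(3,4) by (rule insert_subsetI[rotated])
  then have "(fst q - card {p\<in>?Q. fst p = fst q}) * room m L (insert q ?Q) fst = room m L ?Q fst"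
    by (rule room_insert[OF Q(1,2) lev(2) labels_full[OF lev(2)]])
  then have room: "of_nat (room m L ?Q fst) =
      (of_nat (room m L (insert q ?Q) fst) * of_nat (fst q - card {p\<in>?Q. fst p = fst q}) :: complex)"
    by (simp only: of_nat_mult[symmetric] mult.commute)
  have "of_nat (room m L (insert q ?Q) fst) * (LINT X|(lborel_on (insert q ?Q)). ?h X) =
      of_nat (room m L ?Q fst) * (LINT X|(lborel_on ?Q). bdet ?Q fst X * g (restrict X P))"
    unfolding step room by (simp only: mult.assoc)
  also have "\<dots> = of_nat (room m L P fst) * (LINT X|(lborel_on P). bdet P fst X * g X)"
    using insert.prems by (intro insert.IH) auto
  finally show ?case
    by (simp only: Un_insert_right)
qed

lemma bdet_relabel_symmetric:
  assumes "\<sigma> \<in> level_perms m L"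
  shows "bdet \<Lambda> fst (relabel m L \<sigma> X) = bdet \<Lambda> fst X"
proof -
  have p: "\<sigma> permutes \<Lambda>" and lev: "\<And>p. p \<in> \<Lambda> \<Longrightarrow> fst (\<sigma> p) = fst p"
    using assms by (auto simp: level_perms_def)
  have "bdet \<Lambda> fst X = bdet (\<sigma> ` \<Lambda>) fst X"
    by (simp only: permutes_image[OF p])
  also have "\<dots> = bdet \<Lambda> (fst \<circ> \<sigma>) (X \<circ> \<sigma>)"
    by (rule bdet_relabel[OF finite_labels permutes_inj_on[OF p]])
  also have "\<dots> = bdet \<Lambda> fst (relabel m L \<sigma> X)"
    by (rule bdet_cong) (simp_all add: lev relabel_def)
  finally show ?thesis ..
qed

lemma bdet_ties:
  assumes k: "k \<in> {m+1..m+L}" and tie: "\<not> inj_on (\<lambda>i. X (k, i)) {1..k}"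
  shows "bdet \<Lambda> fst X = 0"
proof -
  obtain i j where "i \<in> {1..k}" "j \<in> {1..k}" "i \<noteq> j" "X (k, i) = X (k, j)"
    using tie by (auto simp: inj_on_def)
  then show ?thesis
    using k by (intro bdet_coincidence[of \<Lambda> "(k, i)" "(k, j)"]) (auto simp: labels_def)
qed

lemma integral_labelled_tuple:
  assumes s: "s \<in> label_maps m L {..<n}" and B: "B \<in> sets (\<Pi>\<^sub>M a\<in>{..<n}. reference_measure m L)"
  shows "(LINT X|(lborel_on \<Lambda>). bdet \<Lambda> fst X * indicator B (\<lambda>a\<in>{..<n}. (fst (s a), X (s a)))) =
    of_nat (room m L {..<n} (fst \<circ> s)) *
    (LINT x|(lborel_on {..<n}). bdet {..<n} (fst \<circ> s) x * indicator B (\<lambda>a\<in>{..<n}. (fst (s a), x a)))"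
proof -
  let ?A = "{..<n}"
  have s_in: "s ` ?A \<subseteq> \<Lambda>" and s_inj: "inj_on s ?A"
    using label_mapsD[OF s] by simp_all
  define g :: "(nat \<Rightarrow> real) \<Rightarrow> complex" where "g x = indicator B (\<lambda>a\<in>?A. (fst (s a), x a))" for x
  have pts: "(\<lambda>x. \<lambda>a\<in>?A. (fst (s a), x a)) \<in> measurable (lborel_on ?A) (\<Pi>\<^sub>M a\<in>?A. reference_measure m L)"
    unfolding reference_measure_def
  proof (intro measurable_restrict measurable_Pair measurable_const measurable_component_singleton)
    fix a assume "a \<in> ?A"
    then show "fst (s a) \<in> space (count_space {m+1..m+L})"
      using label_mapsD(3)[OF s] by simp
  qed
  have g: "g \<in> borel_measurable (lborel_on ?A)"
    unfolding g_def by (rule measurable_compose[OF pts borel_measurable_indicator[OF B]])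
  have bd: "(\<lambda>x. bdet ?A (fst \<circ> s) x * g x) \<in> borel_measurable (lborel_on ?A)"
    by (rule borel_measurable_times[OF bdet_measurable g])
  let ?P = "s ` ?A"
  have pull: "(\<lambda>x. \<lambda>a\<in>?A. x (s a)) \<in> measurable (lborel_on ?P) (lborel_on ?A)"
    by (intro measurable_restrict measurable_component_singleton) simp
  have gP: "(\<lambda>x. g (\<lambda>a\<in>?A. x (s a))) \<in> borel_measurable (lborel_on ?P)"
    by (rule measurable_compose[OF pull g])
  have ind: "indicator B (\<lambda>a\<in>?A. (fst (s a), X (s a))) = g (\<lambda>a\<in>?A. restrict X ?P (s a))" for X
  proof -
    have "(\<lambda>a\<in>?A. (fst (s a), (\<lambda>a\<in>?A. restrict X ?P (s a)) a)) = (\<lambda>a\<in>?A. (fst (s a), X (s a)))"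
      by (rule restrict_ext) simp
    then show ?thesis
      by (simp add: g_def)
  qed
  have "of_nat (room m L (?P \<union> (\<Lambda> - ?P)) fst) *
      (LINT X|(lborel_on (?P \<union> (\<Lambda> - ?P))). bdet (?P \<union> (\<Lambda> - ?P)) fst X * g (\<lambda>a\<in>?A. restrict X ?P (s a))) =
    of_nat (room m L ?P fst) * (LINT x|(lborel_on ?P). bdet ?P fst x * g (\<lambda>a\<in>?A. x (s a)))"
    by (rule marginal[OF s_in gP]) (auto simp: g_def indicator_def finite_labels)
  moreover have "?P \<union> (\<Lambda> - ?P) = \<Lambda>"
    using s_in by auto
  ultimately have 1: "(LINT X|(lborel_on \<Lambda>). bdet \<Lambda> fst X * g (\<lambda>a\<in>?A. restrict X ?P (s a))) =
    of_nat (room m L ?P fst) * (LINT x|(lborel_on ?P). bdet ?P fst x * g (\<lambda>a\<in>?A. x (s a)))"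
    by (simp add: room_labels)
  have "bdet ?P fst x = bdet ?A (fst \<circ> s) (\<lambda>a\<in>?A. x (s a))" for x
    unfolding bdet_relabel[OF finite_lessThan s_inj] by (rule bdet_cong) simp_all
  then have 2: "(LINT x|(lborel_on ?P). bdet ?P fst x * g (\<lambda>a\<in>?A. x (s a))) =
      (LINT x|(lborel_on ?A). bdet ?A (fst \<circ> s) x * g x)"
    using integral_PiM_lborel_reindex[OF finite_lessThan s_inj bd] by simp
  have 3: "room m L ?P fst = room m L ?A (fst \<circ> s)"
    unfolding room_def by (simp add: level_count_image[OF s_inj])
  show ?thesis
    unfolding ind 1 2 3 by (simp only: g_def)
qed

lemma integrable_labelled_tuple:
  assumes s: "s \<in> label_maps m L {..<n}" and B: "B \<in> sets (\<Pi>\<^sub>M a\<in>{..<n}. reference_measure m L)"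
  shows "integrable (lborel_on \<Lambda>)
    (\<lambda>X. bdet \<Lambda> fst X * indicator B (\<lambda>a\<in>{..<n}. (fst (s a), X (s a))))"
proof (rule Bochner_Integration.integrable_bound[OF bdet_integrable[OF finite_labels labels_levels]])
  have s_in: "s ` {..<n} \<subseteq> \<Lambda>"
    by (rule label_mapsD[OF s])
  have "(\<lambda>X. \<lambda>a\<in>{..<n}. (fst (s a), X (s a))) \<in> measurable (lborel_on \<Lambda>) (\<Pi>\<^sub>M a\<in>{..<n}. reference_measure m L)"
    unfolding reference_measure_def
  proof (intro measurable_restrict measurable_Pair measurable_const measurable_component_singleton)
    fix a assume "a \<in> {..<n}"
    then show "s a \<in> \<Lambda>" "fst (s a) \<in> space (count_space {m+1..m+L})"
      using s_in label_mapsD(3)[OF s] by auto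
  qed
  from measurable_compose[OF this borel_measurable_indicator[OF B]]
  show "(\<lambda>X. bdet \<Lambda> fst X * indicator B (\<lambda>a\<in>{..<n}. (fst (s a), X (s a)))) \<in> borel_measurable (lborel_on \<Lambda>)"
    by (rule borel_measurable_times[OF bdet_measurable])
qed (auto simp: norm_mult indicator_def)

lemma integrable_tuple_count:
  assumes B: "B \<in> sets (\<Pi>\<^sub>M a\<in>{..<n}. reference_measure m L)"
  shows "integrable (lborel_on \<Lambda>) (\<lambda>X. bdet \<Lambda> fst X * of_nat (tuple_count m L n B X))"
  unfolding tuple_count_eq_sum sum_distrib_left
  by (rule Bochner_Integration.integrable_sum[OF integrable_labelled_tuple[OF _ B]])

text \<open>The labellings \<open>s\<close> of the tuple are grouped by their levels \<open>l\<close>. All labellings in a group give the same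
  integral, and their number times the room left is \<open>\<Prod>\<^sub>k k!\<close>, unless \<open>l\<close> has more than \<open>k\<close> points on some level
  \<open>k\<close>; then there are none, but \<open>bdet\<close> vanishes too.\<close>

lemma integral_bdet_tuple_count:
  assumes B: "B \<in> sets (\<Pi>\<^sub>M a\<in>{..<n}. reference_measure m L)"
  shows "(LINT X|(lborel_on \<Lambda>). bdet \<Lambda> fst X * of_nat (tuple_count m L n B X)) =
    of_nat (\<Prod>k=m+1..m+L. fact k) *
    (\<Sum>l\<in>{..<n} \<rightarrow>\<^sub>E {m+1..m+L}. LINT x|(lborel_on {..<n}).
      bdet {..<n} l x * indicator B (\<lambda>a\<in>{..<n}. (l a, x a)))"
proof -
  let ?A = "{..<n}" and ?S = "label_maps m L {..<n}" and ?V = "{m+1..m+L}"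
  let ?I = "\<lambda>l. LINT x|(lborel_on ?A). bdet ?A l x * indicator B (\<lambda>a\<in>?A. (l a, x a))"
  have fin: "finite ?S"
    by (rule finite_label_maps) simp
  have level: "restrict (fst \<circ> s) ?A \<in> ?A \<rightarrow>\<^sub>E ?V" if "s \<in> ?S" for s
    using label_mapsD(3)[OF that] by (simp only: restrict_PiE_iff o_apply) blast
  have same: "of_nat (room m L ?A (fst \<circ> s)) * ?I (fst \<circ> s) = (of_nat (room m L ?A l) * ?I l :: complex)"
    if "\<forall>a\<in>?A. fst (s a) = l a" for s l
  proof -
    have "room m L ?A (fst \<circ> s) = room m L ?A l"
      unfolding room_def using that by (intro prod.cong refl arg_cong[where f = fact] arg_cong2[where f = minus]
          arg_cong[where f = card]) auto
    moreover have "bdet ?A (fst \<circ> s) x = bdet ?A l x" for x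
      using that by (intro bdet_cong) auto
    moreover have "(\<lambda>a\<in>?A. ((fst \<circ> s) a, x a)) = (\<lambda>a\<in>?A. (l a, x a))" for x :: "nat \<Rightarrow> real"
      using that by (intro restrict_ext) auto
    ultimately show ?thesis
      by (simp only:)
  qed
  have fibre: "(\<Sum>s | s \<in> ?S \<and> restrict (fst \<circ> s) ?A = l. of_nat (room m L ?A (fst \<circ> s)) * ?I (fst \<circ> s)) =
      (of_nat (\<Prod>k=m+1..m+L. fact k) * ?I l :: complex)" if l: "l \<in> ?A \<rightarrow>\<^sub>E ?V" for l
  proof -
    have cl: "restrict (fst \<circ> s) ?A = l \<longleftrightarrow> (\<forall>a\<in>?A. fst (s a) = l a)" for s
    proof
      assume "restrict (fst \<circ> s) ?A = l"
      then show "\<forall>a\<in>?A. fst (s a) = l a"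
        by (metis o_apply restrict_apply')
    next
      assume "\<forall>a\<in>?A. fst (s a) = l a"
      then show "restrict (fst \<circ> s) ?A = l"
        by (intro ext) (use PiE_arb[OF l] in \<open>simp add: restrict_def\<close>)
    qed
    have "(\<Sum>s | s \<in> ?S \<and> restrict (fst \<circ> s) ?A = l. of_nat (room m L ?A (fst \<circ> s)) * ?I (fst \<circ> s)) =
        (\<Sum>s | s \<in> ?S \<and> (\<forall>a\<in>?A. fst (s a) = l a). of_nat (room m L ?A l) * ?I l)"
      unfolding cl by (intro sum.cong refl same) simp
    also have "\<dots> = of_nat (card {s\<in>?S. \<forall>a\<in>?A. fst (s a) = l a} * room m L ?A l) * ?I l"
      by (simp only: sum_constant of_nat_mult mult.assoc)
    also have "\<dots> = of_nat (\<Prod>k=m+1..m+L. fact k) * ?I l"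
    proof (cases "\<forall>k\<in>?V. card {a\<in>?A. l a = k} \<le> k")
      case True
      have "card {s\<in>?S. \<forall>a\<in>?A. fst (s a) = l a} * room m L ?A l = (\<Prod>k=m+1..m+L. fact k)"
        unfolding room_empty[symmetric, where lev = l] using l True by (intro card_label_maps) auto
      then show ?thesis
        by (simp only:)
    next
      case False
      then obtain k where k: "k \<in> ?V" "k < card {a\<in>?A. l a = k}"
        by auto
      have "bdet ?A l x = 0" for x
        using l by (intro bdet_overfull[OF _ _ k]) auto
      then have "?I l = 0"
        by (simp only: mult_zero_left integral_zero)
      then show ?thesis
        by (simp only: mult_zero_right)
    qed
    finally show ?thesis .
  qed
  have "(LINT X|(lborel_on \<Lambda>). bdet \<Lambda> fst X * of_nat (tuple_count m L n B X)) =
      (LINT X|(lborel_on \<Lambda>). (\<Sum>s\<in>?S. bdet \<Lambda> fst X * indicator B (\<lambda>a\<in>?A. (fst (s a), X (s a)))))"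
    unfolding tuple_count_eq_sum sum_distrib_left ..
  also have "\<dots> = (\<Sum>s\<in>?S. (LINT X|(lborel_on \<Lambda>). bdet \<Lambda> fst X * indicator B (\<lambda>a\<in>?A. (fst (s a), X (s a)))))"
    by (rule Bochner_Integration.integral_sum[OF integrable_labelled_tuple[OF _ B]])
  also have "\<dots> = (\<Sum>s\<in>?S. of_nat (room m L ?A (fst \<circ> s)) * ?I (fst \<circ> s))"
    unfolding o_def by (intro sum.cong refl integral_labelled_tuple[OF _ B, unfolded o_def])
  also have "\<dots> = (\<Sum>l\<in>?A \<rightarrow>\<^sub>E ?V. \<Sum>s | s \<in> ?S \<and> restrict (fst \<circ> s) ?A = l.
      of_nat (room m L ?A (fst \<circ> s)) * ?I (fst \<circ> s))"
    by (rule sum.group[symmetric, OF fin finite_PiE image_subsetI[OF level]]) simp_all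
  also have "\<dots> = (\<Sum>l\<in>?A \<rightarrow>\<^sub>E ?V. of_nat (\<Prod>k=m+1..m+L. fact k) * ?I l)"
    by (rule sum.cong[OF refl fibre])
  finally show ?thesis
    by (simp only: sum_distrib_left)
qed

lemma integral_conf_bdet:
  assumes B: "B \<in> sets (\<Pi>\<^sub>M a\<in>{..<n}. reference_measure m L)"
  shows "of_nat (card (level_perms m L)) * (LINT X|conf_measure m L. bdet \<Lambda> fst X * of_nat (tuple_count m L n B X)) =
    of_nat (\<Prod>k=m+1..m+L. fact k) *
    (\<Sum>l\<in>{..<n} \<rightarrow>\<^sub>E {m+1..m+L}. LINT x|(lborel_on {..<n}).
      bdet {..<n} l x * indicator B (\<lambda>a\<in>{..<n}. (l a, x a)))"
proof -
  have "(LINT X|(lborel_on \<Lambda>). bdet \<Lambda> fst X * of_nat (tuple_count m L n B X)) =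
    of_nat (card (level_perms m L)) * (LINT X|conf_measure m L. bdet \<Lambda> fst X * of_nat (tuple_count m L n B X))"
    by (rule integral_symmetrize[OF integrable_tuple_count[OF B]]) (simp_all add: bdet_relabel_symmetric tuple_count_relabel bdet_ties)
  then show ?thesis
    using integral_bdet_tuple_count[OF B] by simp
qed

end

lemma mean_constant:
  assumes Z: "total_weight m L W \<noteq> 0"
  shows "mean m L W (\<lambda>X. c) = c"
proof -
  have "mean m L W (\<lambda>X. c) = (LINT X|conf_measure m L. W X * (c / total_weight m L W))"
    unfolding mean_def by (simp add: mult.commute)
  also have "\<dots> = total_weight m L W * (c / total_weight m L W)"
    unfolding total_weight_def by (rule integral_mult_left_zero)
  finally show ?thesis
    using Z by simp
qed

text \<open>There are no points, so only the correlation function of order \<open>0\<close> has a nonempty domain.\<close>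

lemma determinantal_no_levels:
  assumes Z: "total_weight m 0 W \<noteq> 0"
  shows "determinantal m 0 W K"
  unfolding determinantal_def correlation_function_def
proof (intro allI conjI ballI)
  fix n :: nat
  let ?R = "\<Pi>\<^sub>M a\<in>{..<n}. reference_measure m 0"
  let ?\<rho> = "\<lambda>p. Determinant.det (Matrix.mat n n (\<lambda>(a, b). K (p a) (p b)))"
  have labels: "labels m 0 = {}"
    by (simp add: labels_def)
  have "integrable ?R ?\<rho> \<and> (\<forall>B. mean m 0 W (\<lambda>X. of_nat (tuple_count m 0 n B X)) = (LINT p:B|?R. ?\<rho> p))"
  proof (cases "n = 0")
    case True
    have "tuple_count m 0 n B X = (if (\<lambda>_. undefined) \<in> B then 1 else 0)" for B X
      by (simp add: True tuple_count_def labels restrict_def)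
    moreover have "?\<rho> p = 1" for p
      using True by (simp add: det_dim_zero)
    moreover have "?R = count_space {\<lambda>_. undefined}"
      using True by (simp add: PiM_empty)
    ultimately show ?thesis
      by (simp add: mean_constant[OF Z] set_lebesgue_integral_def lebesgue_integral_count_space_finite
          indicator_def integrable_count_space)
  next
    case False
    have empty: "space ?R = {}"
      using False by (auto simp: reference_measure_def space_PiM space_pair_measure PiE_eq_empty_iff)
    have zero: "(LINT p|?R. f p) = 0" for f :: "(nat \<Rightarrow> nat \<times> real) \<Rightarrow> complex"
      using Bochner_Integration.integral_cong[of ?R ?R f "\<lambda>_. 0"] by (simp add: empty)
    have "integrable ?R ?\<rho>"
      using Bochner_Integration.integrable_cong[of ?R ?R ?\<rho> "\<lambda>_. 0"] by (simp add: empty)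
    moreover have "tuple_count m 0 n B X = 0" for B X
      using False by (simp add: tuple_count_def labels PiE_eq_empty_iff)
    ultimately show ?thesis
      by (simp add: mean_constant[OF Z] set_lebesgue_integral_def zero)
  qed
  then show "integrable ?R ?\<rho>"
    and "mean m 0 W (\<lambda>X. of_nat (tuple_count m 0 n B X)) = (LINT p:B|?R. ?\<rho> p)" for B
    by auto
qed

context bordered
begin

text \<open>The case of no points: there is one empty tuple.\<close>

lemma integral_conf_bdet_total:
  "of_nat (card (level_perms m L)) * (LINT X|conf_measure m L. bdet \<Lambda> fst X) =
    of_nat (\<Prod>k=m+1..m+L. fact k) * Determinant.det gram_mat"
proof -
  let ?B = "{\<lambda>_. undefined} :: (nat \<Rightarrow> nat \<times> real) set"
  have tc: "tuple_count m L 0 ?B X = 1" for X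
    by (simp add: tuple_count_def restrict_def)
  have "?B \<in> sets (\<Pi>\<^sub>M a\<in>{..<0}. reference_measure m L)"
    by (simp add: sets_PiM_empty)
  from integral_conf_bdet[OF this] show ?thesis
    by (simp add: tc PiM_empty lebesgue_integral_count_space_finite bdet_empty restrict_def)
qed

text \<open>The constant between the weight and \<open>bdet\<close>, the number of orderings and \<open>\<Prod>\<^sub>k k!\<close> appear both in the mean
  and in the total weight; the quotient is an integral of \<open>bdet / det G\<close>.\<close>

lemma determinantal_weight:
  assumes xm: "inj_on xm {1..m}" and S: "S = xm ` {1..m}"
    and Z: "total_weight m L (weight m L xm \<phi> \<phi>v \<upsilon> \<psi>) \<noteq> 0"
  shows "determinantal m L (weight m L xm \<phi> \<phi>v \<upsilon> \<psi>) (correlation_kernel m L S \<phi> \<phi>v \<upsilon> \<psi>)"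
proof -
  let ?W = "weight m L xm \<phi> \<phi>v \<upsilon> \<psi>" and ?K = "correlation_kernel m L S \<phi> \<phi>v \<upsilon> \<psi>"
    and ?V = "{m+1..m+L}" and ?G = "Determinant.det gram_mat"
  let ?N = "of_nat (card (level_perms m L)) :: complex" and ?F = "of_nat (\<Prod>k=m+1..m+L. fact k) :: complex"
  obtain c where c: "c \<noteq> 0" and W: "\<And>X. ?W X = c * bdet \<Lambda> fst X"
    using weight_eq_bdet[OF xm S] by blast
  have N: "?N \<noteq> 0"
    using id_level_perm[of m L] finite_level_perms[of m L] by auto
  have cancel: "c / t * i = c * (?N * i) / (?N * t)" for t i
    using N by simp
  have F: "?F \<noteq> 0"
    by simp
  have total: "total_weight m L ?W = c * (LINT X|conf_measure m L. bdet \<Lambda> fst X)"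
    unfolding total_weight_def W by (rule integral_mult_right_zero)
  have NT: "?N * total_weight m L ?W = c * (?F * ?G)"
    unfolding total integral_conf_bdet_total[symmetric] by (simp only: mult_ac)
  then have G: "?G \<noteq> 0"
    using N Z by auto
  show ?thesis
    unfolding determinantal_def
  proof
    fix n :: nat
    let ?A = "{..<n}" and ?R = "\<Pi>\<^sub>M a\<in>{..<n}. reference_measure m L"
    let ?\<rho> = "\<lambda>p. Determinant.det (Matrix.mat n n (\<lambda>(a, b). ?K (p a) (p b)))"
    \<comment> \<open>The determinant of the kernel in a form that is visibly measurable: the levels are separated
      from the positions.\<close>
    define r where "r p = bdet ?A (\<lambda>a\<in>?A. fst (p a)) (\<lambda>a\<in>?A. snd (p a)) / ?G" for p
    have \<rho>: "?\<rho> p = r p" if p: "p \<in> space ?R" for p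
    proof -
      have lev: "fst (p a) \<in> ?V" if "a < n" for a
        using leveled_space[OF p[unfolded reference_measure_def]] that by simp
      have "bdet ?A (\<lambda>a\<in>?A. fst (p a)) (\<lambda>a\<in>?A. snd (p a)) = bdet ?A (fst \<circ> p) (snd \<circ> p)"
        by (rule bdet_cong) simp_all
      also have "\<dots> = ?G * ?\<rho> p"
        by (rule bdet_eq_det_kernel[OF G lev])
      finally show ?thesis
        using G by (simp add: r_def)
    qed
    have r_slice: "r (\<lambda>a\<in>?A. (l a, x a)) = bdet ?A l x / ?G" for l x
    proof -
      have "bdet ?A (\<lambda>a\<in>?A. fst ((\<lambda>a\<in>?A. (l a, x a)) a)) (\<lambda>a\<in>?A. snd ((\<lambda>a\<in>?A. (l a, x a)) a)) = bdet ?A l x"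
        by (rule bdet_cong) simp_all
      then show ?thesis
        by (simp only: r_def)
    qed
    have r_meas: "r \<in> borel_measurable ?R"
      unfolding r_def[abs_def] reference_measure_def
      by (intro leveled_measurable borel_measurable_divide bdet_measurable borel_measurable_const) simp_all
    have int: "integrable (lborel_on ?A) (\<lambda>x. bdet ?A l x / ?G)" if "l \<in> ?A \<rightarrow>\<^sub>E ?V" for l
      using that by (intro integrable_divide bdet_integrable) auto
    have r_int: "integrable ?R r"
      unfolding reference_measure_def
      by (rule leveled_integral(1)[OF finite_lessThan finite_atLeastAtMost r_meas[unfolded reference_measure_def]])
        (simp only: r_slice int)
    show "correlation_function m L ?W n ?\<rho>"
      unfolding correlation_function_def
    proof (intro conjI ballI)
      show "integrable ?R ?\<rho>"
      proof (subst Bochner_Integration.integrable_cong[OF refl])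
        show "?\<rho> p = r p" if "p \<in> space ?R" for p
          using that by (rule \<rho>)
      qed (rule r_int)
      fix B assume B: "B \<in> sets ?R"
      let ?tc = "\<lambda>X. of_nat (tuple_count m L n B X) :: complex"
      let ?I = "\<lambda>l. LINT x|(lborel_on ?A). bdet ?A l x * indicator B (\<lambda>a\<in>?A. (l a, x a))"
      have "mean m L ?W ?tc = (LINT X|conf_measure m L. c / total_weight m L ?W * (bdet \<Lambda> fst X * ?tc X))"
        unfolding mean_def by (intro Bochner_Integration.integral_cong refl) (simp add: W)
      also have "\<dots> = c / total_weight m L ?W * (LINT X|conf_measure m L. bdet \<Lambda> fst X * ?tc X)"
        by (rule integral_mult_right_zero)
      also have "\<dots> = c * (?N * (LINT X|conf_measure m L. bdet \<Lambda> fst X * ?tc X)) / (?N * total_weight m L ?W)"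
        by (rule cancel)
      also have "\<dots> = c * (?F * (\<Sum>l\<in>?A \<rightarrow>\<^sub>E ?V. ?I l)) / (c * (?F * ?G))"
        by (simp only: NT integral_conf_bdet[OF B])
      also have "\<dots> = (\<Sum>l\<in>?A \<rightarrow>\<^sub>E ?V. ?I l) / ?G"
        unfolding mult_divide_mult_cancel_left[OF c] mult_divide_mult_cancel_left[OF F] ..
      finally have lhs: "mean m L ?W ?tc = (\<Sum>l\<in>?A \<rightarrow>\<^sub>E ?V. ?I l) / ?G" .
      let ?f = "\<lambda>p. indicator B p *\<^sub>R r p"
      have f_meas: "?f \<in> borel_measurable ?R"
        by (rule borel_measurable_scaleR[OF borel_measurable_indicator[OF B] r_meas])
      have slice: "?f (\<lambda>a\<in>?A. (l a, x a)) = bdet ?A l x * indicator B (\<lambda>a\<in>?A. (l a, x a)) / ?G" for l x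
        unfolding r_slice by (simp add: indicator_def)
      have f_int: "integrable (lborel_on ?A) (\<lambda>x. ?f (\<lambda>a\<in>?A. (l a, x a)))" if l: "l \<in> ?A \<rightarrow>\<^sub>E ?V" for l
      proof (rule Bochner_Integration.integrable_bound[OF int[OF l]])
        have "(\<lambda>x. \<lambda>a\<in>?A. (l a, x a)) \<in> measurable (lborel_on ?A) ?R"
          unfolding reference_measure_def
          by (intro measurable_restrict measurable_Pair measurable_const measurable_component_singleton)
            (use PiE_mem[OF l] in simp_all)
        then show "(\<lambda>x. ?f (\<lambda>a\<in>?A. (l a, x a))) \<in> borel_measurable (lborel_on ?A)"
          by (rule measurable_compose[OF _ f_meas])
      qed (auto simp: r_slice indicator_def)
      have "(LINT p:B|?R. ?\<rho> p) = (LINT p|?R. ?f p)"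
        unfolding set_lebesgue_integral_def
        by (rule Bochner_Integration.integral_cong[OF refl]) (simp only: \<rho>)
      also have "\<dots> = (\<Sum>l\<in>?A \<rightarrow>\<^sub>E ?V. LINT x|(lborel_on ?A). ?f (\<lambda>a\<in>?A. (l a, x a)))"
        unfolding reference_measure_def
        by (rule leveled_integral(2)[OF finite_lessThan finite_atLeastAtMost f_meas[unfolded reference_measure_def] f_int])
      also have "\<dots> = (\<Sum>l\<in>?A \<rightarrow>\<^sub>E ?V. ?I l / ?G)"
        unfolding slice by (simp only: integral_divide_zero)
      also have "\<dots> = (\<Sum>l\<in>?A \<rightarrow>\<^sub>E ?V. ?I l) / ?G"
        by (rule sum_divide_distrib[symmetric])
      finally show "mean m L ?W ?tc = (LINT p:B|?R. ?\<rho> p)"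
        using lhs by (simp only:)
    qed
  qed
qed

end

theorem theorem2p4:
  fixes m L :: nat and xm :: "nat \<Rightarrow> real"
    and \<phi> :: "real \<Rightarrow> real \<Rightarrow> complex" and \<phi>v :: "real \<Rightarrow> complex"
    and \<upsilon> :: "nat \<Rightarrow> real \<Rightarrow> complex" and \<psi> :: "nat \<Rightarrow> real \<Rightarrow> complex"
  assumes "xm \<in> Conf m"
    and "(\<lambda>(x, y). \<phi> x y) \<in> borel_measurable (borel \<Otimes>\<^sub>M borel)"
    and "\<phi>v \<in> borel_measurable borel"
    and "\<And>j. 1 \<le> j \<Longrightarrow> j \<le> m + L \<Longrightarrow> \<psi> j \<in> borel_measurable borel"
    and "convolutions_converge m L (xm ` {1..m}) \<phi> \<phi>v \<upsilon> \<psi>"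
    and "integrable (conf_measure m L) (weight m L xm \<phi> \<phi>v \<upsilon> \<psi>)"
    and "total_weight m L (weight m L xm \<phi> \<phi>v \<upsilon> \<psi>) \<noteq> 0"
  shows "(\<exists>K. determinantal m L (weight m L xm \<phi> \<phi>v \<upsilon> \<psi>) K) \<and>
    (invertible_mat (gram m L (xm ` {1..m}) \<phi> \<phi>v \<upsilon> \<psi>) \<longrightarrow>
      determinantal m L (weight m L xm \<phi> \<phi>v \<upsilon> \<psi>)
        (correlation_kernel m L (xm ` {1..m}) \<phi> \<phi>v \<upsilon> \<psi>))"
proof (cases "L = 0")
  case True
  then show ?thesis
    using determinantal_no_levels assms(7) by blast
next
  case False
  \<comment> \<open>If two fixed entries coincide, the first determinant of the weight vanishes.\<close>
  have inj: "inj_on xm {1..m}"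
  proof (rule ccontr)
    assume "\<not> inj_on xm {1..m}"
    then obtain i j where "i \<in> {1..m}" "j \<in> {1..m}" "i \<noteq> j" "xm i = xm j"
      by (auto simp: inj_on_def)
    then have "det1 m (\<lambda>i j. \<upsilon> i (xm j)) = 0"
      unfolding det1_eq_pdet by (intro pdet_identical_columns[of _ i j]) simp_all
    then have "total_weight m L (weight m L xm \<phi> \<phi>v \<upsilon> \<psi>) = 0"
      by (simp add: total_weight_def weight_def)
    then show False
      using assms(7) by blast
  qed
  have "bordered \<phi> m L (xm ` {1..m}) \<phi>v \<upsilon> \<psi>"
    using False assms by (intro bordered_of_converge) simp_all
  then have "determinantal m L (weight m L xm \<phi> \<phi>v \<upsilon> \<psi>) (correlation_kernel m L (xm ` {1..m}) \<phi> \<phi>v \<upsilon> \<psi>)"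
    using inj assms(7) by (intro bordered.determinantal_weight) simp_all
  then show ?thesis
    by blast
qed

end
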